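(* Let $\gamma>1$ and let $\mathbf{L}$ be the Leray transform of $M_\gamma$. Then $\mathbf{L}\colon L^2(M_\gamma,\sigma)\to L^2(M_\gamma,\sigma)$ is a bounded projection operator (i.e. $\mathbf L$ is bounded and $\mathbf{L}\circ\mathbf{L}=\mathbf{L}$) with norm $$\|\mathbf{L}\|_{L^2(M_\gamma,\sigma)}=\frac{\gamma}{2\sqrt{\gamma-1}}.$$
   Context: For $\gamma>1$ let $M_\gamma=\{(\zeta_1,\zeta_2)\in\mathbb{C}^2:\operatorname{Im}\zeta_2=|\zeta_1|^\gamma\}$, parametrized up to a null set by $(s,\alpha,\theta)\in\mathbb{R}\times(0,\infty)\times[0,2\pi)$ via $\zeta=(\alpha e^{i\theta},\,s+i\alpha^\gamma)$. The measure $\sigma$ on $M_\gamma$ is $\alpha^{\gamma-1}\,ds\,d\alpha\,d\theta$. Each $f\in L^2(M_\gamma,\sigma)$ has a partial Fourier expansion $f=\sum_{k\in\mathbb{Z}}f_k(s,\alpha)e^{ik\theta}$, and $L^2_k(M_\gamma,\sigma)$ denotes the closed subspace of functions of the form $f_k(s,\alpha)e^{ik\theta}$; $L^2=\bigoplus_k L^2_k$ orthogonally. The Leray transform of $M_\gamma$ is given by $$\mathbf{L}f(z)=\frac{\gamma^2}{8\pi^2 i}\int_{M_\gamma}f(\zeta)\frac{|\zeta_1|^{\gamma-2}\,d\zeta_2\wedge d\bar\zeta_1\wedge d\zeta_1}{[\gamma\bar\zeta_1|\zeta_1|^{\gamma-2}(\zeta_1-z_1)+i(\zeta_2-z_2)]^2}=\frac{\gamma^2}{4\pi^2}\int_{M_\gamma}\frac{f(\zeta)\,d\sigma(\zeta)}{[A-Be^{i(\theta_z-\theta_\zeta)}]^2},$$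 where, for $z=(\alpha_ze^{i\theta_z},s_z+i\alpha_z^\gamma)\in M_\gamma$ and $\zeta=(\alpha_\zeta e^{i\theta_\zeta},s_\zeta+i\alpha_\zeta^\gamma)$, $A=(\gamma-1)\alpha_\zeta^\gamma+\alpha_z^\gamma+i(s_\zeta-s_z)$ and $B=\gamma\alpha_z\alpha_\zeta^{\gamma-1}$ (one has $|B|<|A|$ off the set $s_z=s_\zeta,\alpha_z=\alpha_\zeta$). For $z\in M_\gamma$ the integral is understood by expanding $[A-Be^{i(\theta_z-\theta_\zeta)}]^{-2}=\sum_{k\ge0}(k+1)B^kA^{-k-2}e^{ik(\theta_z-\theta_\zeta)}$ and integrating term by term: $\mathbf{L}f=\sum_{k\ge0}\mathbf{L}_kf$, where $$\mathbf{L}_kf(s_z,\alpha_z,\theta_z)=e^{ik\theta_z}\,\frac{\gamma^2(k+1)}{2\pi}\int_0^\infty\!\int_{-\infty}^\infty\frac{B^k}{A^{k+2}}f_k(s_\zeta,\alpha_\zeta)\,\alpha_\zeta^{\gamma-1}\,ds_\zeta\,d\alpha_\zeta .$$ *)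

theory Defs
  imports "HOL-Analysis.Analysis"
begin

section \<open>Square-integrable functions\<close>

text \<open>
  The space L2 is represented by its functions, not by classes modulo null sets;
  equality in L2 is therefore stated as equality almost everywhere.
\<close>

definition L2 :: "'a measure \<Rightarrow> ('a \<Rightarrow> complex) set" where
  "L2 M = {f \<in> borel_measurable M. integrable M (\<lambda>x. (cmod (f x))\<^sup>2)}"

definition L2_norm :: "'a measure \<Rightarrow> ('a \<Rightarrow> complex) \<Rightarrow> real" where
  "L2_norm M f = sqrt (\<integral>x. (cmod (f x))\<^sup>2 \<partial>M)"

text \<open>
  Membership in L2 is required of all terms: the Bochner integral of a non-integrable
  function is 0, so without it the norm of the error could vanish spuriously.
\<close>

definition L2_sums ::
    "'a measure \<Rightarrow> (nat \<Rightarrow> 'a \<Rightarrow> complex) \<Rightarrow> ('a \<Rightarrow> complex) \<Rightarrow> bool" where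
  "L2_sums M F g \<longleftrightarrow> (\<forall>k. F k \<in> L2 M) \<and> g \<in> L2 M \<and>
     (\<lambda>n. L2_norm M (\<lambda>x. (\<Sum>k<n. F k x) - g x)) \<longlonglongrightarrow> 0"

text \<open>The sum is determined only up to a null set; some representative is chosen.\<close>

definition L2_suminf :: "'a measure \<Rightarrow> (nat \<Rightarrow> 'a \<Rightarrow> complex) \<Rightarrow> 'a \<Rightarrow> complex" where
  "L2_suminf M F = (SOME g. L2_sums M F g)"

definition L2_bounded_operator ::
    "'a measure \<Rightarrow> (('a \<Rightarrow> complex) \<Rightarrow> 'a \<Rightarrow> complex) \<Rightarrow> bool" where
  "L2_bounded_operator M T \<longleftrightarrow>
     (\<forall>f \<in> L2 M. T f \<in> L2 M) \<and>
     (\<forall>f \<in> L2 M. \<forall>g \<in> L2 M. (AE x in M. f x = g x) \<longrightarrow> (AE x in M. T f x = T g x)) \<and>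
     (\<forall>f \<in> L2 M. \<forall>g \<in> L2 M. AE x in M. T (\<lambda>y. f y + g y) x = T f x + T g x) \<and>
     (\<forall>f \<in> L2 M. \<forall>c. AE x in M. T (\<lambda>y. c * f y) x = c * T f x) \<and>
     (\<exists>C. \<forall>f \<in> L2 M. L2_norm M (T f) \<le> C * L2_norm M f)"

text \<open>Same convention as \<^const>\<open>onorm\<close>; meaningful for bounded operators only.\<close>

definition L2_onorm :: "'a measure \<Rightarrow> (('a \<Rightarrow> complex) \<Rightarrow> 'a \<Rightarrow> complex) \<Rightarrow> real" where
  "L2_onorm M T = (SUP f \<in> L2 M. L2_norm M (T f) / L2_norm M f)"


section \<open>The hypersurface and its measure\<close>

definition hypersurface :: "real \<Rightarrow> (complex \<times> complex) set" where
  "hypersurface \<gamma> = {\<zeta>. Im (snd \<zeta>) = cmod (fst \<zeta>) powr \<gamma>}"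

definition surface_point :: "real \<Rightarrow> real \<times> real \<times> real \<Rightarrow> complex \<times> complex" where
  "surface_point \<gamma> = (\<lambda>(s, \<alpha>, \<theta>). (of_real \<alpha> * cis \<theta>, Complex s (\<alpha> powr \<gamma>)))"

definition surface_params :: "(real \<times> real \<times> real) set" where
  "surface_params = UNIV \<times> {0<..} \<times> {0..<2 * pi}"

definition surface_measure :: "real \<Rightarrow> (complex \<times> complex) measure" where
  "surface_measure \<gamma> =
     distr (density (restrict_space lborel surface_params)
              (\<lambda>(s, \<alpha>, \<theta>). ennreal (\<alpha> powr (\<gamma> - 1))))
           (restrict_space borel (hypersurface \<gamma>))
           (surface_point \<gamma>)"

lemma surface_point_in_hypersurface:
  "p \<in> surface_params \<Longrightarrow> surface_point \<gamma> p \<in> hypersurface \<gamma>"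
  by (auto simp: surface_params_def surface_point_def hypersurface_def norm_mult)

lemma surface_point_measurable:
  "surface_point \<gamma> \<in> measurable (restrict_space lborel surface_params)
     (restrict_space borel (hypersurface \<gamma>))"
proof (rule measurable_restrict_space2)
  show "surface_point \<gamma> \<in> space (restrict_space lborel surface_params) \<rightarrow> hypersurface \<gamma>"
    by (auto simp: space_restrict_space intro: surface_point_in_hypersurface)
  have 1: "surface_point \<gamma> = (\<lambda>p. (of_real (fst (snd p)) * cis (snd (snd p)),
      of_real (fst p) + \<i> * of_real (fst (snd p) powr \<gamma>)))"
    by (auto simp: surface_point_def fun_eq_iff complex_eq_iff)
  have "(\<lambda>p :: real \<times> real \<times> real. of_real (fst (snd p)) * cis (snd (snd p))) \<in> borel_measurable borel"
    by (intro borel_measurable_continuous_onI continuous_intros)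
  moreover have "(\<lambda>p. fst (snd p) powr \<gamma>) \<in> borel_measurable (borel :: (real \<times> real \<times> real) measure)"
    by (intro powr_real_measurable borel_measurable_continuous_onI continuous_intros
          borel_measurable_const)
  then have "(\<lambda>p :: real \<times> real \<times> real. complex_of_real (fst p) + \<i> * of_real (fst (snd p) powr \<gamma>))
      \<in> borel_measurable borel"
    by (intro borel_measurable_add borel_measurable_times borel_measurable_of_real
          borel_measurable_const) (auto intro!: borel_measurable_continuous_onI continuous_intros)
  ultimately have 2: "surface_point \<gamma> \<in> borel_measurable borel"
    unfolding 1 by (rule borel_measurable_Pair)
  show "surface_point \<gamma> \<in> measurable (restrict_space lborel surface_params) borel"
    by (rule measurable_restrict_space1) (use 2 in simp)
qed


section \<open>The Leray transform\<close>

definition fourier_coeff ::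
    "real \<Rightarrow> (complex \<times> complex \<Rightarrow> complex) \<Rightarrow> int \<Rightarrow> real \<Rightarrow> real \<Rightarrow> complex" where
  "fourier_coeff \<gamma> f k s \<alpha> =
     (LINT \<theta>:{0..<2 * pi}|lborel. f (surface_point \<gamma> (s, \<alpha>, \<theta>)) * cis (- (of_int k * \<theta>)))
       / (2 * pi)"

definition leray_A :: "real \<Rightarrow> real \<Rightarrow> real \<Rightarrow> real \<Rightarrow> real \<Rightarrow> complex" where
  "leray_A \<gamma> sz \<alpha>z s \<alpha> = Complex ((\<gamma> - 1) * \<alpha> powr \<gamma> + \<alpha>z powr \<gamma>) (s - sz)"

definition leray_B :: "real \<Rightarrow> real \<Rightarrow> real \<Rightarrow> real" where
  "leray_B \<gamma> \<alpha>z \<alpha> = \<gamma> * \<alpha>z * \<alpha> powr (\<gamma> - 1)"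

text \<open>
  The \<open>k\<close>-th term of the Leray transform, obtained from the kernel
  \<open>\<gamma>\<^sup>2 / (4 \<pi>\<^sup>2) (A - B e\<^sup>i\<^sup>t)\<^sup>-\<^sup>2\<close>, \<open>t = \<theta>z - \<theta>\<close>, by expanding it in powers of
  \<open>B e\<^sup>i\<^sup>t / A\<close> and integrating against the measure; the integration over \<open>\<theta>\<close> produces
  \<open>2 \<pi>\<close> times the Fourier coefficient. The point \<open>z\<close> has the parameters
  \<open>(Re (snd z), cmod (fst z), Arg2pi (fst z))\<close>. For \<open>f\<close> in L2 and \<open>fst z \<noteq> 0\<close> the
  double integral converges absolutely.
\<close>

definition leray_term ::
    "real \<Rightarrow> (complex \<times> complex \<Rightarrow> complex) \<Rightarrow> nat \<Rightarrow> complex \<times> complex \<Rightarrow> complex" where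
  "leray_term \<gamma> f k z =
     (let sz = Re (snd z); \<alpha>z = cmod (fst z); \<theta>z = Arg2pi (fst z)
      in cis (real k * \<theta>z) * of_real (\<gamma>\<^sup>2 * (real k + 1) / (2 * pi)) *
         (LINT \<alpha>:{0<..}|lborel. LINT s|lborel.
            of_real (leray_B \<gamma> \<alpha>z \<alpha>) ^ k / leray_A \<gamma> sz \<alpha>z s \<alpha> ^ (k + 2) *
            fourier_coeff \<gamma> f (int k) s \<alpha> * of_real (\<alpha> powr (\<gamma> - 1))))"

text \<open>
  The series of the terms is summed in L2: it is a series of mutually orthogonal functions,
  which for general \<open>f\<close> in L2 need not converge absolutely at individual points.
\<close>

definition leray_transform ::
    "real \<Rightarrow> (complex \<times> complex \<Rightarrow> complex) \<Rightarrow> complex \<times> complex \<Rightarrow> complex" where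
  "leray_transform \<gamma> f = L2_suminf (surface_measure \<gamma>) (leray_term \<gamma> f)"

end

theory Submission
  imports Defs "HOL-Real_Asymp.Real_Asymp"
begin

text \<open>
  The angular variable separates. Expanding the kernel in powers of
  \<open>e\<^sup>i\<^sup>t\<close> shows that the transform maps the \<open>k\<close>-th
  Fourier coefficient \<open>f\<^sub>k(s, \<alpha>)\<close> of \<open>f\<close>, for \<open>k
  \<ge> 0\<close>, to \<open>T\<^sub>k f\<^sub>k\<close>, where \<open>T\<^sub>k\<close> is
  the integral operator with kernel \<open>C B\<^sup>k / A\<^sup>k\<^sup>+\<^sup>2\<close>
  (\<open>leray_mode\<close>), and annihilates the other frequencies. Different
  \<open>k\<close> give orthogonal functions, so that everything reduces to the operators
  \<open>T\<^sub>k\<close> on the functions of \<open>(s, \<alpha>)\<close>: the transform is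
  bounded with norm \<open>sup\<^sub>k \<parallel>T\<^sub>k\<parallel>\<close>, and it is
  idempotent if every \<open>T\<^sub>k\<close> is.

  The operator \<open>T\<^sub>k\<close> is a convolution in \<open>s\<close>. Since
  \<open>A\<close> has positive real part, \<open>A\<^sup>-\<^sup>k\<^sup>-\<^sup>2\<close> is
  the Laplace integral of \<open>\<xi>\<^sup>k\<^sup>+\<^sup>1 e\<^sup>-\<^sup>\<xi>\<^sup>A /
  (k+1)!\<close> over \<open>\<xi> > 0\<close>, and
  \<open>e\<^sup>-\<^sup>\<xi>\<^sup>A\<close> splits into a factor in \<open>z\<close> and a
  factor in \<open>\<zeta>\<close>. Hence \<open>T\<^sub>k\<close> acts at the frequency
  \<open>\<xi> > 0\<close> of \<open>s\<close> as an operator of rank one: it pairs with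
  \<open>\<alpha>\<close> to the power \<open>(\<gamma>-1)k\<close> times
  \<open>exp(-\<xi>(\<gamma>-1)\<alpha>\<^sup>\<gamma>)\<close>, and the result is a multiple
  of \<open>\<alpha>\<^sup>k exp(-\<xi>\<alpha>\<^sup>\<gamma>)\<close>. Both L2 norms are
  values of the Gamma function, and the norm of the rank one operator does not depend on
  \<open>\<xi>\<close>. Its square is \<open>\<gamma>\<^sup>2 / (4(\<gamma>-1))\<close> for
  \<open>k = 0\<close>, and it is not larger for the other \<open>k\<close> because \<open>ln
  \<Gamma>(x+1) - x ln x\<close> is concave (\<open>Gamma_product_bound\<close>). The upper
  bound follows by applying the inequality in the theorem of Plancherel once to analyse
  \<open>u\<close> and once to synthesise \<open>T\<^sub>k u\<close>
  (\<open>leray_mode_energy_le_integrable\<close>), first for integrable \<open>u\<close> and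
  then, by truncation and the lemma of Fatou, for all \<open>u\<close> in L2
  (\<open>leray_mode_bounded\<close>).

  Idempotence is a statement about kernels: integrating the product of the kernels of
  \<open>T\<^sub>k\<close> at \<open>(z, w)\<close> and \<open>(w, \<zeta>)\<close> over
  \<open>w\<close> gives back the kernel at \<open>(z, \<zeta>)\<close>
  (\<open>leray_kernel_reproducing\<close>). In \<open>s\<close> this is a rational integral
  that partial fractions evaluate, and then, in \<open>t = \<alpha>\<^sup>\<gamma>\<close>, a
  beta integral with integer exponents. Rows and columns of the kernel are in L2, which
  justifies Fubini for truncated functions.

  For the lower bound the function \<open>((\<gamma>-1)\<alpha>\<^sup>\<gamma> + 1 -
  is)\<^sup>-\<^sup>2\<close>, the complex conjugate of a row of the kernel of
  \<open>T\<^sub>0\<close>, has an explicit image and attains the norm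
  (\<open>leray_mode_0_extremal\<close>).
\<close>

section \<open>The space L2\<close>

text \<open>
  The squared norm, with values in the extended nonnegative reals: it is meaningful for every
  measurable function, and Fatou and Tonelli apply to it without integrability conditions.
\<close>

definition L2_energy :: "'a measure \<Rightarrow> ('a \<Rightarrow> complex) \<Rightarrow> ennreal" where
  "L2_energy M f = (\<integral>\<^sup>+x. ennreal ((cmod (f x))\<^sup>2) \<partial>M)"

lemma L2_iff_energy: "f \<in> L2 M \<longleftrightarrow> f \<in> borel_measurable M \<and> L2_energy M f < \<infinity>"
  by (auto simp: L2_def L2_energy_def integrable_iff_bounded)

lemma L2_measurable[measurable_dest]: "f \<in> L2 M \<Longrightarrow> f \<in> borel_measurable M"
  by (auto simp: L2_def)

lemma L2_norm_nonneg [simp]: "0 \<le> L2_norm M f"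
  by (simp add: L2_norm_def)

lemma L2_norm_square_energy:
  assumes "f \<in> L2 M"
  shows "ennreal ((L2_norm M f)\<^sup>2) = L2_energy M f"
  using assms by (auto simp: L2_norm_def L2_energy_def L2_def nn_integral_eq_integral)

lemma L2_norm_square: "(L2_norm M f)\<^sup>2 = (\<integral>x. (cmod (f x))\<^sup>2 \<partial>M)"
  by (simp add: L2_norm_def)

lemma L2_from_energy_le:
  assumes "f \<in> borel_measurable M" "L2_energy M f \<le> ennreal (c\<^sup>2)" "0 \<le> c"
  shows "f \<in> L2 M" "L2_norm M f \<le> c"
proof -
  show *: "f \<in> L2 M"
    using assms by (auto simp: L2_iff_energy intro: le_less_trans)
  have "ennreal ((L2_norm M f)\<^sup>2) \<le> ennreal (c\<^sup>2)"
    using assms by (simp add: L2_norm_square_energy[OF *])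
  then have "(L2_norm M f)\<^sup>2 \<le> c\<^sup>2" by (simp add: ennreal_le_iff)
  then show "L2_norm M f \<le> c" using assms(3) power2_le_imp_le by blast
qed

lemma L2_from_energy_le_energy:
  assumes "f \<in> borel_measurable M" "L2_energy M f \<le> ennreal (c\<^sup>2) * L2_energy M' g" "0 \<le> c" "g \<in> L2 M'"
  shows "f \<in> L2 M" "L2_norm M f \<le> c * L2_norm M' g"
proof -
  have e: "ennreal (c\<^sup>2) * L2_energy M' g = ennreal ((c * L2_norm M' g)\<^sup>2)"
    by (simp add: L2_norm_square_energy[OF assms(4), symmetric] power_mult_distrib ennreal_mult)
  show "f \<in> L2 M" "L2_norm M f \<le> c * L2_norm M' g"
    by (rule L2_from_energy_le[of _ _ "c * L2_norm M' g"]; use assms e in simp)+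
qed

lemma L2_energy_cong_AE:
  "AE x in M. f x = g x \<Longrightarrow> L2_energy M f = L2_energy M g"
  unfolding L2_energy_def by (intro nn_integral_cong_AE) auto

lemma L2_norm_cong_AE:
  assumes "f \<in> L2 M" "g \<in> L2 M" "AE x in M. f x = g x"
  shows "L2_norm M f = L2_norm M g"
proof -
  have "ennreal ((L2_norm M f)\<^sup>2) = ennreal ((L2_norm M g)\<^sup>2)"
    using assms by (simp add: L2_norm_square_energy L2_energy_cong_AE)
  then have "(L2_norm M f)\<^sup>2 = (L2_norm M g)\<^sup>2" by simp
  then show ?thesis by simp
qed

lemma cmod_add_square_le: "(cmod (a + b))\<^sup>2 \<le> 2 * (cmod a)\<^sup>2 + 2 * (cmod b)\<^sup>2"
proof -
  have "(cmod (a + b))\<^sup>2 \<le> (cmod a + cmod b)\<^sup>2"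
    by (intro power_mono norm_triangle_ineq) auto
  also have "\<dots> \<le> 2 * (cmod a)\<^sup>2 + 2 * (cmod b)\<^sup>2"
    using sum_squares_ge_zero[of "cmod a - cmod b" 0] by (simp add: power2_eq_square algebra_simps)
  finally show ?thesis .
qed

lemma L2_zero [simp]: "(\<lambda>x. 0) \<in> L2 M" and L2_norm_zero [simp]: "L2_norm M (\<lambda>x. 0) = 0"
  by (auto simp: L2_def L2_norm_def)

lemma L2_add [intro]:
  assumes "f \<in> L2 M" "g \<in> L2 M"
  shows "(\<lambda>x. f x + g x) \<in> L2 M"
proof -
  have [measurable]: "f \<in> borel_measurable M" "g \<in> borel_measurable M"
    using assms by (auto simp: L2_def)
  have "integrable M (\<lambda>x. 2 * (cmod (f x))\<^sup>2 + 2 * (cmod (g x))\<^sup>2)"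
    using assms by (auto simp: L2_def)
  then have "integrable M (\<lambda>x. (cmod (f x + g x))\<^sup>2)"
    by (rule Bochner_Integration.integrable_bound) (auto intro: cmod_add_square_le)
  then show ?thesis by (simp add: L2_def)
qed

lemma L2_cmult [intro]: "f \<in> L2 M \<Longrightarrow> (\<lambda>x. c * f x) \<in> L2 M"
  by (auto simp: L2_def norm_mult power_mult_distrib)

lemma L2_norm_cmult: "L2_norm M (\<lambda>x. c * f x) = cmod c * L2_norm M f"
  by (simp add: L2_norm_def norm_mult power_mult_distrib real_sqrt_mult)

lemma L2_diff [intro]:
  assumes "f \<in> L2 M" "g \<in> L2 M"
  shows "(\<lambda>x. f x - g x) \<in> L2 M"
  using L2_add[OF assms(1) L2_cmult[OF assms(2), of "-1"]] by simp

lemma L2_norm_diff_commute: "L2_norm M (\<lambda>x. f x - g x) = L2_norm M (\<lambda>x. g x - f x)"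
  by (simp add: L2_norm_def norm_minus_commute)

lemma L2_sum [intro]: "(\<And>i. i \<in> I \<Longrightarrow> F i \<in> L2 M) \<Longrightarrow> (\<lambda>x. \<Sum>i\<in>I. F i x) \<in> L2 M"
  by (induction I rule: infinite_finite_induct) auto

lemma L2_cnj [intro]: "f \<in> L2 M \<Longrightarrow> (\<lambda>x. cnj (f x)) \<in> L2 M"
  by (auto simp: L2_def intro: measurable_compose[OF _ borel_measurable_continuous_onI] continuous_intros)

lemma L2_mult_integrable:
  assumes "f \<in> L2 M" "g \<in> L2 M"
  shows "integrable M (\<lambda>x. f x * g x)"
proof -
  have [measurable]: "f \<in> borel_measurable M" "g \<in> borel_measurable M"
    using assms by (auto simp: L2_def)
  have "integrable M (\<lambda>x. (cmod (f x))\<^sup>2 + (cmod (g x))\<^sup>2)"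
    using assms by (auto simp: L2_def)
  then show ?thesis
  proof (rule Bochner_Integration.integrable_bound)
    have "cmod a * cmod b \<le> (cmod a)\<^sup>2 + (cmod b)\<^sup>2" for a b
      using sum_squares_bound[of "cmod a" "cmod b"] mult_nonneg_nonneg[OF norm_ge_zero[of a] norm_ge_zero[of b]]
      by linarith
    then show "AE x in M. norm (f x * g x) \<le> norm ((cmod (f x))\<^sup>2 + (cmod (g x))\<^sup>2)"
      by (auto simp: norm_mult)
  qed auto
qed

text \<open>
  The quadratic polynomial \<open>\<integral> (t |f| - |g|)\<^sup>2\<close> in the real
  variable \<open>t\<close> is nonnegative; its value at the minimum is the inequality.
\<close>

lemma L2_Cauchy_Schwarz_norm:
  assumes "f \<in> L2 M" "g \<in> L2 M"
  shows "(\<integral>x. cmod (f x * g x) \<partial>M) \<le> L2_norm M f * L2_norm M g"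
proof -
  define I where "I = (\<integral>x. cmod (f x * g x) \<partial>M)"
  define A where "A = (\<integral>x. (cmod (f x))\<^sup>2 \<partial>M)"
  define B where "B = (\<integral>x. (cmod (g x))\<^sup>2 \<partial>M)"
  have int: "integrable M (\<lambda>x. (cmod (f x))\<^sup>2)" "integrable M (\<lambda>x. (cmod (g x))\<^sup>2)"
      "integrable M (\<lambda>x. cmod (f x * g x))"
    using assms L2_mult_integrable[OF assms] by (auto simp: L2_def)
  have [simp]: "A \<ge> 0" "B \<ge> 0" "I \<ge> 0" by (auto simp: A_def B_def I_def)
  have quad: "0 \<le> t\<^sup>2 * A - 2 * t * I + B" for t
  proof -
    have "0 \<le> (\<integral>x. (t * cmod (f x) - cmod (g x))\<^sup>2 \<partial>M)" by simp
    also have "\<dots> = (\<integral>x. (t\<^sup>2 * (cmod (f x))\<^sup>2 - 2 * t * cmod (f x * g x)) + (cmod (g x))\<^sup>2 \<partial>M)"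
      by (intro Bochner_Integration.integral_cong refl)
         (simp add: power2_eq_square norm_mult algebra_simps)
    also have "\<dots> = t\<^sup>2 * A - 2 * t * I + B"
      using int by (simp add: A_def B_def I_def)
    finally show ?thesis .
  qed
  have "I\<^sup>2 \<le> A * B"
  proof (cases "A = 0")
    case True
    have "AE x in M. (cmod (f x))\<^sup>2 = 0"
      using int(1) True by (simp add: A_def integral_nonneg_eq_0_iff_AE)
    then have "AE x in M. cmod (f x * g x) = 0" by auto
    then have "I = 0" unfolding I_def by (subst integral_eq_zero_AE) auto
    then show ?thesis by simp
  next
    case False
    have "A > 0" using False by (simp add: order.strict_iff_order)
    then show ?thesis using quad[of "I / A"] False
      by (simp add: power2_eq_square field_simps)
  qed
  then have "I \<le> sqrt (A * B)" by (rule real_le_rsqrt)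
  then show ?thesis by (simp add: I_def A_def B_def L2_norm_def real_sqrt_mult)
qed

lemma L2_Cauchy_Schwarz:
  assumes "f \<in> L2 M" "g \<in> L2 M"
  shows "cmod (\<integral>x. f x * g x \<partial>M) \<le> L2_norm M f * L2_norm M g"
  using L2_Cauchy_Schwarz_norm[OF assms] integral_norm_bound[of M "\<lambda>x. f x * g x"] by linarith

lemma L2_norm_triangle:
  assumes "f \<in> L2 M" "g \<in> L2 M"
  shows "L2_norm M (\<lambda>x. f x + g x) \<le> L2_norm M f + L2_norm M g"
proof -
  have int: "integrable M (\<lambda>x. (cmod (f x))\<^sup>2)" "integrable M (\<lambda>x. (cmod (g x))\<^sup>2)"
      "integrable M (\<lambda>x. cmod (f x * g x))" "integrable M (\<lambda>x. (cmod (f x + g x))\<^sup>2)"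
    using assms L2_mult_integrable[OF assms] L2_add[OF assms] by (auto simp: L2_def)
  have "(cmod (f x + g x))\<^sup>2 \<le> (cmod (f x))\<^sup>2 + 2 * cmod (f x * g x) + (cmod (g x))\<^sup>2" for x
  proof -
    have "(cmod (f x + g x))\<^sup>2 \<le> (cmod (f x) + cmod (g x))\<^sup>2"
      by (intro power_mono norm_triangle_ineq) auto
    then show ?thesis by (simp add: power2_eq_square norm_mult algebra_simps)
  qed
  then have "(L2_norm M (\<lambda>x. f x + g x))\<^sup>2 \<le>
      (\<integral>x. (cmod (f x))\<^sup>2 + 2 * cmod (f x * g x) + (cmod (g x))\<^sup>2 \<partial>M)"
    unfolding L2_norm_square using int by (intro integral_mono) auto
  also have "\<dots> = (L2_norm M f)\<^sup>2 + 2 * (\<integral>x. cmod (f x * g x) \<partial>M) + (L2_norm M g)\<^sup>2"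
    using int by (simp add: L2_norm_square)
  also have "\<dots> \<le> (L2_norm M f + L2_norm M g)\<^sup>2"
    using L2_Cauchy_Schwarz_norm[OF assms] by (simp add: power2_eq_square algebra_simps)
  finally show ?thesis by (rule power2_le_imp_le) simp
qed

lemma L2_norm_triangle_diff:
  assumes "f \<in> L2 M" "g \<in> L2 M" "h \<in> L2 M"
  shows "L2_norm M (\<lambda>x. f x - h x) \<le> L2_norm M (\<lambda>x. f x - g x) + L2_norm M (\<lambda>x. g x - h x)"
  using L2_norm_triangle[OF L2_diff[OF assms(1,2)] L2_diff[OF assms(2,3)]] by simp

lemma L2_norm_eq_0_AE:
  assumes "f \<in> L2 M" "L2_norm M f = 0"
  shows "AE x in M. f x = 0"
proof -
  have "(\<integral>x. (cmod (f x))\<^sup>2 \<partial>M) = 0" using assms(2) by (simp add: L2_norm_def)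
  then have "AE x in M. (cmod (f x))\<^sup>2 = 0"
    using assms(1) by (subst (asm) integral_nonneg_eq_0_iff_AE) (auto simp: L2_def)
  then show ?thesis by auto
qed

text \<open>
  Fatou: a bound on the energies survives pointwise limits.
\<close>

lemma L2_energy_liminf_le:
  assumes [measurable]: "\<And>n. F n \<in> borel_measurable M"
    and lim: "AE x in M. (\<lambda>n. F n x) \<longlonglongrightarrow> f x"
    and bound: "\<forall>\<^sub>F n in sequentially. L2_energy M (F n) \<le> C"
  shows "L2_energy M f \<le> C"
proof -
  have "L2_energy M f = (\<integral>\<^sup>+x. liminf (\<lambda>n. ennreal ((cmod (F n x))\<^sup>2)) \<partial>M)"
    unfolding L2_energy_def
  proof (rule nn_integral_cong_AE, use lim in eventually_elim)
    case (elim x)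
    then have "(\<lambda>n. ennreal ((cmod (F n x))\<^sup>2)) \<longlonglongrightarrow> ennreal ((cmod (f x))\<^sup>2)"
      by (intro tendsto_intros)
    from lim_imp_Liminf[OF _ this] show ?case by simp
  qed
  also have "\<dots> \<le> liminf (\<lambda>n. L2_energy M (F n))"
    unfolding L2_energy_def by (rule nn_integral_liminf) simp
  also have "\<dots> \<le> C"
    using bound Liminf_le[OF sequentially_bot, of "\<lambda>n. L2_energy M (F n)" C] by simp
  finally show ?thesis .
qed

text \<open>
  Riesz and Fischer. Along a subsequence with consecutive distances at most
  \<open>2\<^sup>-\<^sup>j\<close> the function \<open>\<Sum>j. 2\<^sup>j
  d\<^sub>j\<^sup>2\<close> of the pointwise distances \<open>d\<^sub>j\<close> is integrable,
  hence finite almost everywhere. There \<open>d\<^sub>j\<close> decays geometrically, so that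
  the subsequence converges pointwise, and Fatou shows that the pointwise limit is the limit
  in L2.
\<close>

lemma L2_complete:
  assumes F: "\<And>n. F n \<in> L2 M"
    and Cauchy: "\<And>e::real. e > 0 \<Longrightarrow> \<exists>N. \<forall>m\<ge>N. \<forall>n\<ge>N. L2_norm M (\<lambda>x. F m x - F n x) \<le> e"
  shows "\<exists>g\<in>L2 M. (\<lambda>n. L2_norm M (\<lambda>x. F n x - g x)) \<longlonglongrightarrow> 0"
proof -
  have [measurable]: "\<And>n. F n \<in> borel_measurable M" using F by (auto simp: L2_def)
  have "\<forall>j. \<exists>N. \<forall>m\<ge>N. \<forall>n\<ge>N. L2_norm M (\<lambda>x. F m x - F n x) \<le> (1/2)^j"
    by (auto intro!: Cauchy)
  then obtain N where N: "\<And>j m n. m \<ge> N j \<Longrightarrow> n \<ge> N j \<Longrightarrow> L2_norm M (\<lambda>x. F m x - F n x) \<le> (1/2)^j"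
    by metis
  define r where "r j = (\<Sum>i\<le>j. N i)" for j
  have r_ge: "r j \<ge> N j" for j unfolding r_def by (rule member_le_sum) auto
  have r_mono: "r j \<le> r (Suc j)" for j by (simp add: r_def)
  have r_mono': "i \<le> j \<Longrightarrow> r i \<le> r j" for i j using lift_Suc_mono_le[of r] r_mono by blast
  \<comment> \<open>Finiteness of this weighted sum of squares forces \<open>d j x\<close> below \<open>2\<^sup>-\<^sup>j\<^sup>/\<^sup>2\<close> eventually.\<close>
  define d where "d j x = cmod (F (r (Suc j)) x - F (r j) x)" for j x
  have [measurable]: "d j \<in> borel_measurable M" for j unfolding d_def by measurable
  have d: "(\<integral>\<^sup>+x. ennreal ((d j x)\<^sup>2) \<partial>M) \<le> ennreal ((1/4)^j)" for j
  proof -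
    have "(\<integral>\<^sup>+x. ennreal ((d j x)\<^sup>2) \<partial>M) = ennreal ((L2_norm M (\<lambda>x. F (r (Suc j)) x - F (r j) x))\<^sup>2)"
      using L2_norm_square_energy[OF L2_diff[OF F F]] by (simp add: d_def L2_energy_def)
    also have "\<dots> \<le> ennreal (((1/2)^j)\<^sup>2)"
      using N[of j "r (Suc j)" "r j"] r_ge[of j] r_mono[of j]
      by (intro ennreal_leI power_mono) auto
    also have "((1/2::real)^j)\<^sup>2 = (1/4)^j"
      by (simp add: power2_eq_square flip: power_mult_distrib)
    finally show ?thesis .
  qed
  have "(\<integral>\<^sup>+x. (\<Sum>j. ennreal (2^j * (d j x)\<^sup>2)) \<partial>M) = (\<Sum>j. \<integral>\<^sup>+x. ennreal (2^j * (d j x)\<^sup>2) \<partial>M)"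
    by (rule nn_integral_suminf) simp
  also have "\<dots> \<le> (\<Sum>j. ennreal ((1/2)^j))"
  proof (rule suminf_le)
    fix j
    have "(\<integral>\<^sup>+x. ennreal (2^j * (d j x)\<^sup>2) \<partial>M) = ennreal (2^j) * (\<integral>\<^sup>+x. ennreal ((d j x)\<^sup>2) \<partial>M)"
      by (simp add: ennreal_mult nn_integral_cmult)
    also have "\<dots> \<le> ennreal (2^j) * ennreal ((1/4)^j)"
      by (intro mult_left_mono d) simp
    also have "\<dots> = ennreal ((1/2)^j)"
      by (simp add: ennreal_mult[symmetric] power_mult_distrib[symmetric])
    finally show "(\<integral>\<^sup>+x. ennreal (2^j * (d j x)\<^sup>2) \<partial>M) \<le> ennreal ((1/2)^j)" .
  qed auto
  also have "\<dots> = ennreal 2"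
    using suminf_geometric[of "1/2::real"] by (subst suminf_ennreal2) (auto intro: summable_geometric)
  finally have "(\<integral>\<^sup>+x. (\<Sum>j. ennreal (2^j * (d j x)\<^sup>2)) \<partial>M) \<noteq> \<infinity>"
    unfolding infinity_ennreal_def by (rule neq_top_trans[OF ennreal_neq_top])
  then have "AE x in M. (\<Sum>j. ennreal (2^j * (d j x)\<^sup>2)) \<noteq> \<infinity>"
    by (intro nn_integral_PInf_AE) auto
  then have conv: "AE x in M. convergent (\<lambda>j. F (r j) x)"
  proof eventually_elim
    case (elim x)
    then have "summable (\<lambda>j. 2^j * (d j x)\<^sup>2)"
      by (intro summable_suminf_not_top) auto
    then have "(\<lambda>j. 2^j * (d j x)\<^sup>2) \<longlonglongrightarrow> 0" by (rule summable_LIMSEQ_zero)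
    then have "\<forall>\<^sub>F j in sequentially. 2^j * (d j x)\<^sup>2 < 1"
      by (rule order_tendstoD) simp
    moreover have "summable (\<lambda>j. sqrt (1/2) ^ j)" by (intro summable_geometric) (simp add: real_sqrt_lt_1_iff)
    ultimately have "summable (\<lambda>j. F (r (Suc j)) x - F (r j) x)"
    proof (elim summable_comparison_test_ev[rotated])
      assume "\<forall>\<^sub>F j in sequentially. 2^j * (d j x)\<^sup>2 < 1"
      then show "\<forall>\<^sub>F j in sequentially. norm (F (r (Suc j)) x - F (r j) x) \<le> sqrt (1/2) ^ j"
      proof eventually_elim
        case (elim j)
        have "(d j x)\<^sup>2 \<le> (1/2)^j" using elim by (simp add: field_simps)
        also have "\<dots> = (sqrt (1/2) ^ j)\<^sup>2"
          by (simp add: power2_eq_square flip: power_mult_distrib)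
        finally have "d j x \<le> sqrt (1/2) ^ j" by (rule power2_le_imp_le) simp
        then show ?case by (simp add: d_def)
      qed
    qed
    then have "convergent (\<lambda>n. \<Sum>j<n. F (r (Suc j)) x - F (r j) x)"
      by (simp add: summable_iff_convergent)
    then have "convergent (\<lambda>n. (F (r n) x - F (r 0) x))"
      by (simp only: sum_lessThan_telescope[of "\<lambda>j. F (r j) x"])
    then have "convergent (\<lambda>n. (F (r n) x - F (r 0) x) + F (r 0) x)"
      by (rule convergent_add) (rule convergent_const)
    then show ?case by simp
  qed
  define g where "g x = lim (\<lambda>j. F (r j) x)" for x
  have [measurable]: "g \<in> borel_measurable M" unfolding g_def by (rule borel_measurable_lim_metric) simp
  have lim: "AE x in M. (\<lambda>j. F (r j) x) \<longlonglongrightarrow> g x"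
    using conv by eventually_elim (simp add: g_def convergent_LIMSEQ_iff)
  have close: "(\<lambda>x. F n x - g x) \<in> L2 M \<and> L2_norm M (\<lambda>x. F n x - g x) \<le> (1/2)^i" if "n \<ge> N i" for n i
  proof -
    have "L2_energy M (\<lambda>x. F n x - g x) \<le> ennreal (((1/2)^i)\<^sup>2)"
    proof (rule L2_energy_liminf_le)
      show "AE x in M. (\<lambda>j. F n x - F (r j) x) \<longlonglongrightarrow> F n x - g x"
        using lim by eventually_elim (intro tendsto_intros)
      show "\<forall>\<^sub>F j in sequentially. L2_energy M (\<lambda>x. F n x - F (r j) x) \<le> ennreal (((1/2)^i)\<^sup>2)"
      proof (rule eventually_sequentiallyI)
        fix j assume "i \<le> j"
        then have "r j \<ge> N i" using r_ge[of i] r_mono' order_trans by blast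
        from N[OF that this] show "L2_energy M (\<lambda>x. F n x - F (r j) x) \<le> ennreal (((1/2)^i)\<^sup>2)"
          by (subst L2_norm_square_energy[symmetric]) (auto intro!: F ennreal_leI power_mono)
      qed
    qed simp
    then show ?thesis using L2_from_energy_le[of "\<lambda>x. F n x - g x" M "(1/2)^i"] by simp
  qed
  have "(\<lambda>x. F (N 0) x - (F (N 0) x - g x)) \<in> L2 M"
    by (rule L2_diff[OF F]) (use close[of 0 "N 0"] in auto)
  then have "g \<in> L2 M" by simp
  moreover have "(\<lambda>n. L2_norm M (\<lambda>x. F n x - g x)) \<longlonglongrightarrow> 0"
  proof (rule LIMSEQ_I)
    fix e :: real assume "e > 0"
    then obtain i where i: "(1/2)^i < e" using real_arch_pow_inv[of e "1/2"] by auto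
    show "\<exists>n0. \<forall>n\<ge>n0. norm (L2_norm M (\<lambda>x. F n x - g x) - 0) < e"
      using close[of i] i by (intro exI[of _ "N i"]) (auto intro: le_less_trans)
  qed
  ultimately show ?thesis by blast
qed

lemma L2_limit_unique:
  assumes F: "\<And>n. F n \<in> L2 M" and g: "g \<in> L2 M" and h: "h \<in> L2 M"
    and limg: "(\<lambda>n. L2_norm M (\<lambda>x. F n x - g x)) \<longlonglongrightarrow> 0"
    and limh: "(\<lambda>n. L2_norm M (\<lambda>x. F n x - h x)) \<longlonglongrightarrow> 0"
  shows "AE x in M. g x = h x"
proof -
  have "L2_norm M (\<lambda>x. g x - h x) \<le> L2_norm M (\<lambda>x. F n x - g x) + L2_norm M (\<lambda>x. F n x - h x)" for n
    using L2_norm_triangle_diff[OF g F h, of n] by (simp add: L2_norm_diff_commute[of M g])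
  then have "L2_norm M (\<lambda>x. g x - h x) \<le> 0 + 0"
    by (intro LIMSEQ_le_const[OF tendsto_add[OF limg limh]]) auto
  then have "L2_norm M (\<lambda>x. g x - h x) = 0" using L2_norm_nonneg[of M "\<lambda>x. g x - h x"] by linarith
  from L2_norm_eq_0_AE[OF L2_diff[OF g h] this] show ?thesis by auto
qed


section \<open>Rational integrals on the line\<close>

lemma integral_line_FTC:
  fixes f F :: "real \<Rightarrow> complex"
  assumes F: "\<And>x. (F has_vector_derivative f x) (at x)"
    and f: "continuous_on UNIV f" "integrable lborel f"
    and A: "(F \<longlongrightarrow> A) at_bot" and B: "(F \<longlongrightarrow> B) at_top"
  shows "(\<integral>x. f x \<partial>lborel) = B - A"
proof -
  have "(LBINT x=-\<infinity>..\<infinity>. f x) = B - A"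
    by (rule interval_integral_FTC_integrable[where F=F])
       (use assms in \<open>auto simp: ereal_tendsto_simps set_integrable_def continuous_on_eq_continuous_at\<close>)
  then show ?thesis by (simp add: interval_lebesgue_integral_def set_lebesgue_integral_def)
qed

lemma integral_halfline_FTC:
  fixes f F :: "real \<Rightarrow> complex"
  assumes F: "\<And>x. x > 0 \<Longrightarrow> (F has_vector_derivative f x) (at x)"
    and f: "\<And>x. x > 0 \<Longrightarrow> isCont f x" "set_integrable lborel {0<..} f"
    and A: "(F \<longlongrightarrow> A) (at_right 0)" and B: "(F \<longlongrightarrow> B) at_top"
  shows "(LINT x:{0<..}|lborel. f x) = B - A"
proof -
  have "(LBINT x=ereal 0..\<infinity>. f x) = B - A"
    by (rule interval_integral_FTC_integrable[where F=F])
       (use assms in \<open>auto simp: ereal_tendsto_simps simp del: zero_ereal_def ereal_eq_0\<close>)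
  then show ?thesis by (simp add: interval_integral_to_infinity_eq)
qed

lemma integrable_inverse_quadratic:
  assumes "a > 0"
  shows "integrable lborel (\<lambda>s::real. 1 / (a\<^sup>2 + (s + b)\<^sup>2))"
    and "(\<integral>s. 1 / (a\<^sup>2 + (s + b)\<^sup>2) \<partial>lborel) = pi / a"
proof -
  have pos: "0 < a\<^sup>2 + (s + b)\<^sup>2" for s using assms by (simp add: add_pos_nonneg)
  have deriv: "((\<lambda>s. arctan ((s + b) / a) / a) has_real_derivative 1 / (a\<^sup>2 + (s + b)\<^sup>2)) (at s)" for s
  proof -
    have "a\<^sup>2 + (s + b)\<^sup>2 = a\<^sup>2 * (1 + ((s + b) / a)\<^sup>2)"
      using assms by (simp add: field_simps power2_eq_square)
    then have "inverse (1 + ((s + b) / a)\<^sup>2) * (1 / a) / a = 1 / (a\<^sup>2 + (s + b)\<^sup>2)"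
      by (simp add: divide_inverse power2_eq_square)
    moreover have "((\<lambda>s. arctan ((s + b) / a) / a) has_real_derivative inverse (1 + ((s + b) / a)\<^sup>2) * (1 / a) / a) (at s)"
      using assms by (auto intro!: derivative_eq_intros)
    ultimately show ?thesis by simp
  qed
  have top: "((\<lambda>s. arctan ((s + b) / a) / a) \<longlongrightarrow> (pi/2) / a) at_top"
    by (intro tendsto_divide tendsto_const filterlim_compose[OF tendsto_arctan_at_top])
       (use assms in real_asymp, use assms in auto)
  have bot: "((\<lambda>s. arctan ((s + b) / a) / a) \<longlongrightarrow> (-(pi/2)) / a) at_bot"
    by (intro tendsto_divide tendsto_const filterlim_compose[OF tendsto_arctan_at_bot])
       (use assms in real_asymp, use assms in auto)
  let ?f = "\<lambda>s. 1 / (a\<^sup>2 + (s + b)\<^sup>2)" and ?F = "\<lambda>s. arctan ((s + b) / a) / a"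
  have cont: "isCont ?f s" for s
    using pos[of s] by (intro continuous_intros) auto
  have lims: "((?F \<circ> real_of_ereal) \<longlongrightarrow> (-(pi/2)) / a) (at_right (-\<infinity>))"
    "((?F \<circ> real_of_ereal) \<longlongrightarrow> (pi/2) / a) (at_left \<infinity>)"
    using top bot by (simp_all only: ereal_tendsto_simps)
  have nonneg: "AE s in lborel. -\<infinity> < ereal s \<longrightarrow> ereal s < \<infinity> \<longrightarrow> 0 \<le> ?f s"
    using pos by (auto simp: less_imp_le)
  have "set_integrable lborel (einterval (-\<infinity>) \<infinity>) ?f"
    "(LBINT s=-\<infinity>..\<infinity>. ?f s) = (pi/2) / a - (-(pi/2)) / a"
    by (rule interval_integral_FTC_nonneg[OF _ deriv cont nonneg lims]; simp)+
  then show "integrable lborel (\<lambda>s::real. 1 / (a\<^sup>2 + (s + b)\<^sup>2))"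
    "(\<integral>s. 1 / (a\<^sup>2 + (s + b)\<^sup>2) \<partial>lborel) = pi / a"
    by (auto simp: set_integrable_def interval_lebesgue_integral_def set_lebesgue_integral_def)
qed

text \<open>
  The substitution \<open>t = \<alpha>\<^sup>\<gamma>\<close>, which removes the real exponent
  \<open>\<gamma>\<close> from the integrals over \<open>\<alpha>\<close>. The half-line is
  exhausted by compact intervals on which the derivative of the substitution is continuous.
\<close>

lemma nn_integral_powr_substitution:
  fixes F :: "real \<Rightarrow> ennreal"
  assumes [measurable]: "F \<in> borel_measurable borel" and g: "\<gamma> > 0"
  shows "(\<integral>\<^sup>+\<alpha>. F (\<alpha> powr \<gamma>) * ennreal (indicator {0<..} \<alpha> * \<alpha> powr (\<gamma> - 1)) \<partial>lborel)
       = ennreal (1 / \<gamma>) * (\<integral>\<^sup>+t. F t * indicator {0<..} t \<partial>lborel)"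
proof -
  define a where "a n = 1 / (real n + 2)" for n
  define b where "b n = real n + 2" for n
  define G where "G \<alpha> = F (\<alpha> powr \<gamma>) * ennreal (\<alpha> powr (\<gamma> - 1))" for \<alpha>
  have [measurable]: "G \<in> borel_measurable borel" unfolding G_def by measurable
  have ab: "0 < a n" "a n < b n" "0 < b n" for n
    by (auto simp: a_def b_def field_simps intro!: add_pos_nonneg)
  have mono: "a n \<le> a m" "b m \<le> b n" if "m \<le> n" for m n using that by (auto simp: a_def b_def field_simps)
  have cover: "\<exists>n. a n \<le> x \<and> x \<le> b n" if "x > 0" for x
  proof -
    obtain n1 where "1 / x < real n1" using reals_Archimedean2 by blast
    moreover obtain n2 where "x < real n2" using reals_Archimedean2 by blast
    ultimately have "1 / x \<le> real (n1 + n2) + 2" "x \<le> real (n1 + n2) + 2" by auto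
    then show ?thesis using that by (intro exI[of _ "n1 + n2"]) (auto simp: a_def b_def field_simps)
  qed
  have step: "(\<integral>\<^sup>+\<alpha>. G \<alpha> * indicator {a n..b n} \<alpha> \<partial>lborel)
      = ennreal (1 / \<gamma>) * (\<integral>\<^sup>+t. F t * indicator {a n powr \<gamma>..b n powr \<gamma>} t \<partial>lborel)" for n
  proof -
    have "(\<integral>\<^sup>+t. F t * indicator {a n powr \<gamma>..b n powr \<gamma>} t \<partial>lborel) =
        (\<integral>\<^sup>+x. F (x powr \<gamma>) * ennreal (\<gamma> * x powr (\<gamma> - 1)) * indicator {a n..b n} x \<partial>lborel)"
    proof (rule nn_integral_substitution_aux)
      show "((\<lambda>x. x powr \<gamma>) has_real_derivative \<gamma> * x powr (\<gamma> - 1)) (at x)" if "x \<in> {a n..b n}" for x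
        using that ab(1)[of n] by (auto intro!: derivative_eq_intros)
      show "continuous_on {a n..b n} (\<lambda>x. \<gamma> * x powr (\<gamma> - 1))"
        using ab(1)[of n] by (intro continuous_intros) auto
    qed (use g ab in auto)
    also have "\<dots> = ennreal \<gamma> * (\<integral>\<^sup>+\<alpha>. G \<alpha> * indicator {a n..b n} \<alpha> \<partial>lborel)"
      using g by (subst nn_integral_cmult[symmetric])
        (auto simp: G_def ennreal_mult mult_ac intro!: nn_integral_cong)
    finally show ?thesis
      using g by (simp add: mult.assoc[symmetric] ennreal_mult[symmetric])
  qed
  have U: "(\<Union>n. {a n..b n}) = {0<..}"
  proof (intro equalityI subsetI)
    fix x assume "x \<in> (\<Union>n. {a n..b n})"
    then obtain n where "a n \<le> x" by auto
    then show "x \<in> {0<..}" using ab(1)[of n] by simp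
  qed (use cover in auto)
  have U': "(\<Union>n. {a n powr \<gamma>..b n powr \<gamma>}) = {0<..}"
  proof (intro equalityI subsetI)
    fix x assume "x \<in> (\<Union>n. {a n powr \<gamma>..b n powr \<gamma>})"
    then obtain n where "a n powr \<gamma> \<le> x" by auto
    moreover have "a n powr \<gamma> > 0" using ab(1)[of n] by simp
    ultimately show "x \<in> {0<..}" by (meson greaterThan_iff less_le_trans)
  next
    fix x :: real assume "x \<in> {0<..}"
    then obtain n where n: "a n \<le> x powr (1 / \<gamma>)" "x powr (1 / \<gamma>) \<le> b n" using cover[of "x powr (1 / \<gamma>)"] by auto
    have "a n powr \<gamma> \<le> (x powr (1 / \<gamma>)) powr \<gamma>" "(x powr (1 / \<gamma>)) powr \<gamma> \<le> b n powr \<gamma>"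
      using n g ab(1)[of n] by (auto intro!: powr_mono2)
    then show "x \<in> (\<Union>n. {a n powr \<gamma>..b n powr \<gamma>})"
      using g \<open>x \<in> {0<..}\<close> by (auto simp: powr_powr)
  qed
  have inc: "incseq (\<lambda>n. {a n..b n})" "incseq (\<lambda>n. {a n powr \<gamma>..b n powr \<gamma>})"
  proof -
    show "incseq (\<lambda>n. {a n..b n})"
      unfolding incseq_def using mono by (intro allI impI subsetI) (meson atLeastAtMost_iff order_trans)
    have "a n powr \<gamma> \<le> a m powr \<gamma>" "b m powr \<gamma> \<le> b n powr \<gamma>" if "m \<le> n" for m n
      using mono[OF that] ab(1)[of n] ab(3)[of m] g by (auto intro!: powr_mono2)
    then show "incseq (\<lambda>n. {a n powr \<gamma>..b n powr \<gamma>})"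
      unfolding incseq_def by (intro allI impI subsetI) (meson atLeastAtMost_iff order_trans)
  qed
  have "(\<integral>\<^sup>+\<alpha>. F (\<alpha> powr \<gamma>) * ennreal (indicator {0<..} \<alpha> * \<alpha> powr (\<gamma> - 1)) \<partial>lborel) = (\<integral>\<^sup>+\<alpha>. G \<alpha> * indicator {0<..} \<alpha> \<partial>lborel)"
    by (intro nn_integral_cong) (auto simp: G_def indicator_def)
  also have "\<dots> = emeasure (density lborel G) (\<Union>n. {a n..b n})"
    unfolding U by (simp add: emeasure_density)
  also have "\<dots> = (SUP n. emeasure (density lborel G) {a n..b n})"
    using inc by (intro SUP_emeasure_incseq[symmetric]) auto
  also have "\<dots> = (SUP n. ennreal (1 / \<gamma>) * emeasure (density lborel F) {a n powr \<gamma>..b n powr \<gamma>})"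
    by (simp add: emeasure_density step)
  also have "\<dots> = ennreal (1 / \<gamma>) * (SUP n. emeasure (density lborel F) {a n powr \<gamma>..b n powr \<gamma>})"
    by (rule SUP_mult_left_ennreal[symmetric])
  also have "(SUP n. emeasure (density lborel F) {a n powr \<gamma>..b n powr \<gamma>}) = emeasure (density lborel F) (\<Union>n. {a n powr \<gamma>..b n powr \<gamma>})"
    using inc by (intro SUP_emeasure_incseq) auto
  also have "\<dots> = (\<integral>\<^sup>+t. F t * indicator {0<..} t \<partial>lborel)"
    unfolding U' by (simp add: emeasure_density)
  finally show ?thesis .
qed

lemma cmod_linear_ge: "Re p \<le> cmod (p + \<i> * of_real s)"
  using complex_Re_le_cmod[of "p + \<i> * of_real s"] by simp

lemma integrable_inverse_linear_power:
  assumes "Re p > 0" "m \<ge> 2"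
  shows "integrable lborel (\<lambda>s. 1 / cmod (p + \<i> * of_real s) ^ m)"
proof (rule Bochner_Integration.integrable_bound)
  show "integrable lborel (\<lambda>s. (1 / Re p ^ (m - 2)) * (1 / ((Re p)\<^sup>2 + (s + Im p)\<^sup>2)))"
    by (intro integrable_mult_right integrable_inverse_quadratic assms)
  show "AE s in lborel. norm (1 / cmod (p + \<i> * of_real s) ^ m)
     \<le> norm (1 / Re p ^ (m - 2) * (1 / ((Re p)\<^sup>2 + (s + Im p)\<^sup>2)))"
  proof (intro AE_I2)
    fix s
    have e: "cmod (p + \<i> * of_real s) ^ m = cmod (p + \<i> * of_real s) ^ (m - 2) * ((Re p)\<^sup>2 + (s + Im p)\<^sup>2)"
      using assms(2) by (subst le_add_diff_inverse2[OF assms(2), symmetric], subst power_add)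
        (simp add: cmod_power2 add.commute)
    have "Re p ^ (m - 2) \<le> cmod (p + \<i> * of_real s) ^ (m - 2)"
      using assms by (intro power_mono cmod_linear_ge) auto
    then show "norm (1 / cmod (p + \<i> * of_real s) ^ m)
     \<le> norm (1 / Re p ^ (m - 2) * (1 / ((Re p)\<^sup>2 + (s + Im p)\<^sup>2)))"
      unfolding e using assms by (auto simp: divide_simps add_pos_nonneg intro!: mult_right_mono)
  qed
qed simp

lemma linear_nonzero: "Re p > 0 \<Longrightarrow> p + \<i> * of_real s \<noteq> 0" "Re p > 0 \<Longrightarrow> p - \<i> * of_real s \<noteq> 0"
  by (auto simp: complex_eq_iff)

lemma cmod_minus_reflect: "cmod (q - \<i> * of_real s) = cmod (cnj q + \<i> * of_real s)"
  by (subst complex_mod_cnj[symmetric]) simp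

text \<open>
  In the composition of two kernels the two factors depend on the intermediate
  \<open>s\<close> through \<open>p + i s\<close> and \<open>q - i s\<close>, where
  \<open>p\<close> and \<open>q\<close> have positive real part.
\<close>

definition line_integrand :: "complex \<Rightarrow> complex \<Rightarrow> nat \<Rightarrow> nat \<Rightarrow> real \<Rightarrow> complex" where
  "line_integrand p q m n s = 1 / ((p + \<i> * of_real s) ^ m * (q - \<i> * of_real s) ^ n)"

lemma line_integrand_measurable [measurable]: "line_integrand p q m n \<in> borel_measurable borel"
  unfolding line_integrand_def by measurable

text \<open>
  For positive exponents the integrand is a product of two square-integrable functions; if one
  exponent is zero, the other factor alone decays quadratically.
\<close>

lemma integrable_line_integrand:
  assumes pq: "Re p > 0" "Re q > 0" and mn: "m + n \<ge> 2"
  shows "integrable lborel (line_integrand p q m n)"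
proof -
  let ?P = "\<lambda>s. cmod (p + \<i> * of_real s)" and ?Q = "\<lambda>s. cmod (cnj q + \<i> * of_real s)"
  have n: "norm (line_integrand p q m n s) = 1 / ?P s ^ m * (1 / ?Q s ^ n)" for s
    unfolding line_integrand_def norm_divide norm_mult norm_power cmod_minus_reflect by simp
  consider "m = 0" | "n = 0" | "m \<ge> 1" "n \<ge> 1" by linarith
  then show ?thesis
  proof cases
    case 1
    show ?thesis
      by (rule Bochner_Integration.integrable_bound[OF integrable_inverse_linear_power[of "cnj q" n]])
         (use 1 assms n in auto)
  next
    case 2
    show ?thesis
      by (rule Bochner_Integration.integrable_bound[OF integrable_inverse_linear_power[of p m]])
         (use 2 assms n in auto)
  next
    case 3
    show ?thesis
    proof (rule Bochner_Integration.integrable_bound)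
      show "integrable lborel (\<lambda>s. 1 / ?P s ^ (2 * m) + 1 / ?Q s ^ (2 * n))"
        using 3 pq by (intro Bochner_Integration.integrable_add integrable_inverse_linear_power) auto
      have "x * y \<le> x\<^sup>2 + y\<^sup>2" if "x \<ge> 0" "y \<ge> 0" for x y :: real
        using sum_squares_bound[of x y] mult_nonneg_nonneg[OF that] by linarith
      from this[of "1 / ?P s ^ m" "1 / ?Q s ^ n" for s]
      show "AE s in lborel. norm (line_integrand p q m n s) \<le> norm (1 / ?P s ^ (2 * m) + 1 / ?Q s ^ (2 * n))"
        unfolding n by (auto simp: power_divide power_mult[symmetric] mult.commute[of _ 2])
    qed simp
  qed
qed

lemma line_integral_commute:
  "(\<integral>s. line_integrand p q m n s \<partial>lborel) = (\<integral>s. line_integrand q p n m s \<partial>lborel)"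
  by (subst lborel_integral_real_affine[where c="-1" and t=0]) (simp_all add: line_integrand_def[abs_def] mult.commute)

lemma line_integral_one_sided:
  fixes p q :: complex
  assumes pq: "Re p > 0" "Re q > 0" and m: "m \<ge> 2"
  shows "(\<integral>s. line_integrand p q m 0 s \<partial>lborel) = 0"
proof -
  obtain k where k: "m = Suc (Suc k)" using m by (metis Suc_le_D numeral_2_eq_2 Suc_le_mono)
  define F where "F s = \<i> / of_nat (Suc k) * inverse (p + \<i> * of_real s) ^ Suc k" for s
  have lim: "((\<lambda>s::real. inverse (p + \<i> * of_real s)) \<longlongrightarrow> 0) at_top"
     "((\<lambda>s::real. inverse (p + \<i> * of_real s)) \<longlongrightarrow> 0) at_bot"
  proof -
    have b: "\<bar>Im p + s\<bar> \<le> norm (p + \<i> * of_real s)" for s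
      using abs_Im_le_cmod[of "p + \<i> * of_real s"] by simp
    have "filterlim (\<lambda>s. \<bar>Im p + s\<bar>) at_top at_top" "filterlim (\<lambda>s. \<bar>Im p + s\<bar>) at_top at_bot"
      by real_asymp+
    then have "filterlim (\<lambda>s. norm (p + \<i> * of_real s)) at_top at_top" "filterlim (\<lambda>s. norm (p + \<i> * of_real s)) at_top at_bot"
      by (auto elim!: filterlim_at_top_mono intro!: always_eventually b)
    then show "((\<lambda>s::real. inverse (p + \<i> * of_real s)) \<longlongrightarrow> 0) at_top"
     "((\<lambda>s::real. inverse (p + \<i> * of_real s)) \<longlongrightarrow> 0) at_bot"
      by (auto intro!: filterlim_compose[OF tendsto_inverse_0] filterlim_norm_at_top_imp_at_infinity)
  qed
  have "(\<integral>s. line_integrand p q m 0 s \<partial>lborel) = 0 - 0"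
  proof (rule integral_line_FTC)
    show "(F has_vector_derivative line_integrand p q m 0 x) (at x)" for x
    proof -
      have n: "p + \<i> * of_real x \<noteq> 0" using linear_nonzero(1)[OF pq(1)] .
      have "((\<lambda>z. \<i> / of_nat (Suc k) * inverse (p + \<i> * z) ^ Suc k) has_field_derivative
          \<i> / of_nat (Suc k) * (of_nat (Suc k) * inverse (p + \<i> * of_real x) ^ k * - (inverse (p + \<i> * of_real x) * \<i> * inverse (p + \<i> * of_real x))))
             (at (of_real x))"
        by (rule derivative_eq_intros refl n | simp)+
      also have "\<i> / of_nat (Suc k) * (of_nat (Suc k) * inverse (p + \<i> * of_real x) ^ k * - (inverse (p + \<i> * of_real x) * \<i> * inverse (p + \<i> * of_real x)))
         = line_integrand p q m 0 x"
        unfolding line_integrand_def k by (simp add: divide_inverse power_inverse mult_ac del: of_nat_Suc)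
      finally have "((\<lambda>z. \<i> / of_nat (Suc k) * inverse (p + \<i> * z) ^ Suc k) has_field_derivative line_integrand p q m 0 x) (at (of_real x))" .
      from has_vector_derivative_real_field[OF this] show ?thesis by (simp add: F_def[abs_def])
    qed
    show "continuous_on UNIV (line_integrand p q m 0)"
      unfolding line_integrand_def using linear_nonzero(1)[OF pq(1)] by (intro continuous_intros) auto
    show "integrable lborel (line_integrand p q m 0)"
      using pq m by (intro integrable_line_integrand) auto
    show "(F \<longlongrightarrow> 0) at_top" "(F \<longlongrightarrow> 0) at_bot"
      unfolding F_def
      using tendsto_mult[OF tendsto_const[of "\<i> / of_nat (Suc k)"] tendsto_power[OF lim(1), of "Suc k"]]
        tendsto_mult[OF tendsto_const[of "\<i> / of_nat (Suc k)"] tendsto_power[OF lim(2), of "Suc k"]]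
      by (simp_all only: power_0_Suc mult_zero_right)
  qed
  then show ?thesis by simp
qed

text \<open>
  The only case with a logarithmic primitive. Factoring the real number \<open>s\<close> out
  of both arguments removes the divergent part \<open>ln |s|\<close>, and what remains tends
  to \<open>Ln \<i> - Ln (-\<i>)\<close>.
\<close>

lemma line_integral_1_1:
  fixes p q :: complex
  assumes pq: "Re p > 0" "Re q > 0"
  shows "(\<integral>s. line_integrand p q 1 1 s \<partial>lborel) = 2 * pi / (p + q)"
proof -
  define F where "F s = (- \<i> / (p + q)) * (Ln (p + \<i> * of_real s) - Ln (q - \<i> * of_real s))" for s
  have nz: "p + q \<noteq> 0" using pq by (auto simp: complex_eq_iff)
  have top: "((\<lambda>s. Ln (p' + \<i> * of_real s) - Ln (q' - \<i> * of_real s)) \<longlongrightarrow> \<i> * pi) at_top"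
    if "Re p' > 0" "Re q' > 0" for p' q'
  proof (rule Lim_transform_eventually)
    have "((\<lambda>s::real. Ln (p' / of_real s + \<i>) - Ln (q' / of_real s - \<i>)) \<longlongrightarrow> Ln (0 + \<i>) - Ln (0 - \<i>)) at_top"
      by (intro tendsto_intros tendsto_divide_0[OF tendsto_const]
          filterlim_of_real_at_infinity) (auto simp: complex_nonpos_Reals_iff)
    also have "Ln (0 + \<i>) - Ln (0 - \<i>) = \<i> * pi"
      by simp
    finally show "((\<lambda>s::real. Ln (p' / of_real s + \<i>) - Ln (q' / of_real s - \<i>)) \<longlongrightarrow> \<i> * pi) at_top" .
    show "\<forall>\<^sub>F s in at_top. Ln (p' / of_real s + \<i>) - Ln (q' / of_real s - \<i>) = Ln (p' + \<i> * of_real s) - Ln (q' - \<i> * of_real s)"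
      using eventually_gt_at_top[of 0]
    proof eventually_elim
      case (elim s)
      have "p' + \<i> * of_real s = of_real s * (p' / of_real s + \<i>)" "q' - \<i> * of_real s = of_real s * (q' / of_real s - \<i>)"
        using elim by (auto simp: field_simps)
      moreover have "p' / of_real s + \<i> \<noteq> 0" "q' / of_real s - \<i> \<noteq> 0"
        using that elim by (auto simp: complex_eq_iff)
      ultimately show ?case using elim by (simp add: Ln_times_of_real)
    qed
  qed
  have "(\<integral>s. line_integrand p q 1 1 s \<partial>lborel) = (- \<i> / (p + q)) * (\<i> * pi) - (- \<i> / (p + q)) * (- (\<i> * pi))"
  proof (rule integral_line_FTC)
    show "(F has_vector_derivative line_integrand p q 1 1 x) (at x)" for x
    proof -
      have n: "p + \<i> * of_real x \<noteq> 0" "q - \<i> * of_real x \<noteq> 0" using linear_nonzero pq by auto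
      have "((\<lambda>z. (- \<i> / (p + q)) * (Ln (p + \<i> * z) - Ln (q - \<i> * z))) has_field_derivative
              (- \<i> / (p + q)) * (\<i> / (p + \<i> * of_real x) - (-\<i>) / (q - \<i> * of_real x))) (at (of_real x))"
        using pq by (auto intro!: derivative_eq_intros simp: complex_nonpos_Reals_iff divide_inverse)
      also have "(- \<i> / (p + q)) * (\<i> / (p + \<i> * of_real x) - (-\<i>) / (q - \<i> * of_real x)) = line_integrand p q 1 1 x"
      proof -
        define P Q where "P = p + \<i> * of_real x" and "Q = q - \<i> * of_real x"
        have S: "p + q = P + Q" by (simp add: P_def Q_def)
        have "\<i> / P - (-\<i>) / Q = \<i> * (P + Q) / (P * Q)"
          using n by (simp add: P_def[symmetric] Q_def[symmetric] field_simps)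
        moreover have "(- \<i> / T) * (\<i> * T / R) = 1 / R" if "T \<noteq> 0" "R \<noteq> 0" for T R
          using that by (simp add: field_simps)
        from this[of "P + Q" "P * Q"] have "(- \<i> / (P + Q)) * (\<i> * (P + Q) / (P * Q)) = 1 / (P * Q)"
          using nz n by (simp only: S) (simp add: P_def Q_def)
        ultimately have "(- \<i> / (P + Q)) * (\<i> / P - (-\<i>) / Q) = 1 / (P * Q)" by metis
        then show ?thesis by (simp add: line_integrand_def P_def[symmetric] Q_def[symmetric] S)
      qed
      finally show ?thesis by (drule_tac has_vector_derivative_real_field) (simp add: F_def[abs_def])
    qed
    show "continuous_on UNIV (line_integrand p q 1 1)"
      unfolding line_integrand_def using linear_nonzero pq by (intro continuous_intros) auto
    show "integrable lborel (line_integrand p q 1 1)"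
      using pq by (intro integrable_line_integrand) auto
    show "(F \<longlongrightarrow> (- \<i> / (p + q)) * (\<i> * pi)) at_top"
      unfolding F_def by (intro tendsto_mult tendsto_const top pq)
    have "((\<lambda>s. - (Ln (q + \<i> * of_real s) - Ln (p - \<i> * of_real s))) \<longlongrightarrow> - (\<i> * pi)) at_top"
      by (intro tendsto_minus top pq)
    then show "(F \<longlongrightarrow> (- \<i> / (p + q)) * (- (\<i> * pi))) at_bot"
      unfolding F_def filterlim_at_bot_mirror by (intro tendsto_mult tendsto_const) simp
  qed
  also have "\<dots> = 2 * pi / (p + q)" by (simp add: field_simps)
  finally show ?thesis .
qed

text \<open>
  Partial fractions: \<open>p + q = (p + i s) + (q - i s)\<close> gives the recursion of
  Pascal's triangle in the two exponents, up to the factor \<open>p + q\<close>. The terms in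
  which one exponent has become zero vanish.
\<close>

lemma line_integral:
  fixes p q :: complex
  assumes pq: "Re p > 0" "Re q > 0"
  shows "(\<integral>s. line_integrand p q (Suc m) (Suc n) s \<partial>lborel)
      = 2 * pi * of_nat ((m + n) choose m) / (p + q) ^ Suc (m + n)"
proof (induction "m + n" arbitrary: m n rule: less_induct)
  case less
  have nz: "p + q \<noteq> 0" using pq by (auto simp: complex_eq_iff)
  have div: "X = C / (p + q) ^ Suc k" if "(p + q) * X = C / (p + q) ^ k" for X C k
    using that nz by (metis divide_divide_eq_left' nonzero_mult_div_cancel_left power_Suc)
  have rec: "(p + q) * (\<integral>s. line_integrand p q (Suc m) (Suc n) s \<partial>lborel) =
     (\<integral>s. line_integrand p q (Suc m) n s \<partial>lborel) + (\<integral>s. line_integrand p q m (Suc n) s \<partial>lborel)"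
    if "m + n \<ge> 1" for m n
  proof -
    have "(p + q) * line_integrand p q (Suc m) (Suc n) s = line_integrand p q (Suc m) n s + line_integrand p q m (Suc n) s" for s
      using linear_nonzero(1)[OF pq(1), of s] linear_nonzero(2)[OF pq(2), of s]
      by (simp add: line_integrand_def divide_simps)
    then have "(\<integral>s. (p + q) * line_integrand p q (Suc m) (Suc n) s \<partial>lborel) =
       (\<integral>s. line_integrand p q (Suc m) n s + line_integrand p q m (Suc n) s \<partial>lborel)" by simp
    also have "\<dots> = (\<integral>s. line_integrand p q (Suc m) n s \<partial>lborel) + (\<integral>s. line_integrand p q m (Suc n) s \<partial>lborel)"
      using pq that by (intro Bochner_Integration.integral_add integrable_line_integrand) auto
    finally show ?thesis by simp
  qed
  have z: "(\<integral>s. line_integrand p q (Suc (Suc m)) 0 s \<partial>lborel) = 0"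
     "(\<integral>s. line_integrand p q 0 (Suc (Suc m)) s \<partial>lborel) = 0" for m
    using line_integral_one_sided[OF pq, of "Suc (Suc m)"] line_integral_one_sided[OF pq(2,1), of "Suc (Suc m)"]
    by (simp_all add: line_integral_commute[of p q 0])
  consider "m = 0" "n = 0" | m' where "m = Suc m'" "n = 0" | n' where "m = 0" "n = Suc n'" | m' n' where "m = Suc m'" "n = Suc n'"
    by (cases m; cases n) auto
  then show ?case
  proof cases
    case 1 then show ?thesis using line_integral_1_1[OF pq] by simp
  next
    case 2
    have "(p + q) * (\<integral>s. line_integrand p q (Suc m) (Suc n) s \<partial>lborel) = 2 * pi / (p + q) ^ Suc m'"
      using rec[of m n] z less[of m' 0] 2 by simp
    from div[OF this] show ?thesis using 2 by simp
  next
    case 3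
    have "(p + q) * (\<integral>s. line_integrand p q (Suc m) (Suc n) s \<partial>lborel) = 2 * pi / (p + q) ^ Suc n'"
      using rec[of m n] z less[of 0 n'] 3 by simp
    from div[OF this] show ?thesis using 3 by simp
  next
    case 4
    have "(p + q) * (\<integral>s. line_integrand p q (Suc m) (Suc n) s \<partial>lborel) =
        complex_of_real (2 * pi) * (of_nat ((m + n') choose m) + of_nat ((m' + n) choose m')) / (p + q) ^ Suc (m' + n)"
      using rec[of m n] less[of m n'] less[of m' n] 4 by (simp add: add_divide_distrib distrib_left del: binomial_Suc_Suc)
    also have "(m + n') choose m = (m + n') choose (Suc m')" using 4 by simp
    also have "of_nat ((m + n') choose (Suc m')) + of_nat ((m' + n) choose m') = (of_nat ((m + n) choose m) :: complex)"
      using 4 by (simp add: of_nat_add[symmetric] del: of_nat_add)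
    finally have "(p + q) * (\<integral>s. line_integrand p q (Suc m) (Suc n) s \<partial>lborel) =
        complex_of_real (2 * pi) * of_nat ((m + n) choose m) / (p + q) ^ Suc (m' + n)" .
    from div[OF this] show ?thesis using 4 by simp
  qed
qed


section \<open>Integrals on the half-line\<close>

lemma nn_integral_Gamma_scaled:
  assumes x: "x \<ge> 0" and b: "b > 0"
  shows "(\<integral>\<^sup>+t. ennreal (t powr x * exp (- (b * t))) * indicator {0<..} t \<partial>lborel)
     = ennreal (Gamma (x + 1) / b powr (x + 1))"
proof -
  have "ennreal (Gamma (x + 1)) = (\<integral>\<^sup>+t. ennreal (indicator {0..} t * t powr x / exp t) \<partial>lborel)"
    using Gamma_conv_nn_integral_real[of "x + 1"] x by simp
  also have "\<dots> = ennreal b * (\<integral>\<^sup>+t. ennreal (indicator {0..} (b * t) * (b * t) powr x / exp (b * t)) \<partial>lborel)"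
    using b by (subst nn_integral_real_affine[where c=b and t=0]) auto
  also have "(\<integral>\<^sup>+t. ennreal (indicator {0..} (b * t) * (b * t) powr x / exp (b * t)) \<partial>lborel) =
      (\<integral>\<^sup>+t. ennreal (b powr x) * (ennreal (t powr x * exp (- (b * t))) * indicator {0<..} t) \<partial>lborel)"
  proof (rule nn_integral_cong_AE, rule AE_mp[OF AE_lborel_singleton[of 0]], intro AE_I2 impI)
    fix t :: real assume "t \<noteq> 0"
    then consider "t > 0" | "t < 0" by linarith
    then show "ennreal (indicator {0..} (b * t) * (b * t) powr x / exp (b * t)) =
      ennreal (b powr x) * (ennreal (t powr x * exp (- (b * t))) * indicator {0<..} t)"
    proof cases
      case 1
      then show ?thesis using b
        by (simp add: powr_mult exp_minus divide_inverse mult.assoc flip: ennreal_mult')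
    next
      case 2
      then have "b * t < 0" using b by (simp add: mult_pos_neg)
      then show ?thesis using 2 by simp
    qed
  qed
  also have "\<dots> = ennreal (b powr x) * (\<integral>\<^sup>+t. ennreal (t powr x * exp (- (b * t))) * indicator {0<..} t \<partial>lborel)"
    by (rule nn_integral_cmult) simp
  finally have "ennreal (Gamma (x + 1)) = ennreal (b powr (x + 1)) * (\<integral>\<^sup>+t. ennreal (t powr x * exp (- (b * t))) * indicator {0<..} t \<partial>lborel)"
    using b by (simp add: powr_add ennreal_mult mult_ac)
  then have "ennreal (1 / b powr (x + 1)) * ennreal (Gamma (x + 1)) = (ennreal (1 / b powr (x + 1)) * ennreal (b powr (x + 1))) * (\<integral>\<^sup>+t. ennreal (t powr x * exp (- (b * t))) * indicator {0<..} t \<partial>lborel)"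
    by (simp only: mult.assoc)
  moreover have "ennreal (1 / b powr (x + 1)) * ennreal (b powr (x + 1)) = 1"
    using b by (simp add: ennreal_mult[symmetric])
  ultimately show ?thesis by (simp add: ennreal_mult'[symmetric])
qed

lemma cmod_exp_Laplace: "cmod (exp (- (of_real \<xi> * A))) = exp (- (\<xi> * Re A))"
  by (simp add: norm_exp)

lemma Laplace_power_integrable:
  assumes A: "Re A > 0"
  shows "set_integrable lborel {0<..} (\<lambda>\<xi>. of_real \<xi> ^ n * exp (- (of_real \<xi> * A)))"
  unfolding set_integrable_def
proof (rule integrableI_bounded)
  have "(\<integral>\<^sup>+\<xi>. ennreal (norm (indicat_real {0<..} \<xi> *\<^sub>R (of_real \<xi> ^ n * exp (- (of_real \<xi> * A))))) \<partial>lborel)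
     = (\<integral>\<^sup>+t. ennreal (t powr real n * exp (- (Re A * t))) * indicator {0<..} t \<partial>lborel)"
    by (intro nn_integral_cong)
       (auto simp: indicator_def norm_mult norm_power cmod_exp_Laplace powr_realpow mult.commute)
  also have "\<dots> < \<infinity>" using nn_integral_Gamma_scaled[of "real n" "Re A"] A by simp
  finally show "(\<integral>\<^sup>+\<xi>. ennreal (norm (indicat_real {0<..} \<xi> *\<^sub>R (of_real \<xi> ^ n * exp (- (of_real \<xi> * A))))) \<partial>lborel) < \<infinity>" .
qed simp

text \<open>
  Induction on the exponent, by parts: the derivative of \<open>\<xi>\<^sup>n\<^sup>+\<^sup>1
  e\<^sup>-\<^sup>\<xi>\<^sup>A / A\<close> integrates to zero. The parameter \<open>A\<close>
  is complex, so that this is not just a rescaling of the Gamma integral.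
\<close>

lemma Laplace_power:
  assumes A: "Re A > 0"
  shows "(LINT \<xi>:{0<..}|lborel. of_real \<xi> ^ n * exp (- (of_real \<xi> * A))) = fact n / A ^ Suc n"
proof (induction n)
  have A0: "A \<noteq> 0" using A by auto
  have top: "((\<lambda>\<xi>. of_real \<xi> ^ n * exp (- (of_real \<xi> * A))) \<longlongrightarrow> 0) at_top" for n
  proof (rule tendsto_norm_zero_cancel)
    have "((\<lambda>\<xi>. \<bar>\<xi>\<bar> ^ n * exp (- (\<xi> * Re A))) \<longlongrightarrow> 0) at_top" using A by real_asymp
    then show "((\<lambda>\<xi>. norm (of_real \<xi> ^ n * exp (- (of_real \<xi> * A)))) \<longlongrightarrow> 0) at_top"
      by (simp add: norm_mult norm_power cmod_exp_Laplace)
  qed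
  {
    case 0
    have "(LINT \<xi>:{0<..}|lborel. exp (- (of_real \<xi> * A))) = 0 - (- 1 / A)"
    proof (rule integral_halfline_FTC)
      show "((\<lambda>\<xi>. - exp (- (of_real \<xi> * A)) / A) has_vector_derivative exp (- (of_real x * A))) (at x)" for x
      proof -
        have "((\<lambda>\<xi>. - exp (- (\<xi> * A)) / A) has_field_derivative exp (- (of_real x * A))) (at (of_real x))"
          using A0 by (auto intro!: derivative_eq_intros)
        from has_vector_derivative_real_field[OF this] show ?thesis .
      qed
      show "set_integrable lborel {0<..} (\<lambda>\<xi>. exp (- (of_real \<xi> * A)))"
        using Laplace_power_integrable[OF A, of 0] by simp
      have "((\<lambda>\<xi>. - exp (- (of_real \<xi> * A)) / A) \<longlongrightarrow> - exp (- (of_real 0 * A)) / A) (at_right 0)"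
        by (intro tendsto_intros) (use A0 in auto)
      then show "((\<lambda>\<xi>. - exp (- (of_real \<xi> * A)) / A) \<longlongrightarrow> - 1 / A) (at_right 0)" by simp
      have "((\<lambda>\<xi>. - exp (- (of_real \<xi> * A)) / A) \<longlongrightarrow> - 0 / A) at_top"
        by (intro tendsto_divide tendsto_minus tendsto_const A0) (use top[of 0] in simp)
      then show "((\<lambda>\<xi>. - exp (- (of_real \<xi> * A)) / A) \<longlongrightarrow> 0) at_top" by simp
    qed (auto intro!: continuous_intros simp: A0)
    then show ?case by simp
  next
    case (Suc n)
    let ?f = "\<lambda>n \<xi>. of_real \<xi> ^ n * exp (- (of_real \<xi> * A))"
    note diff = set_integral_diff[OF Laplace_power_integrable[OF A, of "Suc n"]
        set_integrable_mult_right[OF Laplace_power_integrable[OF A, of n], of "of_nat (Suc n) / A"]]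
    have "(LINT \<xi>:{0<..}|lborel. ?f (Suc n) \<xi> - of_nat (Suc n) / A * ?f n \<xi>) = 0 - 0"
    proof (rule integral_halfline_FTC)
      show "((\<lambda>\<xi>. - ?f (Suc n) \<xi> / A) has_vector_derivative ?f (Suc n) x - of_nat (Suc n) / A * ?f n x) (at x)" for x
      proof -
        have "((\<lambda>\<xi>. - (\<xi> ^ Suc n * exp (- (\<xi> * A))) / A) has_field_derivative
              - (of_nat (Suc n) * of_real x ^ n * exp (- (of_real x * A)) + exp (- (of_real x * A)) * - A * of_real x ^ Suc n) / A) (at (of_real x))"
          by (rule derivative_eq_intros refl A0 | simp del: power_Suc of_nat_Suc)+
        also have "- (of_nat (Suc n) * of_real x ^ n * exp (- (of_real x * A)) + exp (- (of_real x * A)) * - A * of_real x ^ Suc n) / A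
            = ?f (Suc n) x - of_nat (Suc n) / A * ?f n x"
          using A0 by (simp add: field_simps del: power_Suc of_nat_Suc)
        finally have "((\<lambda>\<xi>. - (\<xi> ^ Suc n * exp (- (\<xi> * A))) / A) has_field_derivative
              ?f (Suc n) x - of_nat (Suc n) / A * ?f n x) (at (of_real x))" .
        from has_vector_derivative_real_field[OF this] show ?thesis .
      qed
      show "set_integrable lborel {0<..} (\<lambda>\<xi>. ?f (Suc n) \<xi> - of_nat (Suc n) / A * ?f n \<xi>)"
        by (rule diff(1))
      have "((\<lambda>\<xi>. - ?f (Suc n) \<xi> / A) \<longlongrightarrow> - ?f (Suc n) 0 / A) (at_right 0)"
        by (intro tendsto_intros) (use A0 in auto)
      then show "((\<lambda>\<xi>. - ?f (Suc n) \<xi> / A) \<longlongrightarrow> 0) (at_right 0)" by simp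
      have "((\<lambda>\<xi>. - ?f (Suc n) \<xi> / A) \<longlongrightarrow> - 0 / A) at_top"
        by (intro tendsto_divide tendsto_minus tendsto_const A0 top)
      then show "((\<lambda>\<xi>. - ?f (Suc n) \<xi> / A) \<longlongrightarrow> 0) at_top" by simp
    qed (auto intro!: continuous_intros simp: A0)
    then have "(LINT \<xi>:{0<..}|lborel. ?f (Suc n) \<xi>) - of_nat (Suc n) / A * (LINT \<xi>:{0<..}|lborel. ?f n \<xi>) = 0"
      unfolding diff(2) by (simp del: power_Suc of_nat_Suc)
    then have "(LINT \<xi>:{0<..}|lborel. ?f (Suc n) \<xi>) = of_nat (Suc n) / A * (LINT \<xi>:{0<..}|lborel. ?f n \<xi>)"
      by (rule eq_iff_diff_eq_0[THEN iffD2])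
    also have "\<dots> = fact (Suc n) / A ^ Suc (Suc n)"
      unfolding Suc by simp
    finally show ?case .
  }
qed

lemma halfline_power_integrable:
  assumes c: "c > 0" and w: "Re w > 0"
  shows "set_integrable lborel {0<..} (\<lambda>t. of_real t ^ j / (of_real (c * t) + w) ^ (j + m + 2))"
proof -
  define d where "d = Re w"
  have "integrable lborel (\<lambda>t. 1 / (c ^ j * d ^ m * c\<^sup>2) * (1 / ((d / c)\<^sup>2 + (t + 0)\<^sup>2)))"
    using w c by (intro integrable_mult_right integrable_inverse_quadratic) (auto simp: d_def)
  then show ?thesis unfolding set_integrable_def
  proof (rule Bochner_Integration.integrable_bound)
    show "AE t in lborel. norm (indicat_real {0<..} t *\<^sub>R (of_real t ^ j / (of_real (c * t) + w) ^ (j + m + 2)))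
        \<le> norm (1 / (c ^ j * d ^ m * c\<^sup>2) * (1 / ((d / c)\<^sup>2 + (t + 0)\<^sup>2)))"
    proof (intro AE_I2)
      fix t :: real
      show "norm (indicat_real {0<..} t *\<^sub>R (of_real t ^ j / (of_real (c * t) + w) ^ (j + m + 2)))
        \<le> norm (1 / (c ^ j * d ^ m * c\<^sup>2) * (1 / ((d / c)\<^sup>2 + (t + 0)\<^sup>2)))"
      proof (cases "t > 0")
        case True
        define r where "r = cmod (of_real (c * t) + w)"
        have r: "r \<ge> c * t + d" using complex_Re_le_cmod[of "of_real (c * t) + w"] by (simp add: r_def d_def)
        have d: "d > 0" using w by (simp add: d_def)
        have ct: "c * t > 0" using c True by simp
        have 1: "(c * t) ^ j \<le> r ^ j" "d ^ m \<le> r ^ m"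
          using r ct d by (auto intro!: power_mono)
        have "(c * t)\<^sup>2 + d\<^sup>2 \<le> (c * t + d)\<^sup>2" using ct d by (simp add: power2_sum)
        also have "\<dots> \<le> r\<^sup>2" using r ct d by (intro power_mono) auto
        finally have 2: "(c * t)\<^sup>2 + d\<^sup>2 \<le> r\<^sup>2" .
        have 3: "(c * t) ^ j * d ^ m * ((c * t)\<^sup>2 + d\<^sup>2) \<le> r ^ j * r ^ m * r\<^sup>2"
          using 1 2 ct d r by (intro mult_mono) auto
        have r0: "r > 0" using r ct d by linarith
        have "t ^ j / r ^ (j + m + 2) \<le> 1 / (c ^ j * d ^ m * ((c * t)\<^sup>2 + d\<^sup>2))"
        proof -
          have "t ^ j * (c ^ j * d ^ m * ((c * t)\<^sup>2 + d\<^sup>2)) \<le> r ^ (j + m + 2)"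
            using 3 by (simp add: power_add power_mult_distrib power2_eq_square mult_ac)
          moreover have "c ^ j * d ^ m * ((c * t)\<^sup>2 + d\<^sup>2) > 0" "r ^ (j + m + 2) > 0"
            using c d r0 by (auto intro!: mult_pos_pos add_nonneg_pos)
          moreover have "x / R \<le> 1 / K" if "x * K \<le> R" "K > 0" "R > 0" for x K R :: real
            using that by (simp add: field_simps)
          ultimately show ?thesis by blast
        qed
        also have "c ^ j * d ^ m * ((c * t)\<^sup>2 + d\<^sup>2) = c ^ j * d ^ m * c\<^sup>2 * ((d / c)\<^sup>2 + (t + 0)\<^sup>2)"
          using c by (simp add: field_simps power2_eq_square)
        finally show ?thesis using True c d by (simp add: norm_divide norm_power norm_mult r_def)
      qed auto
    qed
  qed simp
qed

text \<open>
  The beta integral with integer exponents and a complex parameter \<open>w\<close>, by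
  induction on the exponent in the numerator: the derivative of
  \<open>t\<^sup>j\<^sup>+\<^sup>1 / (c t + w)\<^sup>j\<^sup>+\<^sup>m\<^sup>+\<^sup>2\<close>
  integrates to zero.
\<close>

lemma halfline_power_integral:
  assumes c: "c > 0" and w: "Re w > 0"
  shows "(LINT t:{0<..}|lborel. of_real t ^ j / (of_real (c * t) + w) ^ (j + m + 2)) =
     fact j * fact m / (fact (j + m + 1) * of_real c ^ Suc j * w ^ Suc m)"
proof (induction j)
  have nz: "of_real (c * t) + w \<noteq> 0" if "t \<ge> 0" for t
  proof -
    have "Re (of_real (c * t) + w) > 0" using w c that by (simp add: add_nonneg_pos)
    then show ?thesis by (metis less_irrefl zero_complex.sel(1))
  qed
  have w0: "w \<noteq> 0" using w by auto
  have "filterlim (\<lambda>t. norm (of_real (c * t) + w)) at_top at_top"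
  proof (rule filterlim_at_top_mono)
    show "filterlim (\<lambda>t. c * t + Re w) at_top at_top" using c by real_asymp
    show "\<forall>\<^sub>F t in at_top. c * t + Re w \<le> norm (of_real (c * t) + w)"
      using complex_Re_le_cmod[of "of_real (c * t) + w" for t] by (intro always_eventually) simp
  qed
  then have inv0: "((\<lambda>t. inverse (of_real (c * t) + w)) \<longlongrightarrow> 0) at_top"
    by (intro filterlim_compose[OF tendsto_inverse_0] filterlim_norm_at_top_imp_at_infinity)
  let ?L = "\<lambda>t. of_real (c * t) + w"
  let ?f = "\<lambda>j t. of_real t ^ j / ?L t ^ (j + m + 2)"
  {
    case 0
    define C where "C = - 1 / (of_nat (Suc m) * complex_of_real c)"
    have "(LINT t:{0<..}|lborel. ?f 0 t) = C * 0 ^ Suc m - C * inverse w ^ Suc m"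
    proof (rule integral_halfline_FTC)
      show "((\<lambda>t. C * inverse (?L t) ^ Suc m) has_vector_derivative ?f 0 x) (at x)" if "x > 0" for x
      proof -
        define v where "v = inverse (of_real c * of_real x + w)"
        have n: "of_real c * of_real x + w \<noteq> 0" using nz[of x] that by simp
        have "((\<lambda>t. C * inverse (of_real c * t + w) ^ Suc m) has_field_derivative
            C * (of_nat (Suc m) * v ^ m * - (v * of_real c * v))) (at (of_real x))"
          unfolding v_def by (rule derivative_eq_intros refl n | simp)+
        also have "C * (of_nat (Suc m) * v ^ m * - (v * of_real c * v)) = v ^ (m + 2)"
          using c by (simp add: C_def divide_simps del: of_nat_Suc)
        also have "v ^ (m + 2) = ?f 0 x" by (simp add: v_def divide_inverse power_inverse)
        finally have "((\<lambda>t. C * inverse (of_real c * t + w) ^ Suc m) has_field_derivative ?f 0 x) (at (of_real x))" .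
        from has_vector_derivative_real_field[OF this] show ?thesis by simp
      qed
      show "isCont (?f 0) x" if "x > 0" for x using nz[of x] that by (intro continuous_intros) auto
      show "set_integrable lborel {0<..} (?f 0)" using halfline_power_integrable[OF assms, of 0] .
      have "((\<lambda>t. C * inverse (?L t) ^ Suc m) \<longlongrightarrow> C * inverse (?L 0) ^ Suc m) (at_right 0)"
        by (intro tendsto_intros) (use w0 in auto)
      then show "((\<lambda>t. C * inverse (?L t) ^ Suc m) \<longlongrightarrow> C * inverse w ^ Suc m) (at_right 0)" by simp
      show "((\<lambda>t. C * inverse (?L t) ^ Suc m) \<longlongrightarrow> C * 0 ^ Suc m) at_top"
        by (intro tendsto_mult tendsto_power tendsto_const inv0)
    qed
    also have "\<dots> = 1 / (of_nat (Suc m) * of_real c * w ^ Suc m)"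
      by (simp add: C_def divide_inverse power_inverse)
    also have "\<dots> = fact 0 * fact m / (fact (0 + m + 1) * of_real c ^ Suc 0 * w ^ Suc m)"
      by (simp add: divide_simps)
    finally show ?case .
  next
    case (Suc j)
    let ?N = "Suc (j + m + 1)"
    note diff = set_integral_diff[OF set_integrable_mult_right[OF halfline_power_integrable[OF assms, of j m], of "of_nat (Suc j)"]
       set_integrable_mult_right[OF halfline_power_integrable[OF assms, of "Suc j" m], of "of_nat ?N * of_real c"]]
    have "(LINT t:{0<..}|lborel. of_nat (Suc j) * ?f j t - of_nat ?N * of_real c * ?f (Suc j) t) = 0 - 0"
    proof (rule integral_halfline_FTC)
      show "((\<lambda>t. of_real t ^ Suc j * inverse (?L t) ^ ?N) has_vector_derivative
          of_nat (Suc j) * ?f j x - of_nat ?N * of_real c * ?f (Suc j) x) (at x)" if "x > 0" for x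
      proof -
        define v where "v = inverse (of_real c * of_real x + w)"
        have n: "of_real c * of_real x + w \<noteq> 0" using nz[of x] that by simp
        have "((\<lambda>t. t ^ Suc j * inverse (of_real c * t + w) ^ ?N) has_field_derivative
            of_nat (Suc j) * of_real x ^ j * v ^ ?N + (of_nat ?N * v ^ (j + m + 1) * - (v * of_real c * v)) * of_real x ^ Suc j) (at (of_real x))"
          unfolding v_def by (rule derivative_eq_intros refl n | simp del: of_nat_Suc power_Suc)+
        also have "of_nat (Suc j) * of_real x ^ j * v ^ ?N + (of_nat ?N * v ^ (j + m + 1) * - (v * of_real c * v)) * of_real x ^ Suc j
           = of_nat (Suc j) * ?f j x - of_nat ?N * of_real c * ?f (Suc j) x"
          by (simp add: v_def divide_inverse power_inverse mult_ac del: of_nat_Suc)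
        finally have "((\<lambda>t. t ^ Suc j * inverse (of_real c * t + w) ^ ?N) has_field_derivative
            of_nat (Suc j) * ?f j x - of_nat ?N * of_real c * ?f (Suc j) x) (at (of_real x))" .
        from has_vector_derivative_real_field[OF this] show ?thesis by simp
      qed
      show "isCont (\<lambda>t. of_nat (Suc j) * ?f j t - of_nat ?N * of_real c * ?f (Suc j) t) x" if "x > 0" for x
        using nz[of x] that by (intro continuous_intros) auto
      show "set_integrable lborel {0<..} (\<lambda>t. of_nat (Suc j) * ?f j t - of_nat ?N * of_real c * ?f (Suc j) t)"
        by (rule diff(1))
      have "((\<lambda>t. of_real t ^ Suc j * inverse (?L t) ^ ?N) \<longlongrightarrow> of_real 0 ^ Suc j * inverse (?L 0) ^ ?N) (at_right 0)"
        by (intro tendsto_intros) (use w0 in auto)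
      then show "((\<lambda>t. of_real t ^ Suc j * inverse (?L t) ^ ?N) \<longlongrightarrow> 0) (at_right 0)" by simp
      have "((\<lambda>t. of_real t * inverse (?L t)) \<longlongrightarrow> 1 / of_real c) at_top"
      proof (rule Lim_transform_eventually)
        have "((\<lambda>t. (1 - w * inverse (?L t)) / of_real c) \<longlongrightarrow> (1 - w * 0) / of_real c) at_top"
          by (intro tendsto_intros inv0) (use c in auto)
        then show "((\<lambda>t. (1 - w * inverse (?L t)) / of_real c) \<longlongrightarrow> 1 / of_real c) at_top" by simp
        show "\<forall>\<^sub>F t in at_top. (1 - w * inverse (?L t)) / of_real c = of_real t * inverse (?L t)"
          using eventually_ge_at_top[of 0]
        proof eventually_elim
          case (elim t)
          have "(1 - w * inverse L) / C = (L - w) / C * inverse L" if "L \<noteq> 0" for L C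
            using that by (simp add: field_simps)
          from this[OF nz[OF elim], of "of_real c"] show ?case using c by simp
        qed
      qed
      then have "((\<lambda>t. (of_real t * inverse (?L t)) ^ Suc j * inverse (?L t) ^ Suc m) \<longlongrightarrow> (1 / of_real c) ^ Suc j * 0 ^ Suc m) at_top"
        by (intro tendsto_mult tendsto_power inv0)
      then show "((\<lambda>t. of_real t ^ Suc j * inverse (?L t) ^ ?N) \<longlongrightarrow> 0) at_top"
        by (simp add: power_mult_distrib power_add mult_ac)
    qed
    then have "of_nat (Suc j) * (LINT t:{0<..}|lborel. ?f j t) - of_nat ?N * of_real c * (LINT t:{0<..}|lborel. ?f (Suc j) t) = 0"
      unfolding diff(2) set_integral_mult_right by (simp only: diff_self)
    then have "of_nat ?N * of_real c * (LINT t:{0<..}|lborel. ?f (Suc j) t) = of_nat (Suc j) * (LINT t:{0<..}|lborel. ?f j t)"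
      by simp
    then have "(LINT t:{0<..}|lborel. ?f (Suc j) t) = of_nat (Suc j) * (LINT t:{0<..}|lborel. ?f j t) / (of_nat ?N * of_real c)"
      using c by (subst eq_divide_eq) (auto simp: mult_ac simp del: of_nat_Suc)
    also have "\<dots> = fact (Suc j) * fact m / (fact (Suc j + m + 1) * of_real c ^ Suc (Suc j) * w ^ Suc m)"
      unfolding Suc by (simp add: divide_simps del: of_nat_Suc)
    finally show ?case .
  }
qed

text \<open>
  On the line \<open>|p + i s|\<^sup>4\<close> is the product of the squares of \<open>p + i
  s\<close> and of its conjugate.
\<close>

lemma nn_integral_inverse_quartic_line:
  assumes "Re p > 0"
  shows "(\<integral>\<^sup>+s. ennreal (1 / cmod (p + \<i> * of_real s) ^ 4) \<partial>lborel) = ennreal (pi / (2 * Re p ^ 3))"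
proof -
  have eq: "line_integrand p (cnj p) 2 2 s = of_real (1 / cmod (p + \<i> * of_real s) ^ 4)" for s
  proof -
    have c: "cnj p - \<i> * of_real s = cnj (p + \<i> * of_real s)" by simp
    have "line_integrand p (cnj p) 2 2 s = 1 / ((p + \<i> * of_real s) * cnj (p + \<i> * of_real s))\<^sup>2"
      unfolding line_integrand_def c by (simp only: power_mult_distrib)
    also have "\<dots> = of_real (1 / cmod (p + \<i> * of_real s) ^ 4)"
      unfolding complex_norm_square[symmetric] by (simp flip: power_mult)
    finally show ?thesis .
  qed
  have i: "integrable lborel (line_integrand p (cnj p) 2 2)"
    using assms by (intro integrable_line_integrand) auto
  then have ir: "integrable lborel (\<lambda>s. 1 / cmod (p + \<i> * of_real s) ^ 4)"
    unfolding eq[abs_def] by (simp only: complex_of_real_integrable_eq)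
  have "of_real (\<integral>s. 1 / cmod (p + \<i> * of_real s) ^ 4 \<partial>lborel) = (\<integral>s. line_integrand p (cnj p) 2 2 s \<partial>lborel)"
    unfolding eq by (rule integral_complex_of_real[symmetric])
  also have "\<dots> = of_real (2 * pi) * 2 / (p + cnj p) ^ 3"
    using line_integral[of p "cnj p" 1 1] assms by (simp add: numeral_2_eq_2[symmetric] numeral_3_eq_3[symmetric])
  also have "\<dots> = of_real (pi / (2 * Re p ^ 3))"
    by (simp add: complex_add_cnj power_mult_distrib)
  finally have "(\<integral>s. 1 / cmod (p + \<i> * of_real s) ^ 4 \<partial>lborel) = pi / (2 * Re p ^ 3)"
    by (simp only: of_real_eq_iff)
  then show ?thesis by (subst nn_integral_eq_integral[OF ir]) auto
qed

lemma nn_integral_inverse_cube_halfline: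
  assumes "c > 0" "d > 0"
  shows "(\<integral>\<^sup>+t. ennreal (1 / (c * t + d) ^ 3) * indicator {0<..} t \<partial>lborel) = ennreal (1 / (2 * c * d\<^sup>2))"
proof -
  have eq: "of_real t ^ 0 / (of_real (c * t) + complex_of_real d) ^ (0 + 1 + 2) = of_real (1 / (c * t + d) ^ 3)" for t
    by (simp add: numeral_3_eq_3)
  have i: "set_integrable lborel {0<..} (\<lambda>t. complex_of_real (1 / (c * t + d) ^ 3))"
    using halfline_power_integrable[of c "of_real d" 0 1] assms unfolding eq by simp
  then have ir: "integrable lborel (\<lambda>t. indicator {0<..} t * (1 / (c * t + d) ^ 3))"
    unfolding set_integrable_def by (simp add: scaleR_conv_of_real flip: of_real_mult complex_of_real_integrable_eq)
  have "of_real (\<integral>t. indicator {0<..} t * (1 / (c * t + d) ^ 3) \<partial>lborel) = (LINT t:{0<..}|lborel. complex_of_real (1 / (c * t + d) ^ 3))"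
    unfolding set_lebesgue_integral_def
    by (simp add: scaleR_conv_of_real flip: integral_complex_of_real of_real_mult)
  also have "\<dots> = of_real (1 / (2 * c * d\<^sup>2))"
    using halfline_power_integral[of c "of_real d" 0 1] assms unfolding eq by (simp add: power2_eq_square mult_ac)
  finally have v: "(\<integral>t. indicator {0<..} t * (1 / (c * t + d) ^ 3) \<partial>lborel) = 1 / (2 * c * d\<^sup>2)"
    by (simp only: of_real_eq_iff)
  have "(\<integral>\<^sup>+t. ennreal (1 / (c * t + d) ^ 3) * indicator {0<..} t \<partial>lborel) =
     (\<integral>\<^sup>+t. ennreal (indicator {0<..} t * (1 / (c * t + d) ^ 3)) \<partial>lborel)"
    by (intro nn_integral_cong) (auto simp: indicator_def)
  also have "\<dots> = ennreal (1 / (2 * c * d\<^sup>2))"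
    using assms v by (subst nn_integral_eq_integral[OF ir]) (auto simp: indicator_def)
  finally show ?thesis .
qed


section \<open>An inequality for the Gamma function\<close>

text \<open>
  Compare the series of \<open>1 / (z + k + 1)\<^sup>2\<close> with the telescoping series of
  \<open>1 / (z + k) - 1 / (z + k + 1)\<close>.
\<close>

lemma Polygamma_1_le:
  fixes z :: real
  assumes "z > 0"
  shows "Polygamma 1 (z + 1) \<le> 1 / z"
proof -
  have tele: "(\<lambda>k. 1 / (z + real k) - 1 / (z + real (Suc k))) sums (1 / (z + real 0) - 0)"
    by (rule telescope_sums') real_asymp
  have s: "summable (\<lambda>k. inverse ((z + 1 + real k)\<^sup>2))"
  proof (rule summable_comparison_test'[OF sums_summable[OF tele]])
    fix k show "norm (inverse ((z + 1 + real k)\<^sup>2)) \<le> 1 / (z + real k) - 1 / (z + real (Suc k))"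
      using assms by (simp add: divide_simps power2_eq_square) (simp add: algebra_simps add_pos_nonneg)
  qed
  have le: "inverse ((z + 1 + real k)\<^sup>2) \<le> 1 / (z + real k) - 1 / (z + real (Suc k))" for k
    using assms by (simp add: divide_simps power2_eq_square) (simp add: algebra_simps add_pos_nonneg)
  have "Polygamma 1 (z + 1) = (\<Sum>k. inverse ((z + 1 + real k)\<^sup>2))"
    by (simp add: Polygamma_def numeral_2_eq_2)
  also have "\<dots> \<le> (\<Sum>k. 1 / (z + real k) - 1 / (z + real (Suc k)))"
    by (intro suminf_le le s sums_summable[OF tele])
  also have "\<dots> = 1 / z" using sums_unique[OF tele] by simp
  finally show ?thesis .
qed

text \<open>
  Concavity of \<open>ln \<Gamma>(z+1) - z ln z\<close>, whose second derivative is the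
  trigamma function at \<open>z + 1\<close> minus \<open>1 / z\<close>.
\<close>

lemma Gamma_midpoint_inequality:
  assumes x: "x > (0::real)" and y: "y > 0"
  shows "ln_Gamma (x + 1) - x * ln x + (ln_Gamma (y + 1) - y * ln y) \<le>
     2 * (ln_Gamma ((x + y) / 2 + 1) - (x + y) / 2 * ln ((x + y) / 2))"
proof -
  define h where "h z = z * ln z - ln_Gamma (z + 1)" for z :: real
  have "convex_on {0<..} h"
  proof (rule f''_ge0_imp_convex)
    show "(h has_real_derivative ln z + 1 - Polygamma 0 (z + 1)) (at z)" if "z \<in> {0<..}" for z :: real
      unfolding h_def using that by (auto intro!: derivative_eq_intros)
    show "((\<lambda>z. ln z + 1 - Polygamma 0 (z + 1)) has_real_derivative 1 / z - Polygamma 1 (z + 1)) (at z)" if "z \<in> {0<..}" for z :: real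
      using that by (auto intro!: derivative_eq_intros simp: add_pos_pos plus_of_nat_eq_0_imp elim!: nonpos_Ints_cases)
    show "1 / z - Polygamma 1 (z + 1) \<ge> 0" if "z \<in> {0<..}" for z :: real
      using Polygamma_1_le[of z] that by simp
  qed simp
  from convex_onD[OF this, of "1/2" x y]
  have "h ((x + y) / 2) \<le> (h x + h y) / 2"
    using x y by (simp add: field_simps)
  then show ?thesis by (simp add: h_def field_simps)
qed

text \<open>
  The midpoint inequality at \<open>x = 2k/\<gamma>\<close> and \<open>y = 2k - x\<close>,
  whose midpoint is \<open>k\<close>. It says that the norm of \<open>T\<^sub>k\<close> is at
  most the norm of \<open>T\<^sub>0\<close>.
\<close>

lemma Gamma_product_bound:
  assumes g: "\<gamma> > 1"
  shows "\<gamma> ^ (2 * k) * (Gamma (2 * real k / \<gamma> + 1) * Gamma (2 * real k - 2 * real k / \<gamma> + 1))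
    \<le> (fact k)\<^sup>2 * 2 ^ (2 * k) * (\<gamma> - 1) powr (2 * real k - 2 * real k / \<gamma>)"
proof (cases "k = 0")
  case False
  define x where "x = 2 * real k / \<gamma>"
  define y where "y = 2 * real k - 2 * real k / \<gamma>"
  have k: "real k > 0" using False by simp
  have x: "x > 0" using g k by (simp add: x_def)
  have y_eq: "y = 2 * real k * (\<gamma> - 1) / \<gamma>" using g by (simp add: y_def field_simps)
  have y: "y > 0" unfolding y_eq using g k by simp
  have xy: "x + y = 2 * real k" by (simp add: x_def y_def)
  have lx: "ln x = ln 2 + ln (real k) - ln \<gamma>" using g k by (simp add: x_def ln_div ln_mult)
  have ly: "ln y = ln 2 + ln (real k) + ln (\<gamma> - 1) - ln \<gamma>"
    unfolding y_eq using g k by (simp add: ln_div ln_mult)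
  have "x * ln x + y * ln y = (x + y) * (ln 2 + ln (real k) - ln \<gamma>) + y * ln (\<gamma> - 1)"
    unfolding lx ly by (simp add: algebra_simps)
  then have e: "x * ln x + y * ln y = 2 * real k * (ln 2 + ln (real k) - ln \<gamma>) + y * ln (\<gamma> - 1)"
    unfolding xy .
  have "ln_Gamma (x + 1) - x * ln x + (ln_Gamma (y + 1) - y * ln y) \<le>
     2 * (ln_Gamma (real k + 1) - real k * ln (real k))"
    using Gamma_midpoint_inequality[OF x y] by (simp add: xy)
  then have "ln_Gamma (x + 1) + ln_Gamma (y + 1) \<le> 2 * ln_Gamma (real k + 1) - 2 * real k * ln (real k) + (x * ln x + y * ln y)"
    by (simp add: algebra_simps)
  also have "\<dots> = 2 * ln_Gamma (real k + 1) + 2 * real k * (ln 2 - ln \<gamma>) + y * ln (\<gamma> - 1)"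
    unfolding e by (simp add: algebra_simps)
  finally have "real (2 * k) * ln \<gamma> + (ln_Gamma (x + 1) + ln_Gamma (y + 1)) \<le> 2 * ln_Gamma (real k + 1) + real (2 * k) * ln 2 + y * ln (\<gamma> - 1)"
    by (simp add: algebra_simps)
  then have "exp (real (2 * k) * ln \<gamma> + (ln_Gamma (x + 1) + ln_Gamma (y + 1))) \<le> exp (2 * ln_Gamma (real k + 1) + real (2 * k) * ln 2 + y * ln (\<gamma> - 1))"
    by simp
  moreover have "exp (real (2 * k) * ln \<gamma>) = \<gamma> ^ (2 * k)" "exp (real (2 * k) * ln 2) = 2 ^ (2 * k)"
    using g by (simp_all only: exp_of_nat_mult) auto
  moreover have "exp (2 * ln_Gamma (real k + 1)) = (fact k)\<^sup>2"
    using exp_of_nat_mult[of 2 "ln_Gamma (real k + 1)"] Gamma_real_pos_exp[of "real k + 1"] Gamma_fact[of k, where 'a=real]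
    by (simp add: add.commute)
  moreover have "exp (y * ln (\<gamma> - 1)) = (\<gamma> - 1) powr y" using g by (simp add: powr_def)
  ultimately show ?thesis
    unfolding y_def[symmetric] unfolding x_def[symmetric] using x y by (simp add: exp_add Gamma_real_pos_exp)
qed (use g in simp)


section \<open>Bessel inequality for the Fourier integral\<close>

lemma Fubini_from_nn_integral:
  fixes f :: "'a \<Rightarrow> 'b \<Rightarrow> complex"
  assumes "sigma_finite_measure M1" "sigma_finite_measure M2"
    and [measurable]: "case_prod f \<in> borel_measurable (M1 \<Otimes>\<^sub>M M2)"
    and fin: "(\<integral>\<^sup>+x. \<integral>\<^sup>+y. ennreal (cmod (f x y)) \<partial>M2 \<partial>M1) < \<infinity>"
  shows "integrable (M1 \<Otimes>\<^sub>M M2) (case_prod f)"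
    and "(\<integral>y. (\<integral>x. f x y \<partial>M1) \<partial>M2) = (\<integral>x. (\<integral>y. f x y \<partial>M2) \<partial>M1)"
proof -
  interpret A: sigma_finite_measure M1 by fact
  interpret B: sigma_finite_measure M2 by fact
  interpret pair_sigma_finite M1 M2 ..
  show i: "integrable (M1 \<Otimes>\<^sub>M M2) (case_prod f)"
  proof (rule integrableI_bounded)
    have "(\<integral>\<^sup>+z. ennreal (norm (case_prod f z)) \<partial>(M1 \<Otimes>\<^sub>M M2)) = (\<integral>\<^sup>+x. \<integral>\<^sup>+y. ennreal (cmod (f x y)) \<partial>M2 \<partial>M1)"
      by (subst B.nn_integral_fst[symmetric]) auto
    then show "(\<integral>\<^sup>+z. ennreal (norm (case_prod f z)) \<partial>(M1 \<Otimes>\<^sub>M M2)) < \<infinity>" using fin by simp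
  qed simp
  show "(\<integral>y. (\<integral>x. f x y \<partial>M1) \<partial>M2) = (\<integral>x. (\<integral>y. f x y \<partial>M2) \<partial>M1)"
    by (rule Fubini_integral[OF i])
qed

text \<open>
  Both halves of the line are Laplace integrals; they contribute \<open>1 / (e + i u)\<close>
  and \<open>1 / (e - i u)\<close>.
\<close>

lemma Poisson_kernel:
  assumes e: "e > 0"
  shows "integrable lborel (\<lambda>\<xi>. complex_of_real (exp (- (e * \<bar>\<xi>\<bar>))) * cis (- (\<xi> * u)))"
    and "(\<integral>\<xi>. complex_of_real (exp (- (e * \<bar>\<xi>\<bar>))) * cis (- (\<xi> * u)) \<partial>lborel) = of_real (2 * e / (e\<^sup>2 + u\<^sup>2))"
proof -
  define h where "h u \<xi> = indicator {0<..} \<xi> *\<^sub>R exp (- (of_real \<xi> * Complex e u))" for u \<xi> :: real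
  have h: "integrable lborel (h u)" "(\<integral>\<xi>. h u \<xi> \<partial>lborel) = 1 / Complex e u" for u
    using Laplace_power_integrable[of "Complex e u" 0] Laplace_power[of "Complex e u" 0] e
    by (auto simp: h_def[abs_def] set_integrable_def set_lebesgue_integral_def)
  have h': "integrable lborel (\<lambda>\<xi>. h (- u) (- \<xi>))" "(\<integral>\<xi>. h (- u) (- \<xi>) \<partial>lborel) = 1 / Complex e (- u)"
    using lborel_integrable_real_affine[OF h(1)[of "-u"], of "-1" 0]
      lborel_integral_real_affine[of "-1" "h (- u)" 0] h(2)[of "-u"] by simp_all
  have eq: "complex_of_real (exp (- (e * \<bar>\<xi>\<bar>))) * cis (- (\<xi> * u)) = h u \<xi> + h (- u) (- \<xi>)" if "\<xi> \<noteq> 0" for \<xi>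
  proof (cases "\<xi> > 0")
    case True
    have "- (of_real \<xi> * Complex e u) = Complex (- (e * \<bar>\<xi>\<bar>)) (- (\<xi> * u))"
      using True by (simp add: complex_eq_iff)
    then show ?thesis using True by (simp add: h_def exp_eq_polar)
  next
    case False
    have "- (of_real (- \<xi>) * Complex e (- u)) = Complex (- (e * \<bar>\<xi>\<bar>)) (- (\<xi> * u))"
      using False by (simp add: complex_eq_iff)
    then show ?thesis using False that by (simp add: h_def exp_eq_polar)
  qed
  have ae: "AE \<xi> in lborel. h u \<xi> + h (- u) (- \<xi>) = complex_of_real (exp (- (e * \<bar>\<xi>\<bar>))) * cis (- (\<xi> * u))"
    using AE_lborel_singleton[of 0] by eventually_elim (simp add: eq)
  have [measurable]: "(\<lambda>\<xi>. complex_of_real (exp (- (e * \<bar>\<xi>\<bar>))) * cis (- (\<xi> * u))) \<in> borel_measurable borel"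
    by (intro borel_measurable_continuous_onI continuous_intros)
  have i: "integrable lborel (\<lambda>\<xi>. h u \<xi> + h (- u) (- \<xi>))" using h h' by simp
  show "integrable lborel (\<lambda>\<xi>. complex_of_real (exp (- (e * \<bar>\<xi>\<bar>))) * cis (- (\<xi> * u)))"
    by (rule integrable_cong_AE_imp[OF i]) (use ae in \<open>auto elim: AE_mp\<close>)
  have "(\<integral>\<xi>. complex_of_real (exp (- (e * \<bar>\<xi>\<bar>))) * cis (- (\<xi> * u)) \<partial>lborel) = (\<integral>\<xi>. h u \<xi> + h (- u) (- \<xi>) \<partial>lborel)"
    using i by (intro integral_cong_AE) (use ae in \<open>auto elim: AE_mp\<close>)
  also have "\<dots> = 1 / Complex e u + 1 / Complex e (- u)"
    using h h' by (simp add: Bochner_Integration.integral_add)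
  also have "\<dots> = of_real (2 * e / (e\<^sup>2 + u\<^sup>2))"
  proof -
    have "e\<^sup>2 + u\<^sup>2 \<noteq> 0" using e by (simp add: add_pos_nonneg less_imp_neq[symmetric])
    then show ?thesis
      by (simp add: complex_eq_iff Re_divide Im_divide add_divide_distrib[symmetric] power2_eq_square[of "e\<^sup>2 + u\<^sup>2"])
  qed
  finally show "(\<integral>\<xi>. complex_of_real (exp (- (e * \<bar>\<xi>\<bar>))) * cis (- (\<xi> * u)) \<partial>lborel) = of_real (2 * e / (e\<^sup>2 + u\<^sup>2))" .
qed

lemma nn_integral_Poisson_kernel:
  assumes e: "e > 0"
  shows "(\<integral>\<^sup>+x. ennreal (2 * e / (e\<^sup>2 + (x - y)\<^sup>2)) \<partial>lborel) = ennreal (2 * pi)"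
proof -
  have "(\<integral>\<^sup>+x. ennreal (2 * e / (e\<^sup>2 + (x - y)\<^sup>2)) \<partial>lborel) = (\<integral>\<^sup>+x. ennreal (2 * e) * ennreal (1 / (e\<^sup>2 + (x + - y)\<^sup>2)) \<partial>lborel)"
    using e by (intro nn_integral_cong) (simp flip: ennreal_mult)
  also have "\<dots> = ennreal (2 * e) * (\<integral>\<^sup>+x. ennreal (1 / (e\<^sup>2 + (x + - y)\<^sup>2)) \<partial>lborel)"
    by (rule nn_integral_cmult) simp
  also have "(\<integral>\<^sup>+x. ennreal (1 / (e\<^sup>2 + (x + - y)\<^sup>2)) \<partial>lborel) = ennreal (pi / e)"
    using integrable_inverse_quadratic[OF e, of "-y"] by (subst nn_integral_eq_integral) auto
  finally show ?thesis using e by (simp flip: ennreal_mult)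
qed

definition fourier_integral :: "(real \<Rightarrow> complex) \<Rightarrow> real \<Rightarrow> complex" where
  "fourier_integral f \<xi> = (\<integral>x. f x * cis (- (\<xi> * x)) \<partial>lborel)"

lemma cis_measurable [measurable]: "cis \<in> borel_measurable borel"
  by (intro borel_measurable_continuous_onI continuous_intros)

lemma fourier_integral_measurable [measurable]:
  assumes [measurable]: "f \<in> borel_measurable borel"
  shows "fourier_integral f \<in> borel_measurable borel"
  unfolding fourier_integral_def by measurable

text \<open>
  With the convergence factor \<open>exp(-e |\<xi>|)\<close> the energy of the Fourier
  transform becomes, by Fubini, a double integral of \<open>f(x)\<close> times the conjugate
  of \<open>f(y)\<close> against the Poisson kernel \<open>P(x - y)\<close>. The estimate
  \<open>2 |f(x) f(y)| \<le> |f(x)|\<^sup>2 + |f(y)|\<^sup>2\<close> bounds it by the mass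
  \<open>2 \<pi>\<close> of \<open>P\<close> times the energy of \<open>f\<close>.
\<close>

lemma smoothed_energy_le:
  assumes f: "integrable lborel f" and e: "e > 0"
  shows "(\<integral>\<^sup>+\<xi>. ennreal (exp (- (e * \<bar>\<xi>\<bar>)) * (cmod (fourier_integral f \<xi>))\<^sup>2) \<partial>lborel)
     \<le> ennreal (2 * pi) * (\<integral>\<^sup>+x. ennreal ((cmod (f x))\<^sup>2) \<partial>lborel)"
proof -
  have [measurable]: "f \<in> borel_measurable borel" using f by auto
  define L where "L = (lborel :: (real \<times> real) measure)"
  have L: "L = lborel \<Otimes>\<^sub>M lborel" unfolding L_def by (rule lborel_prod[symmetric])
  define P where "P u = 2 * e / (e\<^sup>2 + u\<^sup>2)" for u
  have P0: "P u \<ge> 0" for u using e by (simp add: P_def)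
  have [measurable]: "P \<in> borel_measurable borel" unfolding P_def by measurable
  define g where "g z = f (fst z) * cnj (f (snd z))" for z :: "real \<times> real"
  have cnj_meas[measurable]: "cnj \<in> borel_measurable borel"
    by (intro borel_measurable_continuous_onI continuous_intros)
  have gm[measurable]: "g \<in> borel_measurable L" unfolding g_def L by measurable
  have fc: "integrable lborel (\<lambda>y. cnj (f y))" using f by simp
  have g: "integrable L g"
  proof -
    have "(\<integral>\<^sup>+x. \<integral>\<^sup>+y. ennreal (cmod (f x * cnj (f y))) \<partial>lborel \<partial>lborel) =
      (\<integral>\<^sup>+x. ennreal (cmod (f x)) \<partial>lborel) * (\<integral>\<^sup>+y. ennreal (cmod (f y)) \<partial>lborel)"
      by (simp add: norm_mult ennreal_mult nn_integral_cmult nn_integral_multc)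
    also have "\<dots> < \<infinity>" using f by (auto simp: integrable_iff_bounded ennreal_mult_less_top)
    finally show ?thesis
      using Fubini_from_nn_integral(1)[OF sigma_finite_lborel sigma_finite_lborel, of "\<lambda>x y. f x * cnj (f y)"]
      by (simp add: L g_def[abs_def] split_beta')
  qed
  have sq: "of_real ((cmod (fourier_integral f \<xi>))\<^sup>2) = (\<integral>z. g z * cis (- (\<xi> * (fst z - snd z))) \<partial>L)" for \<xi>
  proof -
    have c: "cnj (fourier_integral f \<xi>) = (\<integral>y. cnj (f y) * cis (\<xi> * y) \<partial>lborel)"
      unfolding fourier_integral_def by (subst Bochner_Integration.integral_cnj[symmetric]) (simp add: cis_cnj)
    have "of_real ((cmod (fourier_integral f \<xi>))\<^sup>2) = fourier_integral f \<xi> * cnj (fourier_integral f \<xi>)"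
      by (rule complex_norm_square)
    also have "\<dots> = (\<integral>x. f x * cis (- (\<xi> * x)) * (\<integral>y. cnj (f y) * cis (\<xi> * y) \<partial>lborel) \<partial>lborel)"
      unfolding c by (simp add: fourier_integral_def)
    also have "\<dots> = (\<integral>x. (\<integral>y. g (x, y) * cis (- (\<xi> * (x - y))) \<partial>lborel) \<partial>lborel)"
      by (intro Bochner_Integration.integral_cong refl)
         (simp add: g_def cis_mult right_diff_distrib mult_ac flip: integral_mult_right_zero)
    also have "\<dots> = (\<integral>z. g z * cis (- (\<xi> * (fst z - snd z))) \<partial>L)"
    proof -
      have "integrable (lborel \<Otimes>\<^sub>M lborel) (\<lambda>z. g z * cis (- (\<xi> * (fst z - snd z))))"
        using g unfolding L by (rule Bochner_Integration.integrable_bound) (use gm in \<open>auto simp: L norm_mult\<close>)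
      from lborel_pair.integral_fst'[OF this] show ?thesis by (simp add: L)
    qed
    finally show ?thesis .
  qed
  define H where "H \<xi> z = (complex_of_real (exp (- (e * \<bar>\<xi>\<bar>))) * cis (- (\<xi> * (fst z - snd z)))) * g z" for \<xi> and z :: "real \<times> real"
  have Hm[measurable]: "case_prod H \<in> borel_measurable (lborel \<Otimes>\<^sub>M L)"
    unfolding H_def g_def L by measurable
  have expi: "integrable lborel (\<lambda>\<xi>. exp (- (e * \<bar>\<xi>\<bar>)))"
    using integrable_norm[OF Poisson_kernel(1)[OF e, of 0]] by simp
  have Hfin: "(\<integral>\<^sup>+\<xi>. \<integral>\<^sup>+z. ennreal (cmod (H \<xi> z)) \<partial>L \<partial>lborel) < \<infinity>"
  proof -
    have "(\<integral>\<^sup>+\<xi>. \<integral>\<^sup>+z. ennreal (cmod (H \<xi> z)) \<partial>L \<partial>lborel) = (\<integral>\<^sup>+\<xi>. ennreal (exp (- (e * \<bar>\<xi>\<bar>))) \<partial>lborel) * (\<integral>\<^sup>+z. ennreal (cmod (g z)) \<partial>L)"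
      by (simp add: H_def norm_mult ennreal_mult nn_integral_cmult nn_integral_multc)
    also have "\<dots> < \<infinity>" using expi g by (auto simp: integrable_iff_bounded ennreal_mult_less_top)
    finally show ?thesis .
  qed
  have sfL: "sigma_finite_measure L" unfolding L_def by (rule sigma_finite_lborel)
  note Fub = Fubini_from_nn_integral[OF sigma_finite_lborel sfL Hm Hfin]
  have sm: "(\<lambda>\<xi>. exp (- (e * \<bar>\<xi>\<bar>)) * (cmod (fourier_integral f \<xi>))\<^sup>2) \<in> borel_measurable borel" by measurable
  have Hz: "(\<integral>z. H \<xi> z \<partial>L) = of_real (exp (- (e * \<bar>\<xi>\<bar>)) * (cmod (fourier_integral f \<xi>))\<^sup>2)" for \<xi>
    unfolding of_real_mult sq H_def
    by (subst integral_mult_right_zero[symmetric]) (simp add: mult_ac)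
  have Hx: "(\<integral>\<xi>. H \<xi> z \<partial>lborel) = of_real (P (fst z - snd z)) * g z" for z
    unfolding H_def by (simp only: integral_mult_left_zero Poisson_kernel(2)[OF e] P_def)
  interpret pair_sigma_finite lborel L
    by (intro pair_sigma_finite.intro sigma_finite_lborel sfL)
  have "integrable lborel (\<lambda>\<xi>. \<integral>z. H \<xi> z \<partial>L)" using integrable_fst[OF Fub(1)] .
  then have ir: "integrable lborel (\<lambda>\<xi>. exp (- (e * \<bar>\<xi>\<bar>)) * (cmod (fourier_integral f \<xi>))\<^sup>2)"
    unfolding Hz by (simp only: complex_of_real_integrable_eq)
  have "of_real (\<integral>\<xi>. exp (- (e * \<bar>\<xi>\<bar>)) * (cmod (fourier_integral f \<xi>))\<^sup>2 \<partial>lborel) = (\<integral>z. of_real (P (fst z - snd z)) * g z \<partial>L)"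
    using Fub(2) unfolding Hz Hx by (simp only: integral_complex_of_real)
  moreover have "norm (complex_of_real (\<integral>\<xi>. exp (- (e * \<bar>\<xi>\<bar>)) * (cmod (fourier_integral f \<xi>))\<^sup>2 \<partial>lborel)) =
      (\<integral>\<xi>. exp (- (e * \<bar>\<xi>\<bar>)) * (cmod (fourier_integral f \<xi>))\<^sup>2 \<partial>lborel)"
    by (simp add: norm_of_real)
  ultimately have "(\<integral>\<^sup>+\<xi>. ennreal (exp (- (e * \<bar>\<xi>\<bar>)) * (cmod (fourier_integral f \<xi>))\<^sup>2) \<partial>lborel)
     = ennreal (norm (\<integral>z. of_real (P (fst z - snd z)) * g z \<partial>L))"
    using nn_integral_eq_integral[OF ir] by simp
  also have "\<dots> \<le> (\<integral>\<^sup>+z. ennreal (norm (of_real (P (fst z - snd z)) * g z)) \<partial>L)"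
  proof (cases "integrable L (\<lambda>z. of_real (P (fst z - snd z)) * g z)")
    case True
    then show ?thesis by (rule integral_norm_bound_ennreal)
  next
    case False
    then show ?thesis by (simp add: not_integrable_integral_eq)
  qed
  also have "\<dots> = (\<integral>\<^sup>+x. \<integral>\<^sup>+y. ennreal (P (x - y) * (cmod (f x) * cmod (f y))) \<partial>lborel \<partial>lborel)"
    unfolding L using P0
    by (subst lborel.nn_integral_fst[symmetric]) (auto simp: g_def norm_mult abs_of_nonneg)
  also have "\<dots> \<le> (\<integral>\<^sup>+x. \<integral>\<^sup>+y. (ennreal (1/2) * ennreal (P (y - x)) * ennreal ((cmod (f x))\<^sup>2) + ennreal (1/2) * ennreal (P (x - y)) * ennreal ((cmod (f y))\<^sup>2)) \<partial>lborel \<partial>lborel)"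
  proof (intro nn_integral_mono)
    fix x y
    have "cmod (f x) * cmod (f y) \<le> 1/2 * (cmod (f x))\<^sup>2 + 1/2 * (cmod (f y))\<^sup>2"
      using sum_squares_bound[of "cmod (f x)" "cmod (f y)"] by simp
    then have "P (x - y) * (cmod (f x) * cmod (f y)) \<le> P (x - y) * (1/2 * (cmod (f x))\<^sup>2 + 1/2 * (cmod (f y))\<^sup>2)"
      by (intro mult_left_mono P0)
    also have "\<dots> = 1/2 * P (y - x) * (cmod (f x))\<^sup>2 + 1/2 * P (x - y) * (cmod (f y))\<^sup>2"
    proof -
      have "P (x - y) = P (y - x)" by (simp add: P_def power2_commute)
      then show ?thesis by (simp add: algebra_simps)
    qed
    finally have "ennreal (P (x - y) * (cmod (f x) * cmod (f y))) \<le> ennreal (1/2 * P (y - x) * (cmod (f x))\<^sup>2 + 1/2 * P (x - y) * (cmod (f y))\<^sup>2)"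
      by (rule ennreal_leI)
    also have "\<dots> = ennreal (1/2) * ennreal (P (y - x)) * ennreal ((cmod (f x))\<^sup>2) + ennreal (1/2) * ennreal (P (x - y)) * ennreal ((cmod (f y))\<^sup>2)"
      using P0 by (simp only: ennreal_plus ennreal_mult mult_nonneg_nonneg zero_le_power2)
    finally show "ennreal (P (x - y) * (cmod (f x) * cmod (f y))) \<le> ennreal (1/2) * ennreal (P (y - x)) * ennreal ((cmod (f x))\<^sup>2) + ennreal (1/2) * ennreal (P (x - y)) * ennreal ((cmod (f y))\<^sup>2)" .
  qed
  also have "\<dots> = (\<integral>\<^sup>+x. \<integral>\<^sup>+y. ennreal (1/2) * ennreal (P (y - x)) * ennreal ((cmod (f x))\<^sup>2) \<partial>lborel \<partial>lborel) +
      (\<integral>\<^sup>+x. \<integral>\<^sup>+y. ennreal (1/2) * ennreal (P (x - y)) * ennreal ((cmod (f y))\<^sup>2) \<partial>lborel \<partial>lborel)"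
    by (simp add: nn_integral_add)
  also have "(\<integral>\<^sup>+x. \<integral>\<^sup>+y. ennreal (1/2) * ennreal (P (x - y)) * ennreal ((cmod (f y))\<^sup>2) \<partial>lborel \<partial>lborel) =
      (\<integral>\<^sup>+y. \<integral>\<^sup>+x. ennreal (1/2) * ennreal (P (x - y)) * ennreal ((cmod (f y))\<^sup>2) \<partial>lborel \<partial>lborel)"
    by (rule lborel_pair.Fubini'[symmetric]) simp
  also have half: "(\<integral>\<^sup>+x. \<integral>\<^sup>+y. ennreal (1/2) * ennreal (P (y - x)) * ennreal ((cmod (f x))\<^sup>2) \<partial>lborel \<partial>lborel) =
     ennreal pi * (\<integral>\<^sup>+x. ennreal ((cmod (f x))\<^sup>2) \<partial>lborel)"
  proof -
    have "(\<integral>\<^sup>+y. ennreal (1/2) * ennreal (P (y - x)) * ennreal ((cmod (f x))\<^sup>2) \<partial>lborel) = ennreal pi * ennreal ((cmod (f x))\<^sup>2)" for x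
    proof -
      have "(\<integral>\<^sup>+y. ennreal (1/2) * ennreal (P (y - x)) * ennreal ((cmod (f x))\<^sup>2) \<partial>lborel) =
         ennreal (1/2) * (\<integral>\<^sup>+y. ennreal (P (y - x)) \<partial>lborel) * ennreal ((cmod (f x))\<^sup>2)"
        by (subst nn_integral_multc, simp, subst nn_integral_cmult, simp, rule refl)
      also have "(\<integral>\<^sup>+y. ennreal (P (y - x)) \<partial>lborel) = ennreal (2 * pi)"
        unfolding P_def by (rule nn_integral_Poisson_kernel[OF e])
      also have "ennreal (1/2) * ennreal (2 * pi) = ennreal pi"
        by (subst ennreal_mult[symmetric]) auto
      finally show ?thesis .
    qed
    then show ?thesis by (simp add: nn_integral_cmult)
  qed
  also have "ennreal pi * (\<integral>\<^sup>+x. ennreal ((cmod (f x))\<^sup>2) \<partial>lborel) + ennreal pi * (\<integral>\<^sup>+x. ennreal ((cmod (f x))\<^sup>2) \<partial>lborel)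
    = ennreal (2 * pi) * (\<integral>\<^sup>+x. ennreal ((cmod (f x))\<^sup>2) \<partial>lborel)"
    by (simp add: ennreal_plus[symmetric] distrib_right[symmetric] del: ennreal_plus)
  finally show ?thesis .
qed

text \<open>
  The inequality in the theorem of Plancherel, obtained by removing the convergence factor
  with the lemma of Fatou. The right-hand side may be infinite, so that integrability of
  \<open>f\<close> suffices.
\<close>

theorem fourier_integral_energy_le:
  assumes f: "integrable lborel f"
  shows "(\<integral>\<^sup>+\<xi>. ennreal ((cmod (fourier_integral f \<xi>))\<^sup>2) \<partial>lborel)
     \<le> ennreal (2 * pi) * (\<integral>\<^sup>+x. ennreal ((cmod (f x))\<^sup>2) \<partial>lborel)"
proof -
  have [measurable]: "f \<in> borel_measurable borel" using f by auto
  let ?F = "\<lambda>n \<xi>. ennreal (exp (- (1 / real (Suc n) * \<bar>\<xi>\<bar>)) * (cmod (fourier_integral f \<xi>))\<^sup>2)"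
  have "(\<integral>\<^sup>+\<xi>. ennreal ((cmod (fourier_integral f \<xi>))\<^sup>2) \<partial>lborel) = (\<integral>\<^sup>+\<xi>. liminf (\<lambda>n. ?F n \<xi>) \<partial>lborel)"
  proof (intro nn_integral_cong)
    fix \<xi>
    have "(\<lambda>n. exp (- (1 / real (Suc n) * \<bar>\<xi>\<bar>))) \<longlonglongrightarrow> 1" by real_asymp
    from tendsto_mult_right[OF this, of "(cmod (fourier_integral f \<xi>))\<^sup>2"]
    have "(\<lambda>n. ?F n \<xi>) \<longlonglongrightarrow> ennreal ((cmod (fourier_integral f \<xi>))\<^sup>2)"
      by (intro tendsto_ennrealI) simp
    from lim_imp_Liminf[OF _ this] show "ennreal ((cmod (fourier_integral f \<xi>))\<^sup>2) = liminf (\<lambda>n. ?F n \<xi>)" by simp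
  qed
  also have "\<dots> \<le> liminf (\<lambda>n. \<integral>\<^sup>+\<xi>. ?F n \<xi> \<partial>lborel)"
    by (rule nn_integral_liminf) simp
  also have "\<dots> \<le> ennreal (2 * pi) * (\<integral>\<^sup>+x. ennreal ((cmod (f x))\<^sup>2) \<partial>lborel)"
    by (intro Liminf_le always_eventually allI smoothed_energy_le f) auto
  finally show ?thesis .
qed

lemma inverse_fourier_integral_energy_le:
  assumes f: "integrable lborel f"
  shows "(\<integral>\<^sup>+\<xi>. ennreal ((cmod (\<integral>x. f x * cis (\<xi> * x) \<partial>lborel))\<^sup>2) \<partial>lborel)
     \<le> ennreal (2 * pi) * (\<integral>\<^sup>+x. ennreal ((cmod (f x))\<^sup>2) \<partial>lborel)"
proof -
  have "cmod (\<integral>x. f x * cis (\<xi> * x) \<partial>lborel) = cmod (fourier_integral (\<lambda>x. cnj (f x)) \<xi>)" for \<xi>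
    unfolding fourier_integral_def
    by (subst complex_mod_cnj[symmetric], subst Bochner_Integration.integral_cnj[symmetric]) (simp add: cis_cnj)
  then show ?thesis using fourier_integral_energy_le[of "\<lambda>x. cnj (f x)"] f by simp
qed


section \<open>The measure in the parameters s and alpha\<close>

text \<open>
  The factor \<open>\<alpha>\<^sup>\<gamma>\<^sup>-\<^sup>1 d\<alpha>\<close> of the surface
  measure, as a measure on the whole line that ignores \<open>\<alpha> \<le> 0\<close>: real
  powers of negative numbers then never matter, and the products below are products with
  Lebesgue measure.
\<close>

definition radial_measure :: "real \<Rightarrow> real measure" where
  "radial_measure \<gamma> = density lborel (\<lambda>\<alpha>. ennreal (indicator {0<..} \<alpha> * \<alpha> powr (\<gamma> - 1)))"

abbreviation fibre_measure :: "real \<Rightarrow> (real \<times> real) measure" where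
  "fibre_measure \<gamma> \<equiv> lborel \<Otimes>\<^sub>M radial_measure \<gamma>"

lemma sets_radial_measure [measurable_cong, simp]: "sets (radial_measure \<gamma>) = sets borel"
  by (simp add: radial_measure_def)

lemma space_radial_measure [simp]: "space (radial_measure \<gamma>) = UNIV"
  by (simp add: radial_measure_def)

lemma sigma_finite_radial_measure: "sigma_finite_measure (radial_measure \<gamma>)"
  unfolding radial_measure_def
  by (subst sigma_finite_measure.sigma_finite_iff_density_finite[OF sigma_finite_lborel]) auto

lemma pair_sigma_finite_fibre: "pair_sigma_finite lborel (radial_measure \<gamma>)"
  by (intro pair_sigma_finite.intro sigma_finite_lborel sigma_finite_radial_measure)

lemma sigma_finite_fibre_measure: "sigma_finite_measure (fibre_measure \<gamma>)"
proof -
  interpret pair_sigma_finite lborel "radial_measure \<gamma>" by (rule pair_sigma_finite_fibre)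
  show ?thesis by unfold_locales
qed

lemma nn_integral_fibre:
  assumes "case_prod F \<in> borel_measurable (borel \<Otimes>\<^sub>M borel)"
  shows "(\<integral>\<^sup>+\<zeta>. F (fst \<zeta>) (snd \<zeta>) \<partial>fibre_measure \<gamma>) = (\<integral>\<^sup>+\<alpha>. \<integral>\<^sup>+s. F s \<alpha> \<partial>lborel \<partial>radial_measure \<gamma>)"
proof -
  interpret pair_sigma_finite lborel "radial_measure \<gamma>" by (rule pair_sigma_finite_fibre)
  have [measurable]: "case_prod F \<in> borel_measurable (borel \<Otimes>\<^sub>M borel)" by fact
  show ?thesis by (subst nn_integral_snd[symmetric]) auto
qed

lemma AE_radial_pos: "AE \<alpha> in radial_measure \<gamma>. \<alpha> > 0"
  unfolding radial_measure_def by (subst AE_density) (auto intro!: AE_I2 simp: indicator_def)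

lemma AE_fibre_pos: "AE \<zeta> in fibre_measure \<gamma>. snd \<zeta> > 0"
proof -
  interpret pair_sigma_finite lborel "radial_measure \<gamma>" by (rule pair_sigma_finite_fibre)
  have "{\<zeta> \<in> space (fibre_measure \<gamma>). 0 < snd \<zeta>} \<in> sets (fibre_measure \<gamma>)" by measurable
  then show ?thesis by (rule AE_pair_measure) (auto intro: AE_radial_pos)
qed

lemma nn_integral_radial_powr:
  assumes [measurable]: "F \<in> borel_measurable borel" and g: "\<gamma> > 0"
  shows "(\<integral>\<^sup>+\<alpha>. F (\<alpha> powr \<gamma>) \<partial>radial_measure \<gamma>) = ennreal (1 / \<gamma>) * (\<integral>\<^sup>+t. F t * indicator {0<..} t \<partial>lborel)"
proof -
  have "(\<integral>\<^sup>+\<alpha>. F (\<alpha> powr \<gamma>) \<partial>radial_measure \<gamma>) =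
     (\<integral>\<^sup>+\<alpha>. ennreal (indicator {0<..} \<alpha> * \<alpha> powr (\<gamma> - 1)) * F (\<alpha> powr \<gamma>) \<partial>lborel)"
    unfolding radial_measure_def by (rule nn_integral_density) measurable
  also have "\<dots> = (\<integral>\<^sup>+\<alpha>. F (\<alpha> powr \<gamma>) * ennreal (indicator {0<..} \<alpha> * \<alpha> powr (\<gamma> - 1)) \<partial>lborel)"
    by (simp only: mult.commute)
  also have "\<dots> = ennreal (1 / \<gamma>) * (\<integral>\<^sup>+t. F t * indicator {0<..} t \<partial>lborel)"
    by (rule nn_integral_powr_substitution) (use g in measurable)
  finally show ?thesis .
qed

lemma distr_radial_powr:
  assumes g: "\<gamma> > 0"
  shows "distr (radial_measure \<gamma>) borel (\<lambda>\<alpha>. \<alpha> powr \<gamma>) = density lborel (\<lambda>t. ennreal (indicator {0<..} t / \<gamma>))"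
proof (rule measure_eqI)
  fix A assume "A \<in> sets (distr (radial_measure \<gamma>) borel (\<lambda>\<alpha>. \<alpha> powr \<gamma>))"
  then have [measurable]: "A \<in> sets borel" by simp
  have "emeasure (distr (radial_measure \<gamma>) borel (\<lambda>\<alpha>. \<alpha> powr \<gamma>)) A =
      (\<integral>\<^sup>+t. indicator A t \<partial>distr (radial_measure \<gamma>) borel (\<lambda>\<alpha>. \<alpha> powr \<gamma>))" by simp
  also have "\<dots> = (\<integral>\<^sup>+\<alpha>. indicator A (\<alpha> powr \<gamma>) \<partial>radial_measure \<gamma>)"
    by (rule nn_integral_distr) measurable
  also have "\<dots> = ennreal (1 / \<gamma>) * (\<integral>\<^sup>+t. indicator A t * indicator {0<..} t \<partial>lborel)"
    by (rule nn_integral_radial_powr) (use g in measurable)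
  also have "\<dots> = (\<integral>\<^sup>+t. ennreal (1 / \<gamma>) * (indicator A t * indicator {0<..} t) \<partial>lborel)"
    by (subst nn_integral_cmult) auto
  also have "\<dots> = (\<integral>\<^sup>+t. ennreal (indicator {0<..} t / \<gamma>) * indicator A t \<partial>lborel)"
    by (intro nn_integral_cong) (auto simp: indicator_def)
  finally show "emeasure (distr (radial_measure \<gamma>) borel (\<lambda>\<alpha>. \<alpha> powr \<gamma>)) A = emeasure (density lborel (\<lambda>t. ennreal (indicator {0<..} t / \<gamma>))) A"
    by (simp add: emeasure_density)
qed simp

lemma integral_radial_powr:
  fixes G :: "real \<Rightarrow> complex"
  assumes [measurable]: "G \<in> borel_measurable borel" and g: "\<gamma> > 0"
  shows "(\<integral>\<alpha>. G (\<alpha> powr \<gamma>) \<partial>radial_measure \<gamma>) = (LINT t:{0<..}|lborel. G t) / of_real \<gamma>"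
proof -
  have "(\<integral>\<alpha>. G (\<alpha> powr \<gamma>) \<partial>radial_measure \<gamma>) = (\<integral>t. G t \<partial>distr (radial_measure \<gamma>) borel (\<lambda>\<alpha>. \<alpha> powr \<gamma>))"
    by (subst integral_distr) auto
  also have "\<dots> = (\<integral>t. (indicator {0<..} t / \<gamma>) *\<^sub>R G t \<partial>lborel)"
    unfolding distr_radial_powr[OF g] by (rule integral_density) (use g in auto)
  also have "\<dots> = (\<integral>t. (indicator {0<..} t *\<^sub>R G t) / of_real \<gamma> \<partial>lborel)"
    by (intro Bochner_Integration.integral_cong refl) (auto simp: indicator_def scaleR_conv_of_real)
  finally show ?thesis by (simp add: set_lebesgue_integral_def)
qed

lemma nn_integral_radial_power_exp:
  assumes g: "\<gamma> > 0" and b: "b > 0" and r: "r \<ge> 0"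
  shows "(\<integral>\<^sup>+\<alpha>. ennreal (\<alpha> powr r * exp (- (b * \<alpha> powr \<gamma>))) \<partial>radial_measure \<gamma>)
     = ennreal (Gamma (r / \<gamma> + 1) / (\<gamma> * b powr (r / \<gamma> + 1)))"
proof -
  have "(\<integral>\<^sup>+\<alpha>. ennreal (\<alpha> powr r * exp (- (b * \<alpha> powr \<gamma>))) \<partial>radial_measure \<gamma>) =
     (\<integral>\<^sup>+\<alpha>. ennreal ((\<alpha> powr \<gamma>) powr (r / \<gamma>) * exp (- (b * \<alpha> powr \<gamma>))) \<partial>radial_measure \<gamma>)"
    using g by (simp add: powr_powr)
  also have "\<dots> = ennreal (1 / \<gamma>) * (\<integral>\<^sup>+t. ennreal (t powr (r / \<gamma>) * exp (- (b * t))) * indicator {0<..} t \<partial>lborel)"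
    by (rule nn_integral_radial_powr) (use g in measurable)
  also have "\<dots> = ennreal (1 / \<gamma>) * ennreal (Gamma (r / \<gamma> + 1) / b powr (r / \<gamma> + 1))"
    using g r b by (subst nn_integral_Gamma_scaled) auto
  also have "\<dots> = ennreal (Gamma (r / \<gamma> + 1) / (\<gamma> * b powr (r / \<gamma> + 1)))"
    using g by (simp flip: ennreal_mult')
  finally show ?thesis .
qed

text \<open>
  This single integral gives the L2 bounds for the rows and the columns of all kernels, and
  both norms in the computation of the extremal function.
\<close>

lemma nn_integral_fibre_inverse_quartic:
  assumes g: "\<gamma> > 0" and c: "c > 0" and d: "d > 0"
  shows "(\<integral>\<^sup>+\<zeta>. ennreal (1 / cmod (Complex (c * snd \<zeta> powr \<gamma> + d) (fst \<zeta> + b)) ^ 4) \<partial>fibre_measure \<gamma>)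
    = ennreal (pi / (4 * \<gamma> * c * d\<^sup>2))"
proof -
  have C: "Complex (c * \<alpha> powr \<gamma> + d) (s + b) = Complex (c * \<alpha> powr \<gamma> + d) b + \<i> * of_real s" for s \<alpha>
    by (simp add: complex_eq_iff)
  have "(\<integral>\<^sup>+\<zeta>. ennreal (1 / cmod (Complex (c * snd \<zeta> powr \<gamma> + d) (fst \<zeta> + b)) ^ 4) \<partial>fibre_measure \<gamma>)
     = (\<integral>\<^sup>+\<alpha>. \<integral>\<^sup>+s. ennreal (1 / cmod (Complex (c * \<alpha> powr \<gamma> + d) (s + b)) ^ 4) \<partial>lborel \<partial>radial_measure \<gamma>)"
    unfolding Complex_eq by (rule nn_integral_fibre) measurable
  also have "\<dots> = (\<integral>\<^sup>+\<alpha>. ennreal (pi / (2 * (c * \<alpha> powr \<gamma> + d) ^ 3)) \<partial>radial_measure \<gamma>)"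
    unfolding C using c d
    by (intro nn_integral_cong) (subst nn_integral_inverse_quartic_line, auto simp: add_nonneg_pos)
  also have "\<dots> = ennreal (1 / \<gamma>) * (\<integral>\<^sup>+t. ennreal (pi / (2 * (c * t + d) ^ 3)) * indicator {0<..} t \<partial>lborel)"
    by (rule nn_integral_radial_powr[where F="\<lambda>t. ennreal (pi / (2 * (c * t + d) ^ 3))"]) (use g in measurable)
  also have "(\<integral>\<^sup>+t. ennreal (pi / (2 * (c * t + d) ^ 3)) * indicator {0<..} t \<partial>lborel) =
     (\<integral>\<^sup>+t. ennreal (pi / 2) * (ennreal (1 / (c * t + d) ^ 3) * indicator {0<..} t) \<partial>lborel)"
    by (intro nn_integral_cong) (auto simp: indicator_def simp flip: ennreal_mult')
  also have "\<dots> = ennreal (pi / 2) * ennreal (1 / (2 * c * d\<^sup>2))"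
    using c d by (subst nn_integral_cmult) (auto simp: nn_integral_inverse_cube_halfline)
  also have "ennreal (1 / \<gamma>) * (ennreal (pi / 2) * ennreal (1 / (2 * c * d\<^sup>2))) = ennreal (pi / (4 * \<gamma> * c * d\<^sup>2))"
    using g c d by (simp add: mult_ac flip: ennreal_mult')
  finally show ?thesis .
qed

section \<open>The kernels of the single modes\<close>

lemma leray_B_nonneg: "\<gamma> > 0 \<Longrightarrow> a \<ge> 0 \<Longrightarrow> leray_B \<gamma> a \<alpha> \<ge> 0"
  by (simp add: leray_B_def)

text \<open>
  Young's inequality for the exponents \<open>\<gamma>\<close> and
  \<open>\<gamma>/(\<gamma>-1)\<close>: it gives \<open>B \<le> Re A\<close>, by which all
  kernels are dominated by a multiple of \<open>|A|\<^sup>-\<^sup>2\<close>.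
\<close>

lemma leray_B_le:
  assumes g: "\<gamma> > 1" and a: "a > 0" and \<alpha>: "\<alpha> > 0"
  shows "leray_B \<gamma> a \<alpha> \<le> (\<gamma> - 1) * \<alpha> powr \<gamma> + a powr \<gamma>"
proof -
  have "(a powr \<gamma>) powr (1 / \<gamma>) * (\<alpha> powr \<gamma>) powr (1 - 1 / \<gamma>) \<le> 1 / \<gamma> * (a powr \<gamma>) + (1 - 1 / \<gamma>) * (\<alpha> powr \<gamma>)"
    using assms by (intro Youngs_inequality_0) auto
  also have "(a powr \<gamma>) powr (1 / \<gamma>) * (\<alpha> powr \<gamma>) powr (1 - 1 / \<gamma>) = a * \<alpha> powr (\<gamma> - 1)"
    using assms by (simp add: powr_powr right_diff_distrib)
  finally have "\<gamma> * (a * \<alpha> powr (\<gamma> - 1)) \<le> \<gamma> * (1 / \<gamma> * (a powr \<gamma>) + (1 - 1 / \<gamma>) * (\<alpha> powr \<gamma>))"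
    using g by (intro mult_left_mono) auto
  also have "\<dots> = (\<gamma> - 1) * \<alpha> powr \<gamma> + a powr \<gamma>" using g by (simp add: field_simps)
  finally show ?thesis by (simp add: leray_B_def mult.assoc)
qed

text \<open>
  The kernel of \<open>T\<^sub>k\<close>; a point of the fibre is a pair \<open>(s,
  \<alpha>)\<close>.
\<close>

definition leray_kernel :: "real \<Rightarrow> nat \<Rightarrow> real \<times> real \<Rightarrow> real \<times> real \<Rightarrow> complex" where
  "leray_kernel \<gamma> k z \<zeta> = of_real (\<gamma>\<^sup>2 * (real k + 1) / (2 * pi)) *
     (of_real (leray_B \<gamma> (snd z) (snd \<zeta>)) ^ k / leray_A \<gamma> (fst z) (snd z) (fst \<zeta>) (snd \<zeta>) ^ (k + 2))"

lemma leray_kernel_measurable [measurable (raw)]: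
  assumes [measurable]: "f \<in> measurable M (borel \<Otimes>\<^sub>M borel)" "g \<in> measurable M (borel \<Otimes>\<^sub>M borel)"
  shows "(\<lambda>x. leray_kernel \<gamma> k (f x) (g x)) \<in> borel_measurable M"
proof -
  have [measurable]: "(\<lambda>x. fst (f x)) \<in> borel_measurable M" "(\<lambda>x. snd (f x)) \<in> borel_measurable M"
    "(\<lambda>x. fst (g x)) \<in> borel_measurable M" "(\<lambda>x. snd (g x)) \<in> borel_measurable M"
    by (rule measurable_compose[OF assms(1) measurable_fst] measurable_compose[OF assms(1) measurable_snd]
        measurable_compose[OF assms(2) measurable_fst] measurable_compose[OF assms(2) measurable_snd])+
  have [measurable]: "(\<lambda>x. leray_A \<gamma> (fst (f x)) (snd (f x)) (fst (g x)) (snd (g x))) \<in> borel_measurable M"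
    unfolding leray_A_def Complex_eq
    by (intro borel_measurable_add borel_measurable_times borel_measurable_of_real borel_measurable_diff
        borel_measurable_const powr_real_measurable) measurable
  have [measurable]: "(\<lambda>x. leray_B \<gamma> (snd (f x)) (snd (g x))) \<in> borel_measurable M"
    unfolding leray_B_def by measurable
  show ?thesis
    unfolding leray_kernel_def
    by (rule borel_measurable_times[OF borel_measurable_const borel_measurable_divide[OF borel_measurable_power borel_measurable_power]]) measurable
qed

lemma leray_kernel_row_measurable [measurable]: "leray_kernel \<gamma> k z \<in> borel_measurable (borel \<Otimes>\<^sub>M borel)"
proof (rule leray_kernel_measurable[of "\<lambda>_. z" "borel \<Otimes>\<^sub>M borel" "\<lambda>x. x"])
  show "(\<lambda>_. z) \<in> measurable (borel \<Otimes>\<^sub>M borel) (borel \<Otimes>\<^sub>M borel)"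
    by (rule measurable_const) (simp add: space_pair_measure)
qed (rule measurable_ident_sets[OF refl])

definition leray_mode :: "real \<Rightarrow> nat \<Rightarrow> (real \<times> real \<Rightarrow> complex) \<Rightarrow> real \<times> real \<Rightarrow> complex" where
  "leray_mode \<gamma> k u z = (\<integral>\<zeta>. leray_kernel \<gamma> k z \<zeta> * u \<zeta> \<partial>fibre_measure \<gamma>)"

lemma leray_mode_measurable [measurable]:
  assumes [measurable]: "u \<in> borel_measurable (borel \<Otimes>\<^sub>M borel)"
  shows "leray_mode \<gamma> k u \<in> borel_measurable (borel \<Otimes>\<^sub>M borel)"
proof -
  interpret sigma_finite_measure "fibre_measure \<gamma>" by (rule sigma_finite_fibre_measure)
  show ?thesis unfolding leray_mode_def by measurable
qed

lemma cmod_leray_kernel_le: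
  assumes g: "\<gamma> > 1" and z: "snd z > 0" and \<zeta>: "snd \<zeta> > 0"
  shows "cmod (leray_kernel \<gamma> k z \<zeta>) \<le> \<gamma>\<^sup>2 * (real k + 1) / (2 * pi) * (1 / cmod (leray_A \<gamma> (fst z) (snd z) (fst \<zeta>) (snd \<zeta>)) ^ 2)"
proof -
  define A where "A = leray_A \<gamma> (fst z) (snd z) (fst \<zeta>) (snd \<zeta>)"
  define B where "B = leray_B \<gamma> (snd z) (snd \<zeta>)"
  have "Re A = (\<gamma> - 1) * snd \<zeta> powr \<gamma> + snd z powr \<gamma>" by (simp add: A_def leray_A_def)
  then have A: "Re A > 0" "B \<le> Re A"
    using leray_B_le[OF g z \<zeta>] g z \<zeta> by (auto simp: B_def intro!: add_nonneg_pos)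
  have B: "B \<ge> 0" using g z by (auto simp: B_def intro: leray_B_nonneg)
  have "B ^ k \<le> cmod A ^ k" using A B complex_Re_le_cmod[of A] by (intro power_mono) auto
  moreover have "cmod A > 0" using A complex_Re_le_cmod[of A] by linarith
  ultimately have "B ^ k / cmod A ^ (k + 2) \<le> cmod A ^ k / cmod A ^ (k + 2)"
    by (intro divide_right_mono) auto
  also have "\<dots> = 1 / cmod A ^ 2" using \<open>cmod A > 0\<close> by (simp add: power_add power2_eq_square)
  finally have le: "B ^ k / cmod A ^ (k + 2) \<le> 1 / cmod A ^ 2" .
  define D where "D = \<gamma>\<^sup>2 * (real k + 1) / (2 * pi)"
  have D: "D \<ge> 0" by (simp add: D_def)
  from le have "D * (B ^ k / cmod A ^ (k + 2)) \<le> D * (1 / cmod A ^ 2)"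
    using D by (rule mult_left_mono)
  then have le2: "D * (B ^ k / cmod A ^ (k + 2)) \<le> D * (1 / cmod A ^ 2)" .
  have n: "cmod (of_real D * (of_real B ^ k / A ^ (k + 2))) = D * (B ^ k / cmod A ^ (k + 2))"
    by (simp only: norm_mult norm_divide norm_power norm_of_real abs_of_nonneg[OF B] abs_of_nonneg[OF D])
  show ?thesis
    unfolding leray_kernel_def A_def[symmetric] B_def[symmetric] D_def[symmetric] n by (rule le2)
qed

lemma leray_kernel_row_L2:
  assumes g: "\<gamma> > 1" and z: "snd z > 0"
  shows "leray_kernel \<gamma> k z \<in> L2 (fibre_measure \<gamma>)"
proof -
  define C where "C = \<gamma>\<^sup>2 * (real k + 1) / (2 * pi)"
  have "L2_energy (fibre_measure \<gamma>) (leray_kernel \<gamma> k z) \<le>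
     (\<integral>\<^sup>+\<zeta>. ennreal (C\<^sup>2) * ennreal (1 / cmod (Complex ((\<gamma> - 1) * snd \<zeta> powr \<gamma> + snd z powr \<gamma>) (fst \<zeta> + - fst z)) ^ 4) \<partial>fibre_measure \<gamma>)"
    unfolding L2_energy_def
  proof (rule nn_integral_mono_AE, use AE_fibre_pos in eventually_elim)
    case (elim \<zeta>)
    have c: "cmod (leray_A \<gamma> (fst z) (snd z) (fst \<zeta>) (snd \<zeta>)) = cmod (Complex ((\<gamma> - 1) * snd \<zeta> powr \<gamma> + snd z powr \<gamma>) (fst \<zeta> + - fst z))"
      by (simp add: leray_A_def)
    have "(cmod (leray_kernel \<gamma> k z \<zeta>))\<^sup>2 \<le> (C * (1 / cmod (leray_A \<gamma> (fst z) (snd z) (fst \<zeta>) (snd \<zeta>)) ^ 2))\<^sup>2"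
      unfolding C_def by (rule power_mono[OF cmod_leray_kernel_le[OF g z elim]]) simp
    also have "\<dots> = C\<^sup>2 * (1 / cmod (Complex ((\<gamma> - 1) * snd \<zeta> powr \<gamma> + snd z powr \<gamma>) (fst \<zeta> + - fst z)) ^ 4)"
      unfolding c by (simp add: power_mult_distrib power_divide flip: power_mult)
    finally show ?case by (simp add: ennreal_mult'[symmetric] ennreal_leI)
  qed
  also have "\<dots> = ennreal (C\<^sup>2) * ennreal (pi / (4 * \<gamma> * (\<gamma> - 1) * (snd z powr \<gamma>)\<^sup>2))"
    using g z by (subst nn_integral_cmult, simp add: Complex_eq, subst nn_integral_fibre_inverse_quartic) auto
  also have "\<dots> < \<infinity>" by (simp flip: ennreal_mult')
  finally show ?thesis by (simp add: L2_iff_energy)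
qed

text \<open>
  The bound is uniform for \<open>\<alpha>\<close> bounded away from zero, which is what the
  use of Fubini for truncated functions requires.
\<close>

lemma leray_kernel_column_L2:
  assumes g: "\<gamma> > 1" and d: "d > 0" and \<zeta>: "snd \<zeta> \<ge> d"
  shows "(\<lambda>z. leray_kernel \<gamma> k z \<zeta>) \<in> L2 (fibre_measure \<gamma>)"
    and "L2_norm (fibre_measure \<gamma>) (\<lambda>z. leray_kernel \<gamma> k z \<zeta>) \<le>
       \<gamma>\<^sup>2 * (real k + 1) / (2 * pi) * sqrt (pi / (4 * \<gamma> * ((\<gamma> - 1) * d powr \<gamma>)\<^sup>2))"
proof -
  define C where "C = \<gamma>\<^sup>2 * (real k + 1) / (2 * pi)"
  define e where "e = (\<gamma> - 1) * d powr \<gamma>"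
  have e: "e > 0" "e \<le> (\<gamma> - 1) * snd \<zeta> powr \<gamma>" using g d \<zeta> by (auto simp: e_def intro!: mult_left_mono powr_mono2)
  have "L2_energy (fibre_measure \<gamma>) (\<lambda>z. leray_kernel \<gamma> k z \<zeta>) \<le>
     (\<integral>\<^sup>+z. ennreal (C\<^sup>2) * ennreal (1 / cmod (Complex (1 * snd z powr \<gamma> + (\<gamma> - 1) * snd \<zeta> powr \<gamma>) (fst z + - fst \<zeta>)) ^ 4) \<partial>fibre_measure \<gamma>)"
    unfolding L2_energy_def
  proof (rule nn_integral_mono_AE, use AE_fibre_pos in eventually_elim)
    case (elim z)
    have c: "cmod (leray_A \<gamma> (fst z) (snd z) (fst \<zeta>) (snd \<zeta>)) = cmod (Complex (1 * snd z powr \<gamma> + (\<gamma> - 1) * snd \<zeta> powr \<gamma>) (fst z + - fst \<zeta>))"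
      by (simp add: leray_A_def cmod_def power2_commute add.commute)
    have "(cmod (leray_kernel \<gamma> k z \<zeta>))\<^sup>2 \<le> (C * (1 / cmod (leray_A \<gamma> (fst z) (snd z) (fst \<zeta>) (snd \<zeta>)) ^ 2))\<^sup>2"
      unfolding C_def by (intro power_mono cmod_leray_kernel_le g elim) (use d \<zeta> in auto)
    also have "\<dots> = C\<^sup>2 * (1 / cmod (Complex (1 * snd z powr \<gamma> + (\<gamma> - 1) * snd \<zeta> powr \<gamma>) (fst z + - fst \<zeta>)) ^ 4)"
      unfolding c by (simp add: power_mult_distrib power_divide flip: power_mult)
    finally show ?case by (simp add: ennreal_mult'[symmetric] ennreal_leI)
  qed
  also have "\<dots> = ennreal (C\<^sup>2) * ennreal (pi / (4 * \<gamma> * 1 * ((\<gamma> - 1) * snd \<zeta> powr \<gamma>)\<^sup>2))"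
    using g d \<zeta> e by (subst nn_integral_cmult, simp add: Complex_eq, subst nn_integral_fibre_inverse_quartic) auto
  also have "\<dots> = ennreal (C\<^sup>2 * (pi / (4 * \<gamma> * ((\<gamma> - 1) * snd \<zeta> powr \<gamma>)\<^sup>2)))"
    by (simp flip: ennreal_mult')
  also have "\<dots> \<le> ennreal (C\<^sup>2 * (pi / (4 * \<gamma> * e\<^sup>2)))"
  proof -
    have "pi / (4 * \<gamma> * E\<^sup>2) \<le> pi / (4 * \<gamma> * e\<^sup>2)" if "e \<le> E" for E
    proof -
      have "e\<^sup>2 \<le> E\<^sup>2" using e(1) that by (intro power_mono) auto
      moreover have "e\<^sup>2 > 0" using e(1) by simp
      ultimately show ?thesis using g by (simp add: frac_le)
    qed
    from this[OF e(2)] show ?thesis by (intro ennreal_leI) (rule mult_left_mono, auto)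
  qed
  also have "\<dots> = ennreal ((C * sqrt (pi / (4 * \<gamma> * e\<^sup>2)))\<^sup>2)"
    using g by (simp add: power_mult_distrib)
  finally have le: "L2_energy (fibre_measure \<gamma>) (\<lambda>z. leray_kernel \<gamma> k z \<zeta>) \<le> ennreal ((C * sqrt (pi / (4 * \<gamma> * e\<^sup>2)))\<^sup>2)" .
  have C: "C * sqrt (pi / (4 * \<gamma> * e\<^sup>2)) \<ge> 0"
    using g by (intro mult_nonneg_nonneg real_sqrt_ge_zero) (auto simp: C_def)
  have m: "(\<lambda>z. leray_kernel \<gamma> k z \<zeta>) \<in> borel_measurable (fibre_measure \<gamma>)"
    by measurable (simp_all add: space_pair_measure)
  show "(\<lambda>z. leray_kernel \<gamma> k z \<zeta>) \<in> L2 (fibre_measure \<gamma>)"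
    by (rule L2_from_energy_le(1)[OF m le C])
  show "L2_norm (fibre_measure \<gamma>) (\<lambda>z. leray_kernel \<gamma> k z \<zeta>) \<le> \<gamma>\<^sup>2 * (real k + 1) / (2 * pi) * sqrt (pi / (4 * \<gamma> * ((\<gamma> - 1) * d powr \<gamma>)\<^sup>2))"
    unfolding C_def[symmetric] e_def[symmetric] by (rule L2_from_energy_le(2)[OF m le C])
qed


section \<open>The norm of a single mode on integrable functions\<close>

text \<open>
  Only one of the two functions has to be in L2: if the energy of the other is infinite, the
  right-hand side is infinite unless the first function vanishes almost everywhere.
\<close>

lemma L2_energy_Cauchy_Schwarz:
  assumes [measurable]: "f \<in> borel_measurable M" "g \<in> borel_measurable M" and fin: "L2_energy M f < \<infinity>"
  shows "ennreal ((cmod (\<integral>x. f x * g x \<partial>M))\<^sup>2) \<le> L2_energy M f * L2_energy M g"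
proof -
  have f: "f \<in> L2 M" using assms by (simp add: L2_iff_energy)
  show ?thesis
  proof (cases "L2_energy M g < \<infinity>")
    case True
    then have g: "g \<in> L2 M" using assms by (simp add: L2_iff_energy)
    have "(cmod (\<integral>x. f x * g x \<partial>M))\<^sup>2 \<le> (L2_norm M f * L2_norm M g)\<^sup>2"
      by (intro power_mono L2_Cauchy_Schwarz f g) simp
    then have "ennreal ((cmod (\<integral>x. f x * g x \<partial>M))\<^sup>2) \<le> ennreal ((L2_norm M f * L2_norm M g)\<^sup>2)"
      by (rule ennreal_leI)
    then show ?thesis
      by (simp add: L2_norm_square_energy[OF f, symmetric] L2_norm_square_energy[OF g, symmetric] power_mult_distrib ennreal_mult)
  next
    case False
    then have top: "L2_energy M g = \<infinity>" by (metis infinity_ennreal_def top.not_eq_extremum)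
    show ?thesis
    proof (cases "L2_energy M f = 0")
      case True
      then have "AE x in M. f x = 0"
        unfolding L2_energy_def by (subst (asm) nn_integral_0_iff_AE) auto
      then have "(\<integral>x. f x * g x \<partial>M) = 0" by (intro integral_eq_zero_AE) auto
      then show ?thesis by simp
    next
      case False
      then show ?thesis unfolding top by (simp add: ennreal_mult_top)
    qed
  qed
qed

lemma nn_integral_power_exp:
  assumes r: "r > 0"
  shows "(\<integral>\<^sup>+\<xi>. ennreal (indicator {0<..} \<xi> * (\<xi> ^ n * exp (- (\<xi> * r)))) \<partial>lborel) = ennreal (fact n / r ^ (n + 1))"
proof -
  have "(\<integral>\<^sup>+\<xi>. ennreal (indicator {0<..} \<xi> * (\<xi> ^ n * exp (- (\<xi> * r)))) \<partial>lborel) =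
     (\<integral>\<^sup>+t. ennreal (t powr real n * exp (- (r * t))) * indicator {0<..} t \<partial>lborel)"
    by (intro nn_integral_cong) (auto simp: indicator_def powr_realpow mult.commute)
  also have "\<dots> = ennreal (Gamma (real n + 1) / r powr (real n + 1))"
    using r by (intro nn_integral_Gamma_scaled) auto
  also have "r powr (real n + 1) = r ^ (n + 1)"
    using r powr_realpow[of r "n + 1"] by (simp add: add.commute)
  also have "Gamma (real n + 1) = fact n" using Gamma_fact[of n, where 'a=real] by (simp add: add.commute)
  finally show ?thesis .
qed

text \<open>
  The squared norm of the rank one operator at the frequency \<open>\<xi>\<close>, up to the
  factor \<open>4 \<pi>\<^sup>2\<close> that comes from the two uses of the Fourier
  inequality. All powers of \<open>\<xi>\<close> cancel because \<open>x + y = 2k\<close>.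
\<close>

lemma leray_mode_constant_le:
  fixes \<gamma> \<xi> :: real and k :: nat
  assumes g: "\<gamma> > 1" and \<xi>: "\<xi> > 0"
  defines "x \<equiv> 2 * real k / \<gamma>" and "y \<equiv> 2 * real k - 2 * real k / \<gamma>"
  shows "(\<gamma>\<^sup>2 * (real k + 1) / (2 * pi) / fact (k + 1))\<^sup>2 * \<xi> ^ (2 * k + 2) * \<gamma> ^ (2 * k) *
      (Gamma (x + 1) / (\<gamma> * (2 * \<xi>) powr (x + 1))) * (Gamma (y + 1) / (\<gamma> * (2 * \<xi> * (\<gamma> - 1)) powr (y + 1)))
    \<le> \<gamma>\<^sup>2 / (16 * pi\<^sup>2 * (\<gamma> - 1))"
proof -
  define P where "P = (\<gamma> - 1) powr y"
  define G where "G = Gamma (x + 1) * Gamma (y + 1)"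
  have P: "P > 0" using g by (simp add: P_def)
  have bound: "\<gamma> ^ (2 * k) * G \<le> (fact k)\<^sup>2 * 2 ^ (2 * k) * P"
    using Gamma_product_bound[OF g, of k] by (simp add: G_def P_def x_def y_def)
  have xy: "(x + 1) + (y + 1) = real (2 * k + 2)" by (simp add: x_def y_def)
  have "(2 * \<xi>) powr (x + 1) * (2 * \<xi> * (\<gamma> - 1)) powr (y + 1) = (2 * \<xi>) powr ((x + 1) + (y + 1)) * (\<gamma> - 1) powr (y + 1)"
  proof -
    have "Z powr p * (Z * m) powr q = Z powr (p + q) * m powr q" if "Z > 0" "m > 0" for Z m p q :: real
      using that by (simp add: powr_mult powr_add)
    from this[of "2 * \<xi>" "\<gamma> - 1"] show ?thesis using g \<xi> by simp
  qed
  also have "\<dots> = (2 * \<xi>) ^ (2 * k + 2) * (P * (\<gamma> - 1))"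
    unfolding xy P_def using g \<xi> by (subst powr_realpow) (auto simp: powr_add)
  finally have pw: "(2 * \<xi>) powr (x + 1) * (2 * \<xi> * (\<gamma> - 1)) powr (y + 1) = (2 * \<xi>) ^ (2 * k + 2) * (P * (\<gamma> - 1))" .
  have fk: "\<gamma>\<^sup>2 * (real k + 1) / (2 * pi) / fact (k + 1) = \<gamma>\<^sup>2 / (2 * pi * fact k)"
  proof -
    have "g2 * m / p / (m * f) = g2 / (p * f)" if "m \<noteq> 0" for g2 m p f :: real
      using that by simp
    from this[of "real k + 1" "\<gamma>\<^sup>2" "2 * pi" "fact k"] show ?thesis by (simp add: add.commute)
  qed
  have "(\<gamma>\<^sup>2 * (real k + 1) / (2 * pi) / fact (k + 1))\<^sup>2 * \<xi> ^ (2 * k + 2) * \<gamma> ^ (2 * k) *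
      (Gamma (x + 1) / (\<gamma> * (2 * \<xi>) powr (x + 1))) * (Gamma (y + 1) / (\<gamma> * (2 * \<xi> * (\<gamma> - 1)) powr (y + 1)))
     = (\<gamma>\<^sup>2 / (2 * pi * fact k))\<^sup>2 * \<xi> ^ (2 * k + 2) * (\<gamma> ^ (2 * k) * G) /
        (\<gamma>\<^sup>2 * ((2 * \<xi>) powr (x + 1) * (2 * \<xi> * (\<gamma> - 1)) powr (y + 1)))"
    unfolding fk G_def by (simp add: power2_eq_square)
  also have "\<dots> \<le> (\<gamma>\<^sup>2 / (2 * pi * fact k))\<^sup>2 * \<xi> ^ (2 * k + 2) * ((fact k)\<^sup>2 * 2 ^ (2 * k) * P) /
        (\<gamma>\<^sup>2 * ((2 * \<xi>) powr (x + 1) * (2 * \<xi> * (\<gamma> - 1)) powr (y + 1)))"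
    using \<xi> g by (intro divide_right_mono mult_left_mono bound) auto
  also have "\<dots> = \<gamma>\<^sup>2 / (16 * pi\<^sup>2 * (\<gamma> - 1))"
  proof -
    have alg: "(g2 / (2 * p * f))\<^sup>2 * X * (f\<^sup>2 * T * P) / (g2 * ((T * 4 * X) * (P * m))) = g2 / (16 * p\<^sup>2 * m)"
      if "g2 \<noteq> 0" "p \<noteq> 0" "f \<noteq> 0" "X \<noteq> 0" "T \<noteq> 0" "P \<noteq> 0" "m \<noteq> 0" for g2 p f X T P m :: real
      using that by (simp add: field_simps power2_eq_square)
    have "(2 * \<xi>) ^ (2 * k + 2) = 2 ^ (2 * k) * 4 * \<xi> ^ (2 * k + 2)"
      by (simp only: power_mult_distrib) (simp add: power_add power2_eq_square)
    then show ?thesis unfolding pw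
      using alg[of "\<gamma>\<^sup>2" pi "fact k" "\<xi> ^ (2 * k + 2)" "2 ^ (2 * k)" P "\<gamma> - 1"] g \<xi> P by simp
  qed
  finally show ?thesis .
qed

lemma Re_leray_A: "Re (leray_A \<gamma> sz a s \<alpha>) = (\<gamma> - 1) * \<alpha> powr \<gamma> + a powr \<gamma>"
  by (simp add: leray_A_def)

text \<open>
  The separation of \<open>z = (sz, a)\<close> from \<open>\<zeta> = (s, \<alpha>)\<close>
  that makes the operator of rank one at each frequency.
\<close>

lemma exp_leray_A:
  "exp (- (of_real \<xi> * leray_A \<gamma> sz a s \<alpha>)) =
     of_real (exp (- (\<xi> * ((\<gamma> - 1) * \<alpha> powr \<gamma>))) * exp (- (\<xi> * a powr \<gamma>))) * (cis (- (\<xi> * s)) * cis (\<xi> * sz))"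
proof -
  have "- (of_real \<xi> * leray_A \<gamma> sz a s \<alpha>) = Complex (- (\<xi> * ((\<gamma> - 1) * \<alpha> powr \<gamma>)) + - (\<xi> * a powr \<gamma>)) (- (\<xi> * s) + \<xi> * sz)"
    by (simp add: leray_A_def complex_eq_iff algebra_simps)
  then show ?thesis by (simp only: exp_eq_polar complex.sel exp_add cis_mult)
qed

text \<open>
  At the frequency \<open>\<xi> > 0\<close> the operator is the pairing \<open>D\<close> of
  the partial Fourier transform \<open>uhat\<close> with \<open>\<Psi>\<close>, multiplied by
  the profile \<open>w\<close>. The bound on the support of \<open>u\<close> makes
  \<open>D\<close> absolutely convergent for every \<open>\<xi> > 0\<close>. Energies are then
  estimated in three steps: the Fourier inequality in the variable \<open>s\<close> of the
  image, Cauchy-Schwarz for \<open>D\<close>, and the Fourier inequality in the variable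
  \<open>s\<close> of \<open>u\<close>.
\<close>

lemma leray_mode_energy_le_integrable:
  assumes g: "\<gamma> > 1" and um [measurable]: "u \<in> borel_measurable (borel \<Otimes>\<^sub>M borel)"
    and ui: "integrable (fibre_measure \<gamma>) u" and ub: "\<And>\<zeta>. snd \<zeta> > b \<Longrightarrow> u \<zeta> = 0"
  shows "L2_energy (fibre_measure \<gamma>) (leray_mode \<gamma> k u) \<le> ennreal (\<gamma>\<^sup>2 / (4 * (\<gamma> - 1))) * L2_energy (fibre_measure \<gamma>) u"
proof -
  interpret pair_sigma_finite lborel "radial_measure \<gamma>" by (rule pair_sigma_finite_fibre)
  define C where "C = \<gamma>\<^sup>2 * (real k + 1) / (2 * pi)"
  have C: "C \<ge> 0" by (simp add: C_def)
  define \<Psi> where "\<Psi> \<xi> \<alpha> = (\<alpha> powr (\<gamma> - 1)) ^ k * exp (- (\<xi> * ((\<gamma> - 1) * \<alpha> powr \<gamma>)))" for \<xi> \<alpha>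
  define uhat where "uhat \<xi> \<alpha> = fourier_integral (\<lambda>s. u (s, \<alpha>)) \<xi>" for \<xi> \<alpha>
  define D where "D \<xi> = (\<integral>\<alpha>. of_real (\<Psi> \<xi> \<alpha>) * uhat \<xi> \<alpha> \<partial>radial_measure \<gamma>)" for \<xi>
  define w where "w a \<xi> = indicator {0<..} \<xi> * (C / fact (k + 1) * \<xi> ^ (k + 1) * (\<gamma> * a) ^ k * exp (- (\<xi> * a powr \<gamma>)))" for a \<xi> :: real
  define W where "W a \<xi> = of_real (w a \<xi>) * D \<xi>" for a \<xi>
  have [measurable]: "(\<lambda>(\<xi>, \<alpha>). uhat \<xi> \<alpha>) \<in> borel_measurable (borel \<Otimes>\<^sub>M borel)"
    unfolding uhat_def fourier_integral_def by measurable
  have \<Psi>m [measurable]: "(\<lambda>(\<xi>, \<alpha>). \<Psi> \<xi> \<alpha>) \<in> borel_measurable (borel \<Otimes>\<^sub>M borel)"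
    unfolding \<Psi>_def by measurable
  interpret R: sigma_finite_measure "radial_measure \<gamma>" by (rule sigma_finite_radial_measure)
  have [measurable]: "D \<in> borel_measurable borel"
    unfolding D_def by measurable
  have [measurable]: "(\<lambda>(a, \<xi>). w a \<xi>) \<in> borel_measurable (borel \<Otimes>\<^sub>M borel)"
    unfolding w_def by measurable
  have [measurable]: "(\<lambda>(a, \<xi>). W a \<xi>) \<in> borel_measurable (borel \<Otimes>\<^sub>M borel)"
    unfolding W_def by measurable

  \<comment> \<open>The pairing \<open>D\<close> as an integral over the whole fibre.\<close>
  have D_eq: "(\<integral>\<zeta>. of_real (\<Psi> \<xi> (snd \<zeta>)) * (u \<zeta> * cis (- (\<xi> * fst \<zeta>))) \<partial>fibre_measure \<gamma>) = D \<xi>" if \<xi>: "\<xi> > 0" for \<xi>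
  proof -
    have i: "integrable (fibre_measure \<gamma>) (\<lambda>\<zeta>. of_real (\<Psi> \<xi> (snd \<zeta>)) * (u \<zeta> * cis (- (\<xi> * fst \<zeta>))))"
    proof (rule Bochner_Integration.integrable_bound)
      show "integrable (fibre_measure \<gamma>) (\<lambda>\<zeta>. of_real ((b powr (\<gamma> - 1)) ^ k) * u \<zeta>)" using ui by simp
      show "AE \<zeta> in fibre_measure \<gamma>. norm (of_real (\<Psi> \<xi> (snd \<zeta>)) * (u \<zeta> * cis (- (\<xi> * fst \<zeta>)))) \<le> norm (of_real ((b powr (\<gamma> - 1)) ^ k) * u \<zeta>)"
        using AE_fibre_pos
      proof eventually_elim
        case (elim \<zeta>)
        show ?case
        proof (cases "snd \<zeta> > b")
          case False
          have 1: "(snd \<zeta> powr (\<gamma> - 1)) ^ k \<le> (b powr (\<gamma> - 1)) ^ k"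
            using False elim g by (intro power_mono powr_mono2) auto
          have "exp (- (\<xi> * ((\<gamma> - 1) * snd \<zeta> powr \<gamma>))) \<le> 1" using \<xi> g by simp
          with 1 have "\<Psi> \<xi> (snd \<zeta>) \<le> (b powr (\<gamma> - 1)) ^ k * 1" unfolding \<Psi>_def by (intro mult_mono) auto
          moreover have "\<Psi> \<xi> (snd \<zeta>) \<ge> 0" by (simp add: \<Psi>_def)
          ultimately have "\<bar>\<Psi> \<xi> (snd \<zeta>)\<bar> * cmod (u \<zeta>) \<le> \<bar>(b powr (\<gamma> - 1)) ^ k\<bar> * cmod (u \<zeta>)"
            by (intro mult_right_mono) auto
          then show ?thesis by (simp only: norm_mult norm_of_real norm_cis mult_1_right)
        qed (simp add: ub)
      qed
    qed measurable
    have "(\<integral>\<zeta>. of_real (\<Psi> \<xi> (snd \<zeta>)) * (u \<zeta> * cis (- (\<xi> * fst \<zeta>))) \<partial>fibre_measure \<gamma>) =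
      (\<integral>\<alpha>. (\<integral>s. of_real (\<Psi> \<xi> \<alpha>) * (u (s, \<alpha>) * cis (- (\<xi> * s))) \<partial>lborel) \<partial>radial_measure \<gamma>)"
      using integral_snd[of "\<lambda>s \<alpha>. of_real (\<Psi> \<xi> \<alpha>) * (u (s, \<alpha>) * cis (- (\<xi> * s)))"] i
      by (simp add: split_beta')
    also have "\<dots> = D \<xi>" by (simp add: D_def uhat_def fourier_integral_def)
    finally show ?thesis .
  qed

  \<comment> \<open>The image is the inverse Fourier integral of \<open>W a\<close>, by the Laplace integral of \<open>A\<^sup>-\<^sup>k\<^sup>-\<^sup>2\<close> and Fubini.\<close>
  have synth: "integrable lborel (\<lambda>\<xi>. W a \<xi> * cis (\<xi> * sz)) \<and> leray_mode \<gamma> k u (sz, a) = (\<integral>\<xi>. W a \<xi> * cis (\<xi> * sz) \<partial>lborel)"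
    if a: "a > 0" for a sz
  proof -
    define A where "A \<zeta> = leray_A \<gamma> sz a (fst \<zeta>) (snd \<zeta>)" for \<zeta>
    define B where "B \<zeta> = leray_B \<gamma> a (snd \<zeta>)" for \<zeta> :: "real \<times> real"
    define J where "J \<zeta> \<xi> = (of_real (C / fact (k + 1) * B \<zeta> ^ k) * u \<zeta>) * (indicator {0<..} \<xi> *\<^sub>R (of_real \<xi> ^ (k + 1) * exp (- (of_real \<xi> * A \<zeta>))))" for \<zeta> \<xi>
    have [measurable]: "A \<in> borel_measurable (borel \<Otimes>\<^sub>M borel)" unfolding A_def leray_A_def Complex_eq by measurable
    have [measurable]: "B \<in> borel_measurable (borel \<Otimes>\<^sub>M borel)" unfolding B_def leray_B_def by measurable
    have Jm: "case_prod J \<in> borel_measurable (fibre_measure \<gamma> \<Otimes>\<^sub>M lborel)"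
      unfolding J_def by measurable
    have ap: "a powr \<gamma> > 0" using a by simp
    have B0: "B \<zeta> \<ge> 0" for \<zeta> using g a by (auto simp: B_def intro: leray_B_nonneg)
    have A0: "Re (A \<zeta>) \<ge> a powr \<gamma>" "Re (A \<zeta>) > 0" "B \<zeta> \<le> Re (A \<zeta>)" if "snd \<zeta> > 0" for \<zeta>
      using leray_B_le[OF g a that] g ap that by (auto simp: A_def B_def Re_leray_A intro!: add_nonneg_pos)
    have J1: "(\<integral>\<xi>. J \<zeta> \<xi> \<partial>lborel) = leray_kernel \<gamma> k (sz, a) \<zeta> * u \<zeta>" if "snd \<zeta> > 0" for \<zeta>
    proof -
      have "(\<integral>\<xi>. J \<zeta> \<xi> \<partial>lborel) = (of_real (C / fact (k + 1) * B \<zeta> ^ k) * u \<zeta>) * (fact (k + 1) / A \<zeta> ^ (k + 2))"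
        unfolding J_def using Laplace_power[OF A0(2)[OF that], of "k + 1"]
        by (subst integral_mult_right_zero) (simp add: set_lebesgue_integral_def)
      also have "\<dots> = leray_kernel \<gamma> k (sz, a) \<zeta> * u \<zeta>"
        by (simp add: leray_kernel_def A_def B_def C_def del: fact_Suc)
      finally show ?thesis .
    qed
    have J2: "(\<integral>\<^sup>+\<xi>. ennreal (cmod (J \<zeta> \<xi>)) \<partial>lborel) \<le> ennreal (C / (a powr \<gamma>)\<^sup>2) * ennreal (cmod (u \<zeta>))" if "snd \<zeta> > 0" for \<zeta>
    proof -
      let ?r = "Re (A \<zeta>)"
      define c where "c = C / fact (k + 1) * B \<zeta> ^ k * cmod (u \<zeta>)"
      have c: "c \<ge> 0" using C B0[of \<zeta>] by (simp add: c_def)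
      have "cmod (J \<zeta> \<xi>) = c * (indicator {0<..} \<xi> * (\<xi> ^ (k + 1) * exp (- (\<xi> * ?r))))" for \<xi>
        using C B0[of \<zeta>] by (auto simp: c_def J_def indicator_def norm_mult norm_power norm_divide cmod_exp_Laplace abs_of_nonneg simp del: fact_Suc)
      then have "(\<integral>\<^sup>+\<xi>. ennreal (cmod (J \<zeta> \<xi>)) \<partial>lborel) = (\<integral>\<^sup>+\<xi>. ennreal c * ennreal (indicator {0<..} \<xi> * (\<xi> ^ (k + 1) * exp (- (\<xi> * ?r)))) \<partial>lborel)"
        using c by (simp only: ennreal_mult')
      also have "\<dots> = ennreal c * (\<integral>\<^sup>+\<xi>. ennreal (indicator {0<..} \<xi> * (\<xi> ^ (k + 1) * exp (- (\<xi> * ?r)))) \<partial>lborel)"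
        by (rule nn_integral_cmult) measurable
      also have "\<dots> = ennreal (C / fact (k + 1) * B \<zeta> ^ k * cmod (u \<zeta>)) * ennreal (fact (k + 1) / ?r ^ (k + 2))"
        unfolding nn_integral_power_exp[OF A0(2)[OF that]] c_def by simp
      also have "\<dots> = ennreal (C * (B \<zeta> ^ k / ?r ^ (k + 2)) * cmod (u \<zeta>))"
        using C B0[of \<zeta>] A0(2)[OF that] by (subst ennreal_mult[symmetric]) (auto simp: mult_ac simp del: fact_Suc)
      also have "\<dots> \<le> ennreal (C * (1 / (a powr \<gamma>)\<^sup>2) * cmod (u \<zeta>))"
      proof (intro ennreal_leI mult_right_mono mult_left_mono C norm_ge_zero)
        have "B \<zeta> ^ k / ?r ^ (k + 2) \<le> ?r ^ k / ?r ^ (k + 2)"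
          using A0[OF that] B0 by (intro divide_right_mono power_mono) auto
        also have "\<dots> = 1 / ?r\<^sup>2" using A0(2)[OF that] by (simp add: power_add power2_eq_square)
        also have "\<dots> \<le> 1 / (a powr \<gamma>)\<^sup>2"
        proof (rule frac_le)
          show "(a powr \<gamma>)\<^sup>2 \<le> ?r\<^sup>2" by (rule power_mono[OF A0(1)[OF that]]) simp
          show "0 < (a powr \<gamma>)\<^sup>2" using ap by (rule zero_less_power)
        qed simp_all
        finally show "B \<zeta> ^ k / ?r ^ (k + 2) \<le> 1 / (a powr \<gamma>)\<^sup>2" .
      qed
      also have "\<dots> = ennreal (C / (a powr \<gamma>)\<^sup>2) * ennreal (cmod (u \<zeta>))"
        using C by (subst ennreal_mult[symmetric]) auto
      finally show ?thesis .
    qed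
    have "(\<integral>\<^sup>+\<zeta>. \<integral>\<^sup>+\<xi>. ennreal (cmod (J \<zeta> \<xi>)) \<partial>lborel \<partial>fibre_measure \<gamma>) \<le> (\<integral>\<^sup>+\<zeta>. ennreal (C / (a powr \<gamma>)\<^sup>2) * ennreal (cmod (u \<zeta>)) \<partial>fibre_measure \<gamma>)"
      by (rule nn_integral_mono_AE, use AE_fibre_pos in eventually_elim) (rule J2)
    also have "\<dots> = ennreal (C / (a powr \<gamma>)\<^sup>2) * (\<integral>\<^sup>+\<zeta>. ennreal (cmod (u \<zeta>)) \<partial>fibre_measure \<gamma>)"
      by (rule nn_integral_cmult) measurable
    also have "\<dots> < \<infinity>" using ui by (auto simp: integrable_iff_bounded ennreal_mult_less_top)
    finally have fin: "(\<integral>\<^sup>+\<zeta>. \<integral>\<^sup>+\<xi>. ennreal (cmod (J \<zeta> \<xi>)) \<partial>lborel \<partial>fibre_measure \<gamma>) < \<infinity>" .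
    note Fub = Fubini_from_nn_integral[OF sigma_finite_fibre_measure sigma_finite_lborel Jm fin]
    have J3: "(\<integral>\<zeta>. J \<zeta> \<xi> \<partial>fibre_measure \<gamma>) = W a \<xi> * cis (\<xi> * sz)" for \<xi>
    proof (cases "\<xi> > 0")
      case True
      have "J \<zeta> \<xi> = (of_real (w a \<xi>) * cis (\<xi> * sz)) * (of_real (\<Psi> \<xi> (snd \<zeta>)) * (u \<zeta> * cis (- (\<xi> * fst \<zeta>))))" for \<zeta>
        using True unfolding J_def A_def exp_leray_A B_def leray_B_def w_def \<Psi>_def
        by (simp add: power_mult_distrib mult_ac del: fact_Suc)
      then have "(\<integral>\<zeta>. J \<zeta> \<xi> \<partial>fibre_measure \<gamma>) = (of_real (w a \<xi>) * cis (\<xi> * sz)) * D \<xi>"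
        by (simp only: integral_mult_right_zero D_eq[OF True])
      then show ?thesis by (simp add: W_def mult_ac)
    next
      case False
      then show ?thesis by (simp add: J_def W_def w_def)
    qed
    interpret Q: pair_sigma_finite "fibre_measure \<gamma>" lborel
      by (intro pair_sigma_finite.intro sigma_finite_lborel sigma_finite_fibre_measure)
    have "integrable lborel (\<lambda>\<xi>. W a \<xi> * cis (\<xi> * sz))"
      using Q.integrable_snd[OF Fub(1)] unfolding J3 .
    moreover have "leray_mode \<gamma> k u (sz, a) = (\<integral>\<zeta>. (\<integral>\<xi>. J \<zeta> \<xi> \<partial>lborel) \<partial>fibre_measure \<gamma>)"
      unfolding leray_mode_def
    proof (rule integral_cong_AE)
      show "AE \<zeta> in fibre_measure \<gamma>. leray_kernel \<gamma> k (sz, a) \<zeta> * u \<zeta> = (\<integral>\<xi>. J \<zeta> \<xi> \<partial>lborel)"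
        using AE_fibre_pos by eventually_elim (simp add: J1)
      show "(\<lambda>\<zeta>. \<integral>\<xi>. J \<zeta> \<xi> \<partial>lborel) \<in> borel_measurable (fibre_measure \<gamma>)"
        using Jm by measurable
    qed measurable
    ultimately show ?thesis using Fub(2) unfolding J3 by simp
  qed

  \<comment> \<open>The Fourier inequality on the side of the image.\<close>
  have e1: "(\<integral>\<^sup>+s. ennreal ((cmod (leray_mode \<gamma> k u (s, a)))\<^sup>2) \<partial>lborel) \<le> ennreal (2 * pi) * (\<integral>\<^sup>+\<xi>. ennreal ((cmod (W a \<xi>))\<^sup>2) \<partial>lborel)"
    if a: "a > 0" for a
  proof -
    have "integrable lborel (W a)" using synth[OF a, of 0] by simp
    from inverse_fourier_integral_energy_le[OF this]
    have "(\<integral>\<^sup>+s. ennreal ((cmod (\<integral>\<xi>. W a \<xi> * cis (s * \<xi>) \<partial>lborel))\<^sup>2) \<partial>lborel) \<le> ennreal (2 * pi) * (\<integral>\<^sup>+\<xi>. ennreal ((cmod (W a \<xi>))\<^sup>2) \<partial>lborel)" .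
    then show ?thesis using synth[OF a] by (simp add: mult.commute)
  qed

  define Q where "Q = \<gamma>\<^sup>2 / (16 * pi\<^sup>2 * (\<gamma> - 1))"
  define x where "x = 2 * real k / \<gamma>"
  define y where "y = 2 * real k - 2 * real k / \<gamma>"
  have y_eq: "2 * (\<gamma> - 1) * real k / \<gamma> = y" using g by (simp add: y_def field_simps)
  have y0: "2 * (\<gamma> - 1) * real k \<ge> 0" using g by simp
  let ?U = "\<lambda>\<xi>. \<integral>\<^sup>+\<alpha>. ennreal ((cmod (uhat \<xi> \<alpha>))\<^sup>2) \<partial>radial_measure \<gamma>" and ?V = "\<lambda>\<alpha>. \<integral>\<^sup>+s. ennreal ((cmod (u (s, \<alpha>)))\<^sup>2) \<partial>lborel"
  let ?gx = "\<lambda>\<xi>. Gamma (x + 1) / (\<gamma> * (2 * \<xi>) powr (x + 1))" and ?gy = "\<lambda>\<xi>. Gamma (y + 1) / (\<gamma> * (2 * \<xi> * (\<gamma> - 1)) powr (y + 1))"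
  \<comment> \<open>The rank one estimate at a fixed frequency.\<close>
  have e2: "(\<integral>\<^sup>+a. ennreal ((cmod (W a \<xi>))\<^sup>2) \<partial>radial_measure \<gamma>) \<le> ennreal Q * ?U \<xi>" for \<xi>
  proof (cases "\<xi> > 0")
    case True
    have E\<Psi>: "L2_energy (radial_measure \<gamma>) (\<lambda>\<alpha>. of_real (\<Psi> \<xi> \<alpha>)) = ennreal (?gy \<xi>)"
    proof -
      have "L2_energy (radial_measure \<gamma>) (\<lambda>\<alpha>. of_real (\<Psi> \<xi> \<alpha>)) = (\<integral>\<^sup>+\<alpha>. ennreal (\<alpha> powr (2 * (\<gamma> - 1) * real k) * exp (- ((2 * \<xi> * (\<gamma> - 1)) * \<alpha> powr \<gamma>))) \<partial>radial_measure \<gamma>)"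
        unfolding L2_energy_def
      proof (rule nn_integral_cong_AE, use AE_radial_pos in eventually_elim)
        case (elim \<alpha>)
        have "((\<alpha> powr (\<gamma> - 1)) ^ k)\<^sup>2 = (\<alpha> powr (\<gamma> - 1)) powr real (k * 2)"
          using elim by (subst powr_realpow) (auto simp: power_mult)
        also have "\<dots> = \<alpha> powr (2 * (\<gamma> - 1) * real k)" by (simp add: powr_powr mult_ac)
        finally have 1: "((\<alpha> powr (\<gamma> - 1)) ^ k)\<^sup>2 = \<alpha> powr (2 * (\<gamma> - 1) * real k)" .
        have "(exp (- (\<xi> * ((\<gamma> - 1) * \<alpha> powr \<gamma>))))\<^sup>2 = exp (- ((2 * \<xi> * (\<gamma> - 1)) * \<alpha> powr \<gamma>))"
          by (simp add: exp_double[symmetric] mult_ac)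
        then show ?case unfolding norm_of_real power2_abs \<Psi>_def power_mult_distrib by (simp only: 1)
      qed
      also have "\<dots> = ennreal (?gy \<xi>)"
        unfolding y_eq[symmetric] by (rule nn_integral_radial_power_exp) (use g True y0 in auto)
      finally show ?thesis .
    qed
    have EW: "(\<integral>\<^sup>+a. ennreal ((w a \<xi>)\<^sup>2) \<partial>radial_measure \<gamma>) = ennreal ((C / fact (k + 1))\<^sup>2 * \<xi> ^ (2 * k + 2) * \<gamma> ^ (2 * k) * ?gx \<xi>)"
    proof -
      have "(\<integral>\<^sup>+a. ennreal ((w a \<xi>)\<^sup>2) \<partial>radial_measure \<gamma>) = (\<integral>\<^sup>+a. ennreal ((C / fact (k + 1))\<^sup>2 * \<xi> ^ (2 * k + 2) * \<gamma> ^ (2 * k)) * ennreal (a powr (2 * real k) * exp (- ((2 * \<xi>) * a powr \<gamma>))) \<partial>radial_measure \<gamma>)"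
      proof (rule nn_integral_cong_AE, use AE_radial_pos in eventually_elim)
        case (elim a)
        have eqs: "exp (- ((2 * \<xi>) * a powr \<gamma>)) = (exp (- (\<xi> * a powr \<gamma>)))\<^sup>2"
          "a powr (2 * real k) = (a ^ k)\<^sup>2" "\<xi> ^ (2 * k + 2) = (\<xi> ^ (k + 1))\<^sup>2" "\<gamma> ^ (2 * k) = (\<gamma> ^ k)\<^sup>2"
        proof -
          have "2 * k + 2 = (k + 1) * 2" "2 * k = k * 2" by simp_all
          then show "\<xi> ^ (2 * k + 2) = (\<xi> ^ (k + 1))\<^sup>2" "\<gamma> ^ (2 * k) = (\<gamma> ^ k)\<^sup>2"
            by (simp_all only: power_mult)
          have "a powr (2 * real k) = a ^ (k * 2)" using elim powr_realpow[of a "k * 2"] by (simp add: mult.commute)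
          then show "a powr (2 * real k) = (a ^ k)\<^sup>2" by (simp only: power_mult)
          show "exp (- ((2 * \<xi>) * a powr \<gamma>)) = (exp (- (\<xi> * a powr \<gamma>)))\<^sup>2"
            by (simp add: exp_double[symmetric])
        qed
        have "w a \<xi> = C / fact (k + 1) * \<xi> ^ (k + 1) * (\<gamma> ^ k * a ^ k) * exp (- (\<xi> * a powr \<gamma>))"
          using True by (simp add: w_def power_mult_distrib del: fact_Suc power_Suc)
        then have "(w a \<xi>)\<^sup>2 = ((C / fact (k + 1))\<^sup>2 * \<xi> ^ (2 * k + 2) * \<gamma> ^ (2 * k)) * (a powr (2 * real k) * exp (- ((2 * \<xi>) * a powr \<gamma>)))"
          unfolding eqs by (simp only: power_mult_distrib mult_ac)
        then show ?case using True g by (simp add: ennreal_mult'')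
      qed
      also have "\<dots> = ennreal ((C / fact (k + 1))\<^sup>2 * \<xi> ^ (2 * k + 2) * \<gamma> ^ (2 * k)) * ennreal (?gx \<xi>)"
        using g True by (subst nn_integral_cmult, simp, subst nn_integral_radial_power_exp) (auto simp: x_def)
      also have "\<dots> = ennreal ((C / fact (k + 1))\<^sup>2 * \<xi> ^ (2 * k + 2) * \<gamma> ^ (2 * k) * ?gx \<xi>)"
        using g True by (intro ennreal_mult'[symmetric]) auto
      finally show ?thesis .
    qed
    have DE: "ennreal ((cmod (D \<xi>))\<^sup>2) \<le> ennreal (?gy \<xi>) * ?U \<xi>"
      unfolding D_def E\<Psi>[symmetric]
      using L2_energy_Cauchy_Schwarz[of "\<lambda>\<alpha>. of_real (\<Psi> \<xi> \<alpha>)" "radial_measure \<gamma>" "uhat \<xi>"]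
      by (simp add: E\<Psi>) (simp add: L2_energy_def)
    have "(\<integral>\<^sup>+a. ennreal ((cmod (W a \<xi>))\<^sup>2) \<partial>radial_measure \<gamma>) = (\<integral>\<^sup>+a. ennreal ((w a \<xi>)\<^sup>2) * ennreal ((cmod (D \<xi>))\<^sup>2) \<partial>radial_measure \<gamma>)"
      by (simp add: W_def norm_mult power_mult_distrib ennreal_mult)
    also have "\<dots> = (\<integral>\<^sup>+a. ennreal ((w a \<xi>)\<^sup>2) \<partial>radial_measure \<gamma>) * ennreal ((cmod (D \<xi>))\<^sup>2)"
      by (rule nn_integral_multc) measurable
    also have "\<dots> \<le> (\<integral>\<^sup>+a. ennreal ((w a \<xi>)\<^sup>2) \<partial>radial_measure \<gamma>) * (ennreal (?gy \<xi>) * ?U \<xi>)"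
      by (intro mult_left_mono DE) simp
    also have "\<dots> = ennreal ((C / fact (k + 1))\<^sup>2 * \<xi> ^ (2 * k + 2) * \<gamma> ^ (2 * k) * ?gx \<xi> * ?gy \<xi>) * ?U \<xi>"
    proof -
      have "y \<ge> 0" using g y0 by (simp flip: y_eq)
      then have "Gamma (y + 1) / (\<gamma> * (2 * \<xi> * (\<gamma> - 1)) powr (y + 1)) \<ge> 0" using g by simp
      then show ?thesis unfolding EW mult.assoc[symmetric] by (simp only: ennreal_mult'')
    qed
    also have "\<dots> \<le> ennreal Q * ?U \<xi>"
      using leray_mode_constant_le[OF g True, of k]
      by (intro mult_right_mono ennreal_leI) (simp_all add: C_def Q_def x_def y_def del: fact_Suc)
    finally show ?thesis .
  next
    case False
    then show ?thesis by (simp add: W_def w_def)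
  qed

  \<comment> \<open>The Fourier inequality on the side of \<open>u\<close>.\<close>
  have e3: "AE \<alpha> in radial_measure \<gamma>. (\<integral>\<^sup>+\<xi>. ennreal ((cmod (uhat \<xi> \<alpha>))\<^sup>2) \<partial>lborel) \<le> ennreal (2 * pi) * ?V \<alpha>"
  proof -
    have "integrable (fibre_measure \<gamma>) (case_prod (\<lambda>s \<alpha>. u (s, \<alpha>)))" using ui by simp
    from AE_integrable_snd[OF this] show ?thesis
      by eventually_elim (auto simp: uhat_def intro: fourier_integral_energy_le)
  qed

  have "L2_energy (fibre_measure \<gamma>) (leray_mode \<gamma> k u) = (\<integral>\<^sup>+a. \<integral>\<^sup>+s. ennreal ((cmod (leray_mode \<gamma> k u (s, a)))\<^sup>2) \<partial>lborel \<partial>radial_measure \<gamma>)"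
    unfolding L2_energy_def by (rule nn_integral_snd[symmetric]) measurable
  also have "\<dots> \<le> (\<integral>\<^sup>+a. ennreal (2 * pi) * (\<integral>\<^sup>+\<xi>. ennreal ((cmod (W a \<xi>))\<^sup>2) \<partial>lborel) \<partial>radial_measure \<gamma>)"
    by (rule nn_integral_mono_AE, use AE_radial_pos in eventually_elim) (rule e1)
  also have "\<dots> = ennreal (2 * pi) * (\<integral>\<^sup>+a. (\<integral>\<^sup>+\<xi>. ennreal ((cmod (W a \<xi>))\<^sup>2) \<partial>lborel) \<partial>radial_measure \<gamma>)"
    by (rule nn_integral_cmult) measurable
  also have "\<dots> = ennreal (2 * pi) * (\<integral>\<^sup>+\<xi>. (\<integral>\<^sup>+a. ennreal ((cmod (W a \<xi>))\<^sup>2) \<partial>radial_measure \<gamma>) \<partial>lborel)"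
    by (rule arg_cong[where f="\<lambda>v. ennreal (2 * pi) * v"], rule Fubini') measurable
  also have "\<dots> \<le> ennreal (2 * pi) * (\<integral>\<^sup>+\<xi>. ennreal Q * ?U \<xi> \<partial>lborel)"
    by (rule mult_left_mono[OF nn_integral_mono[OF e2]]) simp
  also have "\<dots> = ennreal (2 * pi) * (ennreal Q * (\<integral>\<^sup>+\<xi>. ?U \<xi> \<partial>lborel))"
    by (rule arg_cong[where f="\<lambda>v. ennreal (2 * pi) * v"], rule nn_integral_cmult) measurable
  also have "\<dots> = ennreal (2 * pi) * (ennreal Q * (\<integral>\<^sup>+\<alpha>. (\<integral>\<^sup>+\<xi>. ennreal ((cmod (uhat \<xi> \<alpha>))\<^sup>2) \<partial>lborel) \<partial>radial_measure \<gamma>))"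
    by (rule arg_cong[where f="\<lambda>v. ennreal (2 * pi) * (ennreal Q * v)"], rule Fubini'[symmetric]) measurable
  also have "\<dots> \<le> ennreal (2 * pi) * (ennreal Q * (\<integral>\<^sup>+\<alpha>. ennreal (2 * pi) * ?V \<alpha> \<partial>radial_measure \<gamma>))"
    by (rule mult_left_mono[OF mult_left_mono[OF nn_integral_mono_AE[OF e3]]]) simp_all
  also have "\<dots> = ennreal (2 * pi) * (ennreal Q * (ennreal (2 * pi) * (\<integral>\<^sup>+\<alpha>. ?V \<alpha> \<partial>radial_measure \<gamma>)))"
    by (rule arg_cong[where f="\<lambda>v. ennreal (2 * pi) * (ennreal Q * v)"], rule nn_integral_cmult) measurable
  also have "\<dots> = ennreal (2 * pi) * (ennreal Q * (ennreal (2 * pi) * L2_energy (fibre_measure \<gamma>) u))"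
    unfolding L2_energy_def
    by (rule arg_cong[where f="\<lambda>v. ennreal (2 * pi) * (ennreal Q * (ennreal (2 * pi) * v))"], rule nn_integral_snd) measurable
  also have "\<dots> = ennreal (\<gamma>\<^sup>2 / (4 * (\<gamma> - 1))) * L2_energy (fibre_measure \<gamma>) u"
  proof -
    have "2 * pi * (Q * (2 * pi)) = \<gamma>\<^sup>2 / (4 * (\<gamma> - 1))"
      using g by (simp add: Q_def power2_eq_square divide_simps)
    moreover have "Q \<ge> 0" using g by (simp add: Q_def)
    ultimately show ?thesis unfolding mult.assoc[symmetric] by (simp add: ennreal_mult[symmetric] mult.assoc)
  qed
  finally show ?thesis .
qed


section \<open>Boundedness of a single mode\<close>

text \<open>
  The boxes have finite measure, exhaust the fibre and stay away from \<open>\<alpha> =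
  0\<close>; hence truncations of functions in L2 are integrable, and the columns of the
  kernels are uniformly bounded in L2 on them.
\<close>

definition fibre_box :: "nat \<Rightarrow> (real \<times> real) set" where
  "fibre_box n = {- real n..real n} \<times> {1 / (real n + 1)..real n + 1}"

definition truncation :: "nat \<Rightarrow> (real \<times> real \<Rightarrow> complex) \<Rightarrow> real \<times> real \<Rightarrow> complex" where
  "truncation n u \<zeta> = indicator (fibre_box n) \<zeta> * u \<zeta>"

lemma fibre_box_sets [measurable]: "fibre_box n \<in> sets (borel \<Otimes>\<^sub>M borel)"
  by (simp add: fibre_box_def)

lemma fibre_box_snd: "\<zeta> \<in> fibre_box n \<Longrightarrow> 1 / (real n + 1) \<le> snd \<zeta> \<and> snd \<zeta> \<le> real n + 1"
  by (auto simp: fibre_box_def)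

lemma emeasure_fibre_box:
  assumes g: "\<gamma> > 1"
  shows "emeasure (fibre_measure \<gamma>) (fibre_box n) < \<infinity>"
proof -
  interpret R: sigma_finite_measure "radial_measure \<gamma>" by (rule sigma_finite_radial_measure)
  let ?b = "real n + 1"
  have "emeasure (radial_measure \<gamma>) {1 / ?b..?b} = (\<integral>\<^sup>+\<alpha>. ennreal (indicator {0<..} \<alpha> * \<alpha> powr (\<gamma> - 1)) * indicator {1 / ?b..?b} \<alpha> \<partial>lborel)"
    unfolding radial_measure_def by (subst emeasure_density) auto
  also have "\<dots> \<le> (\<integral>\<^sup>+\<alpha>. ennreal (?b powr (\<gamma> - 1)) * indicator {1 / ?b..?b} \<alpha> \<partial>lborel)"
    using g by (intro nn_integral_mono) (auto simp: indicator_def intro!: ennreal_leI powr_mono2)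
  also have "\<dots> = ennreal (?b powr (\<gamma> - 1)) * emeasure lborel {1 / ?b..?b}"
    by (simp add: nn_integral_cmult)
  also have "\<dots> < \<infinity>" by (auto simp: ennreal_mult_less_top emeasure_lborel_Icc_eq)
  finally have "emeasure (radial_measure \<gamma>) {1 / ?b..?b} < \<infinity>" .
  moreover have "emeasure (fibre_measure \<gamma>) (fibre_box n) = emeasure lborel {- real n..real n} * emeasure (radial_measure \<gamma>) {1 / ?b..?b}"
    unfolding fibre_box_def by (rule R.emeasure_pair_measure_Times) auto
  ultimately show ?thesis by (auto simp: ennreal_mult_less_top)
qed

lemma L2_fibre_measurable: "u \<in> L2 (fibre_measure \<gamma>) \<Longrightarrow> u \<in> borel_measurable (borel \<Otimes>\<^sub>M borel)"
  using measurable_cong_sets[OF sets_pair_measure_cong[OF sets_lborel sets_radial_measure] refl]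
  by (auto simp: L2_def)

lemma truncation_measurable [measurable]:
  "u \<in> borel_measurable (borel \<Otimes>\<^sub>M borel) \<Longrightarrow> truncation n u \<in> borel_measurable (borel \<Otimes>\<^sub>M borel)"
  unfolding truncation_def by measurable

lemma cmod_truncation_le: "cmod (truncation n u \<zeta>) \<le> cmod (u \<zeta>)"
  by (auto simp: truncation_def indicator_def)

lemma L2_energy_truncation_le: "L2_energy M (truncation n u) \<le> L2_energy M u"
  unfolding L2_energy_def by (intro nn_integral_mono ennreal_leI power_mono cmod_truncation_le) auto

lemma truncation_L2:
  assumes u: "u \<in> L2 (fibre_measure \<gamma>)"
  shows "truncation n u \<in> L2 (fibre_measure \<gamma>)"
proof -
  have [measurable]: "u \<in> borel_measurable (borel \<Otimes>\<^sub>M borel)" using u by (rule L2_fibre_measurable)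
  have "truncation n u \<in> borel_measurable (fibre_measure \<gamma>)" by measurable
  then show ?thesis using u L2_energy_truncation_le[of "fibre_measure \<gamma>" n u] by (auto simp: L2_iff_energy intro: le_less_trans)
qed

lemma truncation_integrable:
  assumes g: "\<gamma> > 1" and u: "u \<in> L2 (fibre_measure \<gamma>)"
  shows "integrable (fibre_measure \<gamma>) (truncation n u)"
proof -
  have "(indicator (fibre_box n) :: _ \<Rightarrow> complex) \<in> L2 (fibre_measure \<gamma>)"
  proof -
    have "L2_energy (fibre_measure \<gamma>) (indicator (fibre_box n)) = (\<integral>\<^sup>+\<zeta>. indicator (fibre_box n) \<zeta> \<partial>fibre_measure \<gamma>)"
      unfolding L2_energy_def by (intro nn_integral_cong) (auto simp: indicator_def)
    also have "\<dots> = emeasure (fibre_measure \<gamma>) (fibre_box n)" by (rule nn_integral_indicator) measurable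
    finally have "L2_energy (fibre_measure \<gamma>) (indicator (fibre_box n)) < \<infinity>" using emeasure_fibre_box[OF g] by simp
    moreover have "(indicator (fibre_box n) :: _ \<Rightarrow> complex) \<in> borel_measurable (fibre_measure \<gamma>)" by measurable
    ultimately show ?thesis by (simp add: L2_iff_energy)
  qed
  from L2_mult_integrable[OF this u] show ?thesis by (simp add: truncation_def[abs_def])
qed

lemma truncation_eventually_eq:
  assumes "snd \<zeta> > 0"
  shows "\<forall>\<^sub>F n in sequentially. truncation n u \<zeta> = u \<zeta>"
proof -
  obtain n1 n2 n3 where n: "\<bar>fst \<zeta>\<bar> < real n1" "snd \<zeta> < real n2" "1 / snd \<zeta> < real n3"
    using reals_Archimedean2 by meson
  show ?thesis
  proof (rule eventually_sequentiallyI[of "max n1 (max n2 n3)"])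
    fix m assume "max n1 (max n2 n3) \<le> m"
    then have m: "\<bar>fst \<zeta>\<bar> \<le> real m" "snd \<zeta> \<le> real m + 1" "1 / snd \<zeta> \<le> real m + 1" using n by auto
    have "1 / (real m + 1) \<le> snd \<zeta>" using m(3) assms by (simp add: field_simps)
    then have "\<zeta> \<in> fibre_box m" using m by (cases \<zeta>) (auto simp: fibre_box_def)
    then show "truncation m u \<zeta> = u \<zeta>" by (simp add: truncation_def)
  qed
qed

lemma truncation_tendsto_L2:
  assumes u: "u \<in> L2 (fibre_measure \<gamma>)"
  shows "(\<lambda>n. L2_norm (fibre_measure \<gamma>) (\<lambda>\<zeta>. truncation n u \<zeta> - u \<zeta>)) \<longlonglongrightarrow> 0"
proof -
  have [measurable]: "u \<in> borel_measurable (borel \<Otimes>\<^sub>M borel)" using u by (rule L2_fibre_measurable)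
  have "(\<lambda>n. \<integral>\<zeta>. (cmod (truncation n u \<zeta> - u \<zeta>))\<^sup>2 \<partial>fibre_measure \<gamma>) \<longlonglongrightarrow> (\<integral>\<zeta>. 0 \<partial>fibre_measure \<gamma>)"
  proof (rule integral_dominated_convergence)
    show "integrable (fibre_measure \<gamma>) (\<lambda>\<zeta>. (cmod (u \<zeta>))\<^sup>2)" using u by (simp add: L2_def)
    show "AE \<zeta> in fibre_measure \<gamma>. (\<lambda>n. (cmod (truncation n u \<zeta> - u \<zeta>))\<^sup>2) \<longlonglongrightarrow> 0"
      using AE_fibre_pos
    proof eventually_elim
      case (elim \<zeta>)
      show ?case
        by (rule tendsto_eventually) (use truncation_eventually_eq[OF elim, of u] in \<open>auto elim!: eventually_mono\<close>)
    qed
    show "AE \<zeta> in fibre_measure \<gamma>. norm ((cmod (truncation n u \<zeta> - u \<zeta>))\<^sup>2) \<le> (cmod (u \<zeta>))\<^sup>2" for n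
      by (auto simp: truncation_def indicator_def)
  qed measurable
  then have "(\<lambda>n. sqrt (\<integral>\<zeta>. (cmod (truncation n u \<zeta> - u \<zeta>))\<^sup>2 \<partial>fibre_measure \<gamma>)) \<longlonglongrightarrow> sqrt 0"
    by (intro tendsto_real_sqrt) simp
  then show ?thesis by (simp add: L2_norm_def)
qed

lemma leray_mode_integrable:
  assumes "\<gamma> > 1" "snd z > 0" "u \<in> L2 (fibre_measure \<gamma>)"
  shows "integrable (fibre_measure \<gamma>) (\<lambda>\<zeta>. leray_kernel \<gamma> k z \<zeta> * u \<zeta>)"
  by (intro L2_mult_integrable leray_kernel_row_L2 assms)

lemma leray_mode_add:
  assumes "\<gamma> > 1" "snd z > 0" "u \<in> L2 (fibre_measure \<gamma>)" "v \<in> L2 (fibre_measure \<gamma>)"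
  shows "leray_mode \<gamma> k (\<lambda>\<zeta>. u \<zeta> + v \<zeta>) z = leray_mode \<gamma> k u z + leray_mode \<gamma> k v z"
  using leray_mode_integrable[OF assms(1,2)] assms(3,4) by (simp add: leray_mode_def distrib_left)

lemma leray_mode_diff:
  assumes "\<gamma> > 1" "snd z > 0" "u \<in> L2 (fibre_measure \<gamma>)" "v \<in> L2 (fibre_measure \<gamma>)"
  shows "leray_mode \<gamma> k (\<lambda>\<zeta>. u \<zeta> - v \<zeta>) z = leray_mode \<gamma> k u z - leray_mode \<gamma> k v z"
  using leray_mode_integrable[OF assms(1,2)] assms(3,4) by (simp add: leray_mode_def right_diff_distrib)

lemma leray_mode_cmult: "leray_mode \<gamma> k (\<lambda>\<zeta>. c * u \<zeta>) z = c * leray_mode \<gamma> k u z"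
proof -
  have "leray_mode \<gamma> k (\<lambda>\<zeta>. c * u \<zeta>) z = (\<integral>\<zeta>. c * (leray_kernel \<gamma> k z \<zeta> * u \<zeta>) \<partial>fibre_measure \<gamma>)"
    unfolding leray_mode_def by (simp only: mult.left_commute)
  then show ?thesis by (simp only: leray_mode_def integral_mult_right_zero)
qed

lemma leray_mode_cong_AE:
  assumes u: "u \<in> borel_measurable (borel \<Otimes>\<^sub>M borel)" "v \<in> borel_measurable (borel \<Otimes>\<^sub>M borel)"
    and "AE \<zeta> in fibre_measure \<gamma>. u \<zeta> = v \<zeta>"
  shows "leray_mode \<gamma> k u z = leray_mode \<gamma> k v z"
proof -
  have [measurable]: "u \<in> borel_measurable (borel \<Otimes>\<^sub>M borel)" "v \<in> borel_measurable (borel \<Otimes>\<^sub>M borel)" by fact+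
  show ?thesis unfolding leray_mode_def
    by (rule integral_cong_AE) (measurable, use assms(3) in auto)
qed

text \<open>
  Rows of the kernel are in L2, so that convergence in L2 implies convergence of the images at
  every point.
\<close>

lemma leray_mode_tendsto:
  assumes g: "\<gamma> > 1" and z: "snd z > 0" and U: "\<And>n. U n \<in> L2 (fibre_measure \<gamma>)" and u: "u \<in> L2 (fibre_measure \<gamma>)"
    and lim: "(\<lambda>n. L2_norm (fibre_measure \<gamma>) (\<lambda>\<zeta>. U n \<zeta> - u \<zeta>)) \<longlonglongrightarrow> 0"
  shows "(\<lambda>n. leray_mode \<gamma> k (U n) z) \<longlonglongrightarrow> leray_mode \<gamma> k u z"
proof (rule LIM_zero_cancel, rule Lim_null_comparison)
  show "\<forall>\<^sub>F n in sequentially. norm (leray_mode \<gamma> k (U n) z - leray_mode \<gamma> k u z) \<le>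
      L2_norm (fibre_measure \<gamma>) (leray_kernel \<gamma> k z) * L2_norm (fibre_measure \<gamma>) (\<lambda>\<zeta>. U n \<zeta> - u \<zeta>)"
  proof (intro always_eventually allI)
    fix n
    have "leray_mode \<gamma> k (U n) z - leray_mode \<gamma> k u z = leray_mode \<gamma> k (\<lambda>\<zeta>. U n \<zeta> - u \<zeta>) z"
      by (rule leray_mode_diff[OF g z U u, symmetric])
    then show "norm (leray_mode \<gamma> k (U n) z - leray_mode \<gamma> k u z) \<le>
      L2_norm (fibre_measure \<gamma>) (leray_kernel \<gamma> k z) * L2_norm (fibre_measure \<gamma>) (\<lambda>\<zeta>. U n \<zeta> - u \<zeta>)"
      using L2_Cauchy_Schwarz[OF leray_kernel_row_L2[OF g z] L2_diff[OF U u]] by (simp add: leray_mode_def)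
  qed
  show "(\<lambda>n. L2_norm (fibre_measure \<gamma>) (leray_kernel \<gamma> k z) * L2_norm (fibre_measure \<gamma>) (\<lambda>\<zeta>. U n \<zeta> - u \<zeta>)) \<longlonglongrightarrow> 0"
    by (rule tendsto_mult_right_zero[OF lim])
qed

text \<open>
  The images of the truncations converge pointwise, so that the bound for integrable functions
  passes to the limit by Fatou.
\<close>

theorem leray_mode_bounded:
  assumes g: "\<gamma> > 1" and u: "u \<in> L2 (fibre_measure \<gamma>)"
  shows "L2_energy (fibre_measure \<gamma>) (leray_mode \<gamma> k u) \<le> ennreal (\<gamma>\<^sup>2 / (4 * (\<gamma> - 1))) * L2_energy (fibre_measure \<gamma>) u"
    and "leray_mode \<gamma> k u \<in> L2 (fibre_measure \<gamma>)"
    and "L2_norm (fibre_measure \<gamma>) (leray_mode \<gamma> k u) \<le> \<gamma> / (2 * sqrt (\<gamma> - 1)) * L2_norm (fibre_measure \<gamma>) u"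
proof -
  have [measurable]: "u \<in> borel_measurable (borel \<Otimes>\<^sub>M borel)" using u by (rule L2_fibre_measurable)
  show le: "L2_energy (fibre_measure \<gamma>) (leray_mode \<gamma> k u) \<le> ennreal (\<gamma>\<^sup>2 / (4 * (\<gamma> - 1))) * L2_energy (fibre_measure \<gamma>) u"
  proof (rule L2_energy_liminf_le[where F = "\<lambda>n. leray_mode \<gamma> k (truncation n u)"])
    show "AE z in fibre_measure \<gamma>. (\<lambda>n. leray_mode \<gamma> k (truncation n u) z) \<longlonglongrightarrow> leray_mode \<gamma> k u z"
      using AE_fibre_pos
      by eventually_elim (intro leray_mode_tendsto g truncation_L2 u truncation_tendsto_L2)
    have "L2_energy (fibre_measure \<gamma>) (leray_mode \<gamma> k (truncation n u)) \<le> ennreal (\<gamma>\<^sup>2 / (4 * (\<gamma> - 1))) * L2_energy (fibre_measure \<gamma>) (truncation n u)" for n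
    proof (rule leray_mode_energy_le_integrable[OF g _ truncation_integrable[OF g u], of n "real n + 1"])
      show "truncation n u \<zeta> = 0" if "real n + 1 < snd \<zeta>" for \<zeta>
        using that fibre_box_snd[of \<zeta> n] by (auto simp: truncation_def indicator_def)
    qed measurable
    also have "\<And>n. ennreal (\<gamma>\<^sup>2 / (4 * (\<gamma> - 1))) * L2_energy (fibre_measure \<gamma>) (truncation n u) \<le> ennreal (\<gamma>\<^sup>2 / (4 * (\<gamma> - 1))) * L2_energy (fibre_measure \<gamma>) u"
      by (intro mult_left_mono L2_energy_truncation_le) simp
    finally show "\<forall>\<^sub>F n in sequentially. L2_energy (fibre_measure \<gamma>) (leray_mode \<gamma> k (truncation n u)) \<le> ennreal (\<gamma>\<^sup>2 / (4 * (\<gamma> - 1))) * L2_energy (fibre_measure \<gamma>) u"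
      by (intro always_eventually allI)
  qed measurable
  have c: "\<gamma>\<^sup>2 / (4 * (\<gamma> - 1)) = (\<gamma> / (2 * sqrt (\<gamma> - 1)))\<^sup>2"
    using g by (simp add: power_divide power_mult_distrib)
  have m: "leray_mode \<gamma> k u \<in> borel_measurable (fibre_measure \<gamma>)" by measurable
  show "leray_mode \<gamma> k u \<in> L2 (fibre_measure \<gamma>)"
    "L2_norm (fibre_measure \<gamma>) (leray_mode \<gamma> k u) \<le> \<gamma> / (2 * sqrt (\<gamma> - 1)) * L2_norm (fibre_measure \<gamma>) u"
    by (rule L2_from_energy_le_energy[OF m le[unfolded c] _ u]; use g in simp)+
qed

section \<open>Idempotence of a single mode\<close>

text \<open>
  Integrate over \<open>w = (s, b)\<close>, first over \<open>s\<close> by partial fractions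
  and then over \<open>b\<close>. The two constants add up to \<open>p + q = \<gamma>
  b\<^sup>\<gamma> + A\<close> with \<open>A\<close> belonging to \<open>(z, \<zeta>)\<close>,
  and the product of the two factors \<open>B\<close> is \<open>\<gamma>
  b\<^sup>\<gamma>\<close> times the one of \<open>(z, \<zeta>)\<close>; hence the integral
  over \<open>b\<close> involves only integer powers of \<open>t = b\<^sup>\<gamma>\<close>.
\<close>

lemma leray_kernel_reproducing:
  assumes g: "\<gamma> > 1" and z: "snd z > 0" and \<zeta>: "snd \<zeta> > 0"
  shows "(\<integral>w. leray_kernel \<gamma> k z w * leray_kernel \<gamma> k w \<zeta> \<partial>fibre_measure \<gamma>) = leray_kernel \<gamma> k z \<zeta>"
proof -
  interpret pair_sigma_finite lborel "radial_measure \<gamma>" by (rule pair_sigma_finite_fibre)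
  obtain sz a where z': "z = (sz, a)" by (cases z)
  obtain s\<zeta> \<alpha> where \<zeta>': "\<zeta> = (s\<zeta>, \<alpha>)" by (cases \<zeta>)
  have a: "a > 0" "\<alpha> > 0" using z \<zeta> z' \<zeta>' by auto
  define C where "C = \<gamma>\<^sup>2 * (real k + 1) / (2 * pi)"
  define A where "A = leray_A \<gamma> sz a s\<zeta> \<alpha>"
  define B where "B = leray_B \<gamma> a \<alpha>"
  define G where "G t = of_real t ^ k / (of_real (\<gamma> * t) + A) ^ (k + (k + 1) + 2)" for t :: real
  have [measurable]: "G \<in> borel_measurable borel" unfolding G_def by measurable
  define F where "F = complex_of_real (C\<^sup>2 * \<gamma> ^ k * B ^ k * (2 * pi) * real ((2 * k + 2) choose (k + 1)))"
  have A: "Re A > 0" using g a by (auto simp: A_def Re_leray_A intro!: add_nonneg_pos)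
  have i: "integrable (fibre_measure \<gamma>) (\<lambda>w. leray_kernel \<gamma> k z w * leray_kernel \<gamma> k w \<zeta>)"
    by (rule L2_mult_integrable[OF leray_kernel_row_L2[OF g z] leray_kernel_column_L2(1)[OF g \<zeta> order_refl]])
  have inner: "(\<integral>s. leray_kernel \<gamma> k z (s, b) * leray_kernel \<gamma> k (s, b) \<zeta> \<partial>lborel) = F * G (b powr \<gamma>)" if b: "b > 0" for b
  proof -
    define p where "p = Complex ((\<gamma> - 1) * b powr \<gamma> + a powr \<gamma>) (- sz)"
    define q where "q = Complex ((\<gamma> - 1) * \<alpha> powr \<gamma> + b powr \<gamma>) s\<zeta>"
    have pq: "Re p > 0" "Re q > 0" using g a b by (auto simp: p_def q_def intro!: add_nonneg_pos)
    have A1: "leray_A \<gamma> sz a s b = p + \<i> * of_real s" "leray_A \<gamma> s b s\<zeta> \<alpha> = q - \<i> * of_real s" for s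
      by (auto simp: leray_A_def p_def q_def complex_eq_iff)
    have sum: "p + q = of_real (\<gamma> * b powr \<gamma>) + A"
      by (simp add: p_def q_def A_def leray_A_def complex_eq_iff algebra_simps)
    have BB: "leray_B \<gamma> a b * leray_B \<gamma> b \<alpha> = \<gamma> * B * b powr \<gamma>"
      using b by (simp add: leray_B_def B_def powr_diff)
    have "leray_kernel \<gamma> k z (s, b) * leray_kernel \<gamma> k (s, b) \<zeta> =
        of_real (C\<^sup>2 * (leray_B \<gamma> a b * leray_B \<gamma> b \<alpha>) ^ k) * line_integrand p q (Suc (k + 1)) (Suc (k + 1)) s" for s
    proof -
      have "leray_kernel \<gamma> k z (s, b) = of_real C * (of_real (leray_B \<gamma> a b) ^ k / (p + \<i> * of_real s) ^ (k + 2))"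
        "leray_kernel \<gamma> k (s, b) \<zeta> = of_real C * (of_real (leray_B \<gamma> b \<alpha>) ^ k / (q - \<i> * of_real s) ^ (k + 2))"
        unfolding leray_kernel_def z' \<zeta>' fst_conv snd_conv A1 C_def by (rule refl)+
      then show ?thesis
        by (simp add: line_integrand_def power_mult_distrib power2_eq_square)
    qed
    then have "(\<integral>s. leray_kernel \<gamma> k z (s, b) * leray_kernel \<gamma> k (s, b) \<zeta> \<partial>lborel) =
       of_real (C\<^sup>2 * (\<gamma> * B * b powr \<gamma>) ^ k) * (2 * pi * of_nat (((k + 1) + (k + 1)) choose (k + 1)) / (p + q) ^ Suc ((k + 1) + (k + 1)))"
      unfolding BB[symmetric] by (simp only: integral_mult_right_zero line_integral[OF pq])
    also have "\<dots> = F * G (b powr \<gamma>)"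
    proof -
      define Nb where "Nb = (2 * k + 2) choose (k + 1)"
      define L where "L = (of_real (\<gamma> * b powr \<gamma>) + A) ^ (k + (k + 1) + 2)"
      have e: "Suc ((k + 1) + (k + 1)) = k + (k + 1) + 2" "(k + 1) + (k + 1) = 2 * k + 2" by simp_all
      show ?thesis unfolding sum unfolding e(1) unfolding e(2) F_def G_def Nb_def[symmetric] L_def[symmetric]
        by (simp add: power_mult_distrib mult_ac)
    qed
    finally show ?thesis .
  qed
  have "(\<integral>w. leray_kernel \<gamma> k z w * leray_kernel \<gamma> k w \<zeta> \<partial>fibre_measure \<gamma>) =
     (\<integral>b. (\<integral>s. leray_kernel \<gamma> k z (s, b) * leray_kernel \<gamma> k (s, b) \<zeta> \<partial>lborel) \<partial>radial_measure \<gamma>)"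
    using integral_snd[of "\<lambda>s b. leray_kernel \<gamma> k z (s, b) * leray_kernel \<gamma> k (s, b) \<zeta>"] i by (simp add: split_beta')
  also have "\<dots> = (\<integral>b. F * G (b powr \<gamma>) \<partial>radial_measure \<gamma>)"
  proof (rule integral_cong_AE)
    have "(\<lambda>w. leray_kernel \<gamma> k z w * leray_kernel \<gamma> k w \<zeta>) \<in> borel_measurable (fibre_measure \<gamma>)" using i by auto
    then have [measurable]: "(\<lambda>w. leray_kernel \<gamma> k z w * leray_kernel \<gamma> k w \<zeta>) \<in> borel_measurable (borel \<Otimes>\<^sub>M borel)" by measurable
    show "(\<lambda>b. \<integral>s. leray_kernel \<gamma> k z (s, b) * leray_kernel \<gamma> k (s, b) \<zeta> \<partial>lborel) \<in> borel_measurable (radial_measure \<gamma>)"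
      by (intro lborel.borel_measurable_lebesgue_integral) (simp add: split_beta', measurable)
    show "(\<lambda>b. F * G (b powr \<gamma>)) \<in> borel_measurable (radial_measure \<gamma>)" unfolding G_def by measurable
    show "AE b in radial_measure \<gamma>. (\<integral>s. leray_kernel \<gamma> k z (s, b) * leray_kernel \<gamma> k (s, b) \<zeta> \<partial>lborel) = F * G (b powr \<gamma>)"
      using AE_radial_pos by eventually_elim (rule inner)
  qed
  also have "\<dots> = F * ((LINT t:{0<..}|lborel. G t) / of_real \<gamma>)"
    using g by (subst integral_mult_right_zero, subst integral_radial_powr) auto
  also have "(LINT t:{0<..}|lborel. G t) = fact k * fact (k + 1) / (fact (k + (k + 1) + 1) * of_real \<gamma> ^ Suc k * A ^ Suc (k + 1))"
    unfolding G_def using g A by (intro halfline_power_integral) auto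
  also have "F * (fact k * fact (k + 1) / (fact (k + (k + 1) + 1) * of_real \<gamma> ^ Suc k * A ^ Suc (k + 1)) / of_real \<gamma>) =
     of_real C * (of_real B ^ k / A ^ (k + 2))"
  proof -
    have b: "real ((2 * k + 2) choose (k + 1)) = fact (2 * k + 2) / (fact (k + 1) * fact (k + 1))"
      by (subst binomial_fact) (auto simp: numeral_2_eq_2)
    have alg: "C\<^sup>2 * gk * (2 * pi) * (N / (m * fk * (m * fk))) * (fk * (m * fk) / (N * (\<gamma> * gk)) / \<gamma>) = C"
      if "m = real k + 1" "gk \<noteq> 0" "N \<noteq> 0" "fk \<noteq> 0" for gk N fk m
    proof -
      have "m \<noteq> 0" using that by simp
      have "C\<^sup>2 * gk * (2 * pi) * (N / (m * fk * (m * fk))) * (fk * (m * fk) / (N * (\<gamma> * gk)) / \<gamma>) = C * (C * (2 * pi) / (m * \<gamma>\<^sup>2))"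
        using that g \<open>m \<noteq> 0\<close> by (simp add: power2_eq_square)
      also have "C * (2 * pi) / (m * \<gamma>\<^sup>2) = 1" using g \<open>m \<noteq> 0\<close> that by (simp add: C_def)
      finally show ?thesis by simp
    qed
    have fk: "fact (k + 1) = (real k + 1) * fact k" by (simp add: add.commute)
    define S where "S = C\<^sup>2 * \<gamma> ^ k * (2 * pi) * real ((2 * k + 2) choose (k + 1))"
    define T where "T = fact k * fact (k + 1) / (fact (2 * k + 2) * (\<gamma> * \<gamma> ^ k)) / \<gamma>"
    have ST: "S * T = C"
      unfolding S_def T_def b fk by (rule alg) (use g in auto)
    have "F = of_real (S * B ^ k)"
      unfolding F_def S_def by (simp only: mult_ac)
    moreover have "fact k * fact (k + 1) / (fact (k + (k + 1) + 1) * of_real \<gamma> ^ Suc k * A ^ Suc (k + 1)) / of_real \<gamma> = of_real T / A ^ (k + 2)"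
    proof -
      have e: "k + (k + 1) + 1 = 2 * k + 2" "Suc (k + 1) = k + 2" by simp_all
      have T: "complex_of_real T = fact k * fact (k + 1) / (fact (2 * k + 2) * of_real \<gamma> ^ Suc k) / of_real \<gamma>"
        unfolding T_def by (simp only: of_real_mult of_real_divide of_real_fact of_real_power power_Suc)
      show ?thesis unfolding e T by (simp only: divide_divide_eq_left mult_ac)
    qed
    ultimately have "F * (fact k * fact (k + 1) / (fact (k + (k + 1) + 1) * of_real \<gamma> ^ Suc k * A ^ Suc (k + 1)) / of_real \<gamma>) =
       of_real (S * T) * (of_real B ^ k / A ^ (k + 2))"
      by (simp only: of_real_mult of_real_power times_divide_eq_right times_divide_eq_left mult_ac)
    then show ?thesis unfolding ST .
  qed
  finally show ?thesis by (simp add: leray_kernel_def z' \<zeta>' A_def B_def C_def)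
qed

text \<open>
  For truncated functions Fubini reduces the claim to the reproducing property of the kernel:
  rows and columns are in L2, so that the double integral converges absolutely by
  Cauchy-Schwarz. Both sides are continuous in L2.
\<close>

theorem leray_mode_idempotent:
  assumes g: "\<gamma> > 1" and u: "u \<in> L2 (fibre_measure \<gamma>)" and z: "snd z > 0"
  shows "leray_mode \<gamma> k (leray_mode \<gamma> k u) z = leray_mode \<gamma> k u z"
proof -
  let ?N = "fibre_measure \<gamma>"
  have um [measurable]: "u \<in> borel_measurable (borel \<Otimes>\<^sub>M borel)" using u by (rule L2_fibre_measurable)
  have trunc: "leray_mode \<gamma> k (leray_mode \<gamma> k (truncation n u)) z = leray_mode \<gamma> k (truncation n u) z" for n
  proof -
    define v where "v = truncation n u"
    have vm [measurable]: "v \<in> borel_measurable (borel \<Otimes>\<^sub>M borel)" unfolding v_def by measurable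
    have vi: "integrable ?N v" unfolding v_def by (rule truncation_integrable[OF g u])
    define d where "d = 1 / (real n + 1)"
    have d: "d > 0" by (simp add: d_def)
    have vd: "snd \<zeta> \<ge> d" if "v \<zeta> \<noteq> 0" for \<zeta>
      using that fibre_box_snd[of \<zeta> n] by (auto simp: v_def truncation_def d_def indicator_def split: if_splits)
    define K where "K = \<gamma>\<^sup>2 * (real k + 1) / (2 * pi) * sqrt (pi / (4 * \<gamma> * ((\<gamma> - 1) * d powr \<gamma>)\<^sup>2))"
    define f where "f \<zeta> w = (leray_kernel \<gamma> k z w * leray_kernel \<gamma> k w \<zeta>) * v \<zeta>" for \<zeta> w
    have fm: "case_prod f \<in> borel_measurable (?N \<Otimes>\<^sub>M ?N)" unfolding f_def by measurable
    have "(\<integral>\<^sup>+w. ennreal (cmod (f \<zeta> w)) \<partial>?N) \<le> ennreal (L2_norm ?N (leray_kernel \<gamma> k z) * K) * ennreal (cmod (v \<zeta>))" for \<zeta>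
    proof (cases "v \<zeta> = 0")
      case False
      note col = leray_kernel_column_L2[OF g d vd[OF False], of k]
      have i: "integrable ?N (\<lambda>w. cmod (leray_kernel \<gamma> k z w * leray_kernel \<gamma> k w \<zeta>))"
        using L2_mult_integrable[OF leray_kernel_row_L2[OF g z] col(1)] by (rule integrable_norm)
      have "(\<integral>w. cmod (leray_kernel \<gamma> k z w * leray_kernel \<gamma> k w \<zeta>) \<partial>?N) \<le> L2_norm ?N (leray_kernel \<gamma> k z) * L2_norm ?N (\<lambda>w. leray_kernel \<gamma> k w \<zeta>)"
        by (rule L2_Cauchy_Schwarz_norm[OF leray_kernel_row_L2[OF g z] col(1)])
      also have "\<dots> \<le> L2_norm ?N (leray_kernel \<gamma> k z) * K"
        using col(2) unfolding K_def by (intro mult_left_mono) auto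
      finally have le: "(\<integral>w. cmod (leray_kernel \<gamma> k z w * leray_kernel \<gamma> k w \<zeta>) \<partial>?N) \<le> L2_norm ?N (leray_kernel \<gamma> k z) * K" .
      have "(\<integral>\<^sup>+w. ennreal (cmod (f \<zeta> w)) \<partial>?N) = (\<integral>\<^sup>+w. ennreal (cmod (leray_kernel \<gamma> k z w * leray_kernel \<gamma> k w \<zeta>)) * ennreal (cmod (v \<zeta>)) \<partial>?N)"
        unfolding f_def norm_mult[of _ "v \<zeta>"] by (simp only: ennreal_mult norm_ge_zero)
      also have "\<dots> = (\<integral>\<^sup>+w. ennreal (cmod (leray_kernel \<gamma> k z w * leray_kernel \<gamma> k w \<zeta>)) \<partial>?N) * ennreal (cmod (v \<zeta>))"
        by (rule nn_integral_multc) (use i in measurable)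
      also have "\<dots> \<le> ennreal (L2_norm ?N (leray_kernel \<gamma> k z) * K) * ennreal (cmod (v \<zeta>))"
        by (intro mult_right_mono) (subst nn_integral_eq_integral[OF i], auto intro: ennreal_leI le)
      finally show ?thesis .
    qed (simp add: f_def)
    then have "(\<integral>\<^sup>+\<zeta>. \<integral>\<^sup>+w. ennreal (cmod (f \<zeta> w)) \<partial>?N \<partial>?N) \<le> (\<integral>\<^sup>+\<zeta>. ennreal (L2_norm ?N (leray_kernel \<gamma> k z) * K) * ennreal (cmod (v \<zeta>)) \<partial>?N)"
      by (rule nn_integral_mono)
    also have "\<dots> = ennreal (L2_norm ?N (leray_kernel \<gamma> k z) * K) * (\<integral>\<^sup>+\<zeta>. ennreal (cmod (v \<zeta>)) \<partial>?N)"
      by (rule nn_integral_cmult) measurable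
    also have "\<dots> < \<infinity>" using vi by (auto simp: integrable_iff_bounded ennreal_mult_less_top)
    finally have fin: "(\<integral>\<^sup>+\<zeta>. \<integral>\<^sup>+w. ennreal (cmod (f \<zeta> w)) \<partial>?N \<partial>?N) < \<infinity>" .
    have Fub: "(\<integral>w. (\<integral>\<zeta>. f \<zeta> w \<partial>?N) \<partial>?N) = (\<integral>\<zeta>. (\<integral>w. f \<zeta> w \<partial>?N) \<partial>?N)"
      by (rule Fubini_from_nn_integral(2)[OF sigma_finite_fibre_measure sigma_finite_fibre_measure fm fin])
    have "leray_mode \<gamma> k (leray_mode \<gamma> k v) z = (\<integral>w. (\<integral>\<zeta>. f \<zeta> w \<partial>?N) \<partial>?N)"
      unfolding leray_mode_def f_def mult.assoc integral_mult_right_zero ..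
    also have "\<dots> = (\<integral>\<zeta>. (\<integral>w. f \<zeta> w \<partial>?N) \<partial>?N)" by (rule Fub)
    also have "\<dots> = (\<integral>\<zeta>. leray_kernel \<gamma> k z \<zeta> * v \<zeta> \<partial>?N)"
    proof (intro Bochner_Integration.integral_cong refl)
      fix \<zeta>
      show "(\<integral>w. f \<zeta> w \<partial>?N) = leray_kernel \<gamma> k z \<zeta> * v \<zeta>"
      proof (cases "v \<zeta> = 0")
        case False
        then have "snd \<zeta> > 0" using vd d by (meson less_le_trans)
        from leray_kernel_reproducing[OF g z this, of k] show ?thesis
          by (simp only: f_def integral_mult_left_zero)
      qed (simp add: f_def)
    qed
    finally show ?thesis by (simp add: v_def leray_mode_def)
  qed
  have T: "truncation n u \<in> L2 ?N" for n by (rule truncation_L2[OF u])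
  have lim1: "(\<lambda>n. leray_mode \<gamma> k (truncation n u) z) \<longlonglongrightarrow> leray_mode \<gamma> k u z"
    by (intro leray_mode_tendsto g z T u truncation_tendsto_L2)
  have "(\<lambda>n. leray_mode \<gamma> k (leray_mode \<gamma> k (truncation n u)) z) \<longlonglongrightarrow> leray_mode \<gamma> k (leray_mode \<gamma> k u) z"
  proof (intro leray_mode_tendsto g z leray_mode_bounded(2) T u)
    show "(\<lambda>n. L2_norm ?N (\<lambda>\<zeta>. leray_mode \<gamma> k (truncation n u) \<zeta> - leray_mode \<gamma> k u \<zeta>)) \<longlonglongrightarrow> 0"
    proof (rule Lim_null_comparison)
      show "\<forall>\<^sub>F n in sequentially. norm (L2_norm ?N (\<lambda>\<zeta>. leray_mode \<gamma> k (truncation n u) \<zeta> - leray_mode \<gamma> k u \<zeta>)) \<le>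
         \<gamma> / (2 * sqrt (\<gamma> - 1)) * L2_norm ?N (\<lambda>\<zeta>. truncation n u \<zeta> - u \<zeta>)"
      proof (intro always_eventually allI)
        fix n
        have "L2_norm ?N (\<lambda>\<zeta>. leray_mode \<gamma> k (truncation n u) \<zeta> - leray_mode \<gamma> k u \<zeta>) = L2_norm ?N (leray_mode \<gamma> k (\<lambda>\<zeta>. truncation n u \<zeta> - u \<zeta>))"
        proof (rule L2_norm_cong_AE)
          show "AE w in ?N. leray_mode \<gamma> k (truncation n u) w - leray_mode \<gamma> k u w = leray_mode \<gamma> k (\<lambda>\<zeta>. truncation n u \<zeta> - u \<zeta>) w"
            using AE_fibre_pos by eventually_elim (simp add: leray_mode_diff[OF g _ T u])
        qed (intro L2_diff leray_mode_bounded(2) g T u)+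
        then show "norm (L2_norm ?N (\<lambda>\<zeta>. leray_mode \<gamma> k (truncation n u) \<zeta> - leray_mode \<gamma> k u \<zeta>)) \<le>
         \<gamma> / (2 * sqrt (\<gamma> - 1)) * L2_norm ?N (\<lambda>\<zeta>. truncation n u \<zeta> - u \<zeta>)"
          using leray_mode_bounded(3)[OF g L2_diff[OF T u], of k n] by simp
      qed
      show "(\<lambda>n. \<gamma> / (2 * sqrt (\<gamma> - 1)) * L2_norm ?N (\<lambda>\<zeta>. truncation n u \<zeta> - u \<zeta>)) \<longlonglongrightarrow> 0"
        by (rule tendsto_mult_right_zero[OF truncation_tendsto_L2[OF u]])
    qed
  qed
  then show ?thesis unfolding trunc using lim1 by (rule LIMSEQ_unique)
qed

section \<open>A function that attains the norm\<close>

text \<open>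
  Equality in the estimates above forces \<open>u\<close> to be, at every frequency
  \<open>\<xi> > 0\<close>, a multiple of
  \<open>exp(-\<xi>(\<gamma>-1)\<alpha>\<^sup>\<gamma>)\<close>. The conjugate of a row of the
  kernel has this form, and its image is again an inverse square.
\<close>

theorem leray_mode_0_extremal:
  assumes g: "\<gamma> > 1"
  shows "\<exists>u\<in>L2 (fibre_measure \<gamma>). L2_norm (fibre_measure \<gamma>) u > 0 \<and>
     L2_norm (fibre_measure \<gamma>) (leray_mode \<gamma> 0 u) = \<gamma> / (2 * sqrt (\<gamma> - 1)) * L2_norm (fibre_measure \<gamma>) u"
proof -
  interpret pair_sigma_finite lborel "radial_measure \<gamma>" by (rule pair_sigma_finite_fibre)
  let ?N = "fibre_measure \<gamma>"
  define C where "C = \<gamma>\<^sup>2 / (2 * pi)"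
  have C: "C > 0" using g by (simp add: C_def)
  define u where "u \<zeta> = cnj (leray_kernel \<gamma> 0 (0, 1) \<zeta>)" for \<zeta>
  have row: "leray_kernel \<gamma> 0 (0, 1) \<in> L2 ?N" by (rule leray_kernel_row_L2[OF g]) simp
  have u: "u \<in> L2 ?N" unfolding u_def by (rule L2_cnj[OF row])
  have kern: "leray_kernel \<gamma> 0 z \<zeta> = of_real C / (leray_A \<gamma> (fst z) (snd z) (fst \<zeta>) (snd \<zeta>))\<^sup>2" for z \<zeta>
    by (simp add: leray_kernel_def C_def power2_eq_square)
  have Eu: "L2_energy ?N u = ennreal (C\<^sup>2 * (pi / (4 * \<gamma> * (\<gamma> - 1))))"
  proof -
    have "L2_energy ?N u = (\<integral>\<^sup>+\<zeta>. ennreal (C\<^sup>2) * ennreal (1 / cmod (Complex ((\<gamma> - 1) * snd \<zeta> powr \<gamma> + 1) (fst \<zeta> + 0)) ^ 4) \<partial>?N)"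
      unfolding L2_energy_def
    proof (intro nn_integral_cong)
      fix \<zeta>
      have c: "cmod (leray_A \<gamma> 0 1 (fst \<zeta>) (snd \<zeta>)) = cmod (Complex ((\<gamma> - 1) * snd \<zeta> powr \<gamma> + 1) (fst \<zeta> + 0))"
        by (simp add: leray_A_def)
      have "(cmod (u \<zeta>))\<^sup>2 = C\<^sup>2 * (1 / cmod (leray_A \<gamma> 0 1 (fst \<zeta>) (snd \<zeta>)) ^ 4)"
        using C by (simp add: u_def kern norm_divide norm_power power_divide flip: power_mult)
      then show "ennreal ((cmod (u \<zeta>))\<^sup>2) = ennreal (C\<^sup>2) * ennreal (1 / cmod (Complex ((\<gamma> - 1) * snd \<zeta> powr \<gamma> + 1) (fst \<zeta> + 0)) ^ 4)"
        unfolding c by (simp add: ennreal_mult'[symmetric])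
    qed
    also have "\<dots> = ennreal (C\<^sup>2) * ennreal (pi / (4 * \<gamma> * (\<gamma> - 1) * 1\<^sup>2))"
      using g by (subst nn_integral_cmult, simp add: Complex_eq, subst nn_integral_fibre_inverse_quartic) auto
    finally show ?thesis by (simp add: ennreal_mult'[symmetric])
  qed
  define F where "F = complex_of_real (C\<^sup>2 * pi / (\<gamma> * (\<gamma> - 1)))"
  have mode: "leray_mode \<gamma> 0 u z = F / (Complex (snd z powr \<gamma> + 1) (- fst z))\<^sup>2" if z: "snd z > 0" for z
  proof -
    define w where "w = Complex (snd z powr \<gamma> + 1) (- fst z)"
    have w: "Re w > 0" using z by (simp add: w_def add_pos_pos)
    define G where "G t = of_real t ^ 0 / (of_real (2 * (\<gamma> - 1) * t) + w) ^ (0 + 1 + 2)" for t :: real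
    have [measurable]: "G \<in> borel_measurable borel" unfolding G_def by measurable
    have i: "integrable ?N (\<lambda>\<zeta>. leray_kernel \<gamma> 0 z \<zeta> * u \<zeta>)" by (rule leray_mode_integrable[OF g z u])
    have inner: "(\<integral>s. leray_kernel \<gamma> 0 z (s, b) * u (s, b) \<partial>lborel) = of_real (4 * pi * C\<^sup>2) * G (b powr \<gamma>)" if b: "b > 0" for b
    proof -
      define p where "p = Complex ((\<gamma> - 1) * b powr \<gamma> + snd z powr \<gamma>) (- fst z)"
      define q where "q = Complex ((\<gamma> - 1) * b powr \<gamma> + 1) 0"
      have pq: "Re p > 0" "Re q > 0" using g z b by (auto simp: p_def q_def intro!: add_nonneg_pos)
      have A: "leray_A \<gamma> (fst z) (snd z) s b = p + \<i> * of_real s" "cnj (leray_A \<gamma> 0 1 s b) = q - \<i> * of_real s" for s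
        by (auto simp: leray_A_def p_def q_def complex_eq_iff)
      have sum: "p + q = of_real (2 * (\<gamma> - 1) * b powr \<gamma>) + w"
        by (simp add: p_def q_def w_def complex_eq_iff algebra_simps)
      have "leray_kernel \<gamma> 0 z (s, b) * u (s, b) = of_real (C\<^sup>2) * line_integrand p q (Suc 1) (Suc 1) s" for s
        by (simp add: kern u_def A line_integrand_def power2_eq_square)
      then have "(\<integral>s. leray_kernel \<gamma> 0 z (s, b) * u (s, b) \<partial>lborel) = of_real (C\<^sup>2) * (2 * pi * of_nat ((1 + 1) choose 1) / (p + q) ^ Suc (1 + 1))"
        by (simp only: integral_mult_right_zero line_integral[OF pq])
      also have "\<dots> = of_real (4 * pi * C\<^sup>2) * G (b powr \<gamma>)"
        unfolding sum G_def by (simp add: eval_nat_numeral)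
      finally show ?thesis .
    qed
    have "leray_mode \<gamma> 0 u z = (\<integral>b. (\<integral>s. leray_kernel \<gamma> 0 z (s, b) * u (s, b) \<partial>lborel) \<partial>radial_measure \<gamma>)"
      unfolding leray_mode_def using integral_snd[of "\<lambda>s b. leray_kernel \<gamma> 0 z (s, b) * u (s, b)"] i by (simp add: split_beta')
    also have "\<dots> = (\<integral>b. of_real (4 * pi * C\<^sup>2) * G (b powr \<gamma>) \<partial>radial_measure \<gamma>)"
    proof (rule integral_cong_AE)
      have [measurable]: "u \<in> borel_measurable (borel \<Otimes>\<^sub>M borel)" using u by (rule L2_fibre_measurable)
      show "(\<lambda>b. \<integral>s. leray_kernel \<gamma> 0 z (s, b) * u (s, b) \<partial>lborel) \<in> borel_measurable (radial_measure \<gamma>)"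
        by (intro lborel.borel_measurable_lebesgue_integral) (simp add: split_beta', measurable)
      show "(\<lambda>b. of_real (4 * pi * C\<^sup>2) * G (b powr \<gamma>)) \<in> borel_measurable (radial_measure \<gamma>)" unfolding G_def by measurable
      show "AE b in radial_measure \<gamma>. (\<integral>s. leray_kernel \<gamma> 0 z (s, b) * u (s, b) \<partial>lborel) = of_real (4 * pi * C\<^sup>2) * G (b powr \<gamma>)"
        using AE_radial_pos by eventually_elim (rule inner)
    qed
    also have "\<dots> = of_real (4 * pi * C\<^sup>2) * ((LINT t:{0<..}|lborel. G t) / of_real \<gamma>)"
      using g by (subst integral_mult_right_zero, subst integral_radial_powr) auto
    also have "(LINT t:{0<..}|lborel. G t) = fact 0 * fact 1 / (fact (0 + 1 + 1) * of_real (2 * (\<gamma> - 1)) ^ Suc 0 * w ^ Suc 1)"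
      unfolding G_def using g w by (intro halfline_power_integral) auto
    also have "of_real (4 * pi * C\<^sup>2) * (fact 0 * fact 1 / (fact (0 + 1 + 1) * of_real (2 * (\<gamma> - 1)) ^ Suc 0 * w ^ Suc 1) / of_real \<gamma>) = F / w\<^sup>2"
    proof -
      have "of_real (4 * pi * C\<^sup>2) * (fact 0 * fact 1 / (fact (0 + 1 + 1) * of_real (2 * m) ^ Suc 0 * w ^ Suc 1) / of_real \<gamma>) = complex_of_real (C\<^sup>2 * pi / (\<gamma> * m)) / w\<^sup>2" for m
        by (simp add: power2_eq_square mult_ac)
      then show ?thesis unfolding F_def .
    qed
    finally show ?thesis by (simp add: w_def)
  qed
  have Em: "L2_energy ?N (leray_mode \<gamma> 0 u) = ennreal ((C\<^sup>2 * pi / (\<gamma> * (\<gamma> - 1)))\<^sup>2 * (pi / (4 * \<gamma>)))"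
  proof -
    have "L2_energy ?N (leray_mode \<gamma> 0 u) = (\<integral>\<^sup>+z. ennreal ((C\<^sup>2 * pi / (\<gamma> * (\<gamma> - 1)))\<^sup>2) * ennreal (1 / cmod (Complex (1 * snd z powr \<gamma> + 1) (fst z + 0)) ^ 4) \<partial>?N)"
      unfolding L2_energy_def
    proof (rule nn_integral_cong_AE, use AE_fibre_pos in eventually_elim)
      case (elim z)
      have c: "cmod (Complex (snd z powr \<gamma> + 1) (- fst z)) = cmod (Complex (1 * snd z powr \<gamma> + 1) (fst z + 0))"
        by (simp add: cmod_def)
      have "(cmod (leray_mode \<gamma> 0 u z))\<^sup>2 = (C\<^sup>2 * pi / (\<gamma> * (\<gamma> - 1)))\<^sup>2 * (1 / cmod (Complex (snd z powr \<gamma> + 1) (- fst z)) ^ 4)"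
      proof -
        have "(\<bar>x\<bar> / y\<^sup>2)\<^sup>2 = x\<^sup>2 * (1 / y ^ 4)" for x y :: real
          by (simp add: power_divide flip: power_mult)
        then show ?thesis unfolding mode[OF elim] F_def norm_divide norm_power norm_of_real .
      qed
      then show ?case unfolding c by (simp only: ennreal_mult'[symmetric] zero_le_power2)
    qed
    also have "\<dots> = ennreal ((C\<^sup>2 * pi / (\<gamma> * (\<gamma> - 1)))\<^sup>2) * ennreal (pi / (4 * \<gamma> * 1 * 1\<^sup>2))"
      using g by (subst nn_integral_cmult, simp add: Complex_eq, subst nn_integral_fibre_inverse_quartic) auto
    finally show ?thesis by (simp add: ennreal_mult'[symmetric])
  qed
  have nu: "(L2_norm ?N u)\<^sup>2 = C\<^sup>2 * (pi / (4 * \<gamma> * (\<gamma> - 1)))"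
    using L2_norm_square_energy[OF u] g unfolding Eu by (subst (asm) ennreal_inj) auto
  have nm: "(L2_norm ?N (leray_mode \<gamma> 0 u))\<^sup>2 = (C\<^sup>2 * pi / (\<gamma> * (\<gamma> - 1)))\<^sup>2 * (pi / (4 * \<gamma>))"
    using L2_norm_square_energy[OF leray_mode_bounded(2)[OF g u, of 0]] g unfolding Em by (subst (asm) ennreal_inj) auto
  have "(L2_norm ?N u)\<^sup>2 > 0" unfolding nu using C g by simp
  then have pos: "L2_norm ?N u > 0" using L2_norm_nonneg[of ?N u] by (metis less_le zero_less_power2)
  have "(L2_norm ?N (leray_mode \<gamma> 0 u))\<^sup>2 = (\<gamma> / (2 * sqrt (\<gamma> - 1)) * L2_norm ?N u)\<^sup>2"
  proof -
    have "(C2 * pi / (\<gamma> * m))\<^sup>2 * (pi / (4 * \<gamma>)) = \<gamma>\<^sup>2 / (4 * m) * (C2 * (pi / (4 * \<gamma> * m)))"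
      if "C2 = \<gamma>\<^sup>2 * \<gamma>\<^sup>2 / (4 * pi\<^sup>2)" "m \<noteq> 0" for C2 m
      using g that by (simp add: field_simps power2_eq_square)
    from this[of "C\<^sup>2" "\<gamma> - 1"] show ?thesis
      unfolding power_mult_distrib nm nu using g by (simp add: C_def power_divide power2_eq_square)
  qed
  then have "L2_norm ?N (leray_mode \<gamma> 0 u) = \<gamma> / (2 * sqrt (\<gamma> - 1)) * L2_norm ?N u"
    using g by (subst (asm) power2_eq_iff_nonneg) auto
  then show ?thesis using u pos by blast
qed


section \<open>Fourier series on the circle\<close>

text \<open>
  The exponential cut off to one period, as a function on the line, so that the L2 theory of
  Lebesgue measure applies.
\<close>

definition circle_mode :: "nat \<Rightarrow> real \<Rightarrow> complex" where
  "circle_mode k \<theta> = indicator {0..<2 * pi} \<theta> * cis (real k * \<theta>)"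

lemma circle_mode_measurable [measurable]: "circle_mode k \<in> borel_measurable borel"
  unfolding circle_mode_def by measurable

lemma circle_mode_L2: "circle_mode k \<in> L2 lborel"
proof -
  have "L2_energy lborel (circle_mode k) = (\<integral>\<^sup>+\<theta>. indicator {0..<2 * pi} \<theta> \<partial>lborel)"
    unfolding L2_energy_def by (intro nn_integral_cong) (auto simp: circle_mode_def indicator_def norm_mult)
  also have "\<dots> < \<infinity>" by simp
  finally show ?thesis by (simp add: L2_iff_energy)
qed

lemma integral_circle_cis:
  "(\<integral>\<theta>. indicator {0..<2 * pi} \<theta> * cis (of_int m * \<theta>) \<partial>lborel) = (if m = 0 then complex_of_real (2 * pi) else 0)"
proof -
  have "(\<integral>\<theta>. indicator {0..<2 * pi} \<theta> * cis (of_int m * \<theta>) \<partial>lborel) = (\<integral>\<theta>. indicator {0..2 * pi} \<theta> *\<^sub>R cis (of_int m * \<theta>) \<partial>lborel)"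
  proof (rule integral_cong_AE)
    show "AE \<theta> in lborel. indicator {0..<2 * pi} \<theta> * cis (of_int m * \<theta>) = indicator {0..2 * pi} \<theta> *\<^sub>R cis (of_int m * \<theta>)"
      using AE_lborel_singleton[of "2 * pi"] by eventually_elim (auto simp: indicator_def)
  qed measurable
  also have "\<dots> = (if m = 0 then complex_of_real (2 * pi) else 0)"
  proof (cases "m = 0")
    case False
    define F where "F \<theta> = cis (of_int m * \<theta>) / (\<i> * of_int m)" for \<theta>
    have "(\<integral>\<theta>. indicator {0..2 * pi} \<theta> *\<^sub>R cis (of_int m * \<theta>) \<partial>lborel) = F (2 * pi) - F 0"
    proof (rule integral_FTC_Icc)
      show "(F has_vector_derivative cis (of_int m * x)) (at x within {0..2 * pi})" for x
      proof -
        have "((\<lambda>z. exp (\<i> * of_int m * z) / (\<i> * of_int m)) has_field_derivative exp (\<i> * of_int m * of_real x)) (at (of_real x))"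
          using False by (auto intro!: derivative_eq_intros)
        from has_vector_derivative_real_field[OF this] show ?thesis
          by (simp add: F_def[abs_def] cis_conv_exp mult_ac has_vector_derivative_at_within)
      qed
    qed (auto intro!: continuous_intros)
    also have "\<dots> = 0" using cis_multiple_2pi[of "of_int m"] by (simp add: F_def mult_ac)
    finally show ?thesis using False by simp
  qed (simp add: scaleR_conv_of_real)
  finally show ?thesis .
qed

lemma circle_mode_orthogonal:
  "(\<integral>\<theta>. circle_mode j \<theta> * cnj (circle_mode k \<theta>) \<partial>lborel) = (if j = k then complex_of_real (2 * pi) else 0)"
proof -
  have "circle_mode j \<theta> * cnj (circle_mode k \<theta>) = indicator {0..<2 * pi} \<theta> * cis (of_int (int j - int k) * \<theta>)" for \<theta>
    by (auto simp: circle_mode_def indicator_def cis_cnj cis_mult left_diff_distrib)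
  then show ?thesis using integral_circle_cis[of "int j - int k"] by simp
qed

lemma circle_sum_inner:
  fixes c :: "nat \<Rightarrow> complex"
  assumes "finite I"
  shows "(\<integral>\<theta>. (\<Sum>j\<in>I. c j * circle_mode j \<theta>) * cnj (circle_mode k \<theta>) \<partial>lborel) = (if k \<in> I then complex_of_real (2 * pi) * c k else 0)"
proof -
  have i: "integrable lborel (\<lambda>\<theta>. c j * (circle_mode j \<theta> * cnj (circle_mode k \<theta>)))" for j
    by (intro integrable_mult_right L2_mult_integrable circle_mode_L2 L2_cnj)
  have "(\<integral>\<theta>. (\<Sum>j\<in>I. c j * circle_mode j \<theta>) * cnj (circle_mode k \<theta>) \<partial>lborel) = (\<integral>\<theta>. (\<Sum>j\<in>I. c j * (circle_mode j \<theta> * cnj (circle_mode k \<theta>))) \<partial>lborel)"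
    by (simp add: sum_distrib_right mult.assoc)
  also have "\<dots> = (\<Sum>j\<in>I. c j * (if j = k then complex_of_real (2 * pi) else 0))"
    using i by (simp add: circle_mode_orthogonal)
  also have "\<dots> = (\<Sum>j\<in>I. if k = j then complex_of_real (2 * pi) * c k else 0)" by (intro sum.cong) auto
  also have "\<dots> = (if k \<in> I then complex_of_real (2 * pi) * c k else 0)"
    using assms by (simp add: sum.delta)
  finally show ?thesis .
qed

lemma circle_sum_energy:
  fixes c :: "nat \<Rightarrow> complex"
  assumes I: "finite I"
  shows "L2_energy lborel (\<lambda>\<theta>. \<Sum>j\<in>I. c j * circle_mode j \<theta>) = ennreal (2 * pi * (\<Sum>j\<in>I. (cmod (c j))\<^sup>2))"
proof -
  define T where "T \<theta> = (\<Sum>j\<in>I. c j * circle_mode j \<theta>)" for \<theta>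
  have T: "T \<in> L2 lborel" unfolding T_def by (intro L2_sum L2_cmult circle_mode_L2)
  have i: "integrable lborel (\<lambda>\<theta>. cnj (c k) * (T \<theta> * cnj (circle_mode k \<theta>)))" for k
    by (intro integrable_mult_right L2_mult_integrable circle_mode_L2 L2_cnj T)
  have "of_real ((L2_norm lborel T)\<^sup>2) = (\<integral>\<theta>. T \<theta> * cnj (T \<theta>) \<partial>lborel)"
    unfolding L2_norm_square complex_norm_square[symmetric] by (rule integral_complex_of_real[symmetric])
  also have "\<dots> = (\<integral>\<theta>. (\<Sum>k\<in>I. cnj (c k) * (T \<theta> * cnj (circle_mode k \<theta>))) \<partial>lborel)"
  proof (intro Bochner_Integration.integral_cong refl)
    fix \<theta>
    have "cnj (T \<theta>) = (\<Sum>k\<in>I. cnj (c k) * cnj (circle_mode k \<theta>))" by (simp add: T_def)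
    then show "T \<theta> * cnj (T \<theta>) = (\<Sum>k\<in>I. cnj (c k) * (T \<theta> * cnj (circle_mode k \<theta>)))"
      by (simp add: sum_distrib_left mult_ac)
  qed
  also have "\<dots> = (\<Sum>k\<in>I. cnj (c k) * (complex_of_real (2 * pi) * c k))"
    using i circle_sum_inner[OF I, of c] by (simp add: T_def[symmetric])
  also have "\<dots> = of_real (2 * pi * (\<Sum>j\<in>I. (cmod (c j))\<^sup>2))"
    by (simp add: sum_distrib_left complex_norm_square mult_ac del: of_real_power)
  finally have "(L2_norm lborel T)\<^sup>2 = 2 * pi * (\<Sum>j\<in>I. (cmod (c j))\<^sup>2)" by (simp only: of_real_eq_iff)
  then show ?thesis using L2_norm_square_energy[OF T] by (simp add: T_def[abs_def])
qed

definition circle_coeff :: "(real \<Rightarrow> complex) \<Rightarrow> nat \<Rightarrow> complex" where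
  "circle_coeff h k = (\<integral>\<theta>. h \<theta> * cis (- (real k * \<theta>)) \<partial>lborel) / complex_of_real (2 * pi)"

lemma circle_coeff_inner:
  assumes "\<And>\<theta>. \<theta> \<notin> {0..<2 * pi} \<Longrightarrow> h \<theta> = 0"
  shows "(\<integral>\<theta>. h \<theta> * cnj (circle_mode k \<theta>) \<partial>lborel) = complex_of_real (2 * pi) * circle_coeff h k"
proof -
  have "h \<theta> * cnj (circle_mode k \<theta>) = h \<theta> * cis (- (real k * \<theta>))" for \<theta>
    using assms[of \<theta>] by (cases "\<theta> \<in> {0..<2 * pi}") (auto simp: circle_mode_def cis_cnj)
  then have "(\<lambda>\<theta>. h \<theta> * cnj (circle_mode k \<theta>)) = (\<lambda>\<theta>. h \<theta> * cis (- (real k * \<theta>)))" by (rule ext)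
  then show ?thesis by (simp add: circle_coeff_def)
qed

text \<open>
  The difference of \<open>h\<close> and its Fourier polynomial \<open>T\<close> is orthogonal
  to \<open>T\<close>, hence \<open>\<parallel>h\<parallel>\<^sup>2 = \<parallel>h -
  T\<parallel>\<^sup>2 + \<parallel>T\<parallel>\<^sup>2\<close>.
\<close>

lemma circle_Bessel:
  assumes [measurable]: "h \<in> borel_measurable borel" and supp: "\<And>\<theta>. \<theta> \<notin> {0..<2 * pi} \<Longrightarrow> h \<theta> = 0"
    and I: "finite I"
  shows "ennreal (2 * pi * (\<Sum>k\<in>I. (cmod (circle_coeff h k))\<^sup>2)) \<le> L2_energy lborel h"
proof (cases "L2_energy lborel h < \<infinity>")
  case True
  then have h: "h \<in> L2 lborel" by (simp add: L2_iff_energy)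
  define T where "T \<theta> = (\<Sum>j\<in>I. circle_coeff h j * circle_mode j \<theta>)" for \<theta>
  have T: "T \<in> L2 lborel" unfolding T_def by (intro L2_sum L2_cmult circle_mode_L2)
  have hT: "(\<lambda>\<theta>. h \<theta> - T \<theta>) \<in> L2 lborel" using h T by (rule L2_diff)
  have ik: "integrable lborel (\<lambda>\<theta>. f \<theta> * cnj (circle_mode k \<theta>))" if "f \<in> L2 lborel" for f k
    by (intro L2_mult_integrable circle_mode_L2 L2_cnj that)
  have orth: "(\<integral>\<theta>. (h \<theta> - T \<theta>) * cnj (circle_mode k \<theta>) \<partial>lborel) = 0" if "k \<in> I" for k
  proof -
    have "(\<integral>\<theta>. (h \<theta> - T \<theta>) * cnj (circle_mode k \<theta>) \<partial>lborel) = (\<integral>\<theta>. h \<theta> * cnj (circle_mode k \<theta>) \<partial>lborel) - (\<integral>\<theta>. T \<theta> * cnj (circle_mode k \<theta>) \<partial>lborel)"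
      using ik[OF h] ik[OF T] by (simp add: left_diff_distrib)
    then show ?thesis using circle_coeff_inner[OF supp] circle_sum_inner[OF I, of "circle_coeff h" k] that
      by (simp add: T_def)
  qed
  have "(\<integral>\<theta>. (h \<theta> - T \<theta>) * cnj (T \<theta>) \<partial>lborel) = (\<integral>\<theta>. (\<Sum>k\<in>I. cnj (circle_coeff h k) * ((h \<theta> - T \<theta>) * cnj (circle_mode k \<theta>))) \<partial>lborel)"
  proof (intro Bochner_Integration.integral_cong refl)
    fix \<theta>
    have "cnj (T \<theta>) = (\<Sum>k\<in>I. cnj (circle_coeff h k) * cnj (circle_mode k \<theta>))" by (simp add: T_def)
    then show "(h \<theta> - T \<theta>) * cnj (T \<theta>) = (\<Sum>k\<in>I. cnj (circle_coeff h k) * ((h \<theta> - T \<theta>) * cnj (circle_mode k \<theta>)))"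
      by (simp add: sum_distrib_left mult_ac)
  qed
  also have "\<dots> = 0" using ik[OF hT] orth by simp
  finally have z: "(\<integral>\<theta>. (h \<theta> - T \<theta>) * cnj (T \<theta>) \<partial>lborel) = 0" .
  have iz: "integrable lborel (\<lambda>\<theta>. (h \<theta> - T \<theta>) * cnj (T \<theta>))"
    by (intro L2_mult_integrable hT L2_cnj T)
  define r where "r \<theta> = Re ((h \<theta> - T \<theta>) * cnj (T \<theta>))" for \<theta>
  have r: "integrable lborel r" "(\<integral>\<theta>. r \<theta> \<partial>lborel) = 0"
    unfolding r_def using integrable_Re[OF iz] integral_Re[OF iz] z by (simp_all only: zero_complex.sel)
  have pw: "(cmod (T \<theta>))\<^sup>2 + 2 * r \<theta> \<le> (cmod (h \<theta>))\<^sup>2" for \<theta>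
  proof -
    have "(cmod (h \<theta>))\<^sup>2 = (cmod (h \<theta> - T \<theta>))\<^sup>2 + ((cmod (T \<theta>))\<^sup>2 + 2 * r \<theta>)"
      unfolding cmod_power2 r_def by (simp add: power2_eq_square algebra_simps)
    then show ?thesis by simp
  qed
  have "(L2_norm lborel T)\<^sup>2 = (\<integral>\<theta>. (cmod (T \<theta>))\<^sup>2 + 2 * r \<theta> \<partial>lborel)"
    using T r by (simp add: L2_norm_square L2_def)
  also have "\<dots> \<le> (L2_norm lborel h)\<^sup>2"
    unfolding L2_norm_square using T h r pw by (intro integral_mono) (auto simp: L2_def)
  finally have "ennreal ((L2_norm lborel T)\<^sup>2) \<le> ennreal ((L2_norm lborel h)\<^sup>2)" by (rule ennreal_leI)
  then show ?thesis
    using circle_sum_energy[OF I, of "circle_coeff h"] by (simp add: L2_norm_square_energy h T) (simp add: T_def[abs_def])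
next
  case False
  then have "L2_energy lborel h = \<infinity>" by (metis infinity_ennreal_def top.not_eq_extremum)
  then show ?thesis by simp
qed


section \<open>Functions on the hypersurface in the chart\<close>

lemma sets_surface_measure [simp]: "sets (surface_measure \<gamma>) = sets (restrict_space borel (hypersurface \<gamma>))"
  by (simp add: surface_measure_def)

lemma surface_params_sets [measurable]: "surface_params \<in> sets (borel \<Otimes>\<^sub>M (borel \<Otimes>\<^sub>M borel))"
  unfolding surface_params_def by (intro pair_measureI) auto

lemma borel_triple: "(borel :: (real \<times> real \<times> real) measure) = borel \<Otimes>\<^sub>M (borel \<Otimes>\<^sub>M borel)"
  by (simp add: borel_prod)

lemma surface_params_iff: "(s, \<alpha>, \<theta>) \<in> surface_params \<longleftrightarrow> \<alpha> > 0 \<and> \<theta> \<in> {0..<2 * pi}"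
  by (auto simp: surface_params_def)

text \<open>
  Integration over the hypersurface in the order that the argument uses:
  \<open>\<theta>\<close> innermost, over a fixed point of the fibre. The indicator function
  makes the integrand measurable on the whole parameter space; outside the chart nothing is
  known about \<open>h\<close>.
\<close>

lemma nn_integral_surface:
  assumes h: "h \<in> borel_measurable (surface_measure \<gamma>)"
  defines "H \<equiv> \<lambda>p. h (surface_point \<gamma> p) * indicator surface_params p"
  shows "H \<in> borel_measurable (borel \<Otimes>\<^sub>M (borel \<Otimes>\<^sub>M borel))"
    and "(\<integral>\<^sup>+z. h z \<partial>surface_measure \<gamma>) = (\<integral>\<^sup>+\<zeta>. (\<integral>\<^sup>+\<theta>. H (fst \<zeta>, snd \<zeta>, \<theta>) \<partial>lborel) \<partial>fibre_measure \<gamma>)"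
proof -
  let ?R = "restrict_space lborel surface_params" and ?d = "\<lambda>(s :: real, \<alpha> :: real, \<theta> :: real). ennreal (\<alpha> powr (\<gamma> - 1))"
  interpret R: sigma_finite_measure "radial_measure \<gamma>" by (rule sigma_finite_radial_measure)
  have par: "surface_params \<in> sets lborel" using surface_params_sets by (simp add: borel_triple)
  have h': "h \<in> borel_measurable (restrict_space borel (hypersurface \<gamma>))"
    using h by (simp add: measurable_cong_sets[OF sets_surface_measure refl])
  have hs: "(\<lambda>p. h (surface_point \<gamma> p)) \<in> borel_measurable ?R"
    by (rule measurable_compose[OF surface_point_measurable h'])
  have d: "?d \<in> borel_measurable lborel"
  proof -
    have "?d \<in> borel_measurable (borel \<Otimes>\<^sub>M (borel \<Otimes>\<^sub>M borel))" by measurable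
    then show ?thesis by (simp add: borel_prod)
  qed
  show H [measurable]: "H \<in> borel_measurable (borel \<Otimes>\<^sub>M (borel \<Otimes>\<^sub>M borel))"
    using hs par by (simp add: borel_measurable_restrict_space_iff_ennreal H_def borel_triple)
  have "(\<integral>\<^sup>+z. h z \<partial>surface_measure \<gamma>) = (\<integral>\<^sup>+p. h (surface_point \<gamma> p) \<partial>density ?R ?d)"
    unfolding surface_measure_def
    by (rule nn_integral_distr) (use h surface_point_measurable in \<open>auto simp: surface_measure_def\<close>)
  also have "\<dots> = (\<integral>\<^sup>+p. ?d p * h (surface_point \<gamma> p) \<partial>?R)"
    by (rule nn_integral_density[OF measurable_restrict_space1[OF d] hs])
  also have "\<dots> = (\<integral>\<^sup>+p. ?d p * h (surface_point \<gamma> p) * indicator surface_params p \<partial>lborel)"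
    by (rule nn_integral_restrict_space) (use par in simp)
  also have "\<dots> = (\<integral>\<^sup>+p. ennreal (indicator {0<..} (fst (snd p)) * fst (snd p) powr (\<gamma> - 1)) * H p \<partial>(lborel \<Otimes>\<^sub>M (lborel \<Otimes>\<^sub>M lborel)))"
    unfolding lborel_prod by (intro nn_integral_cong) (auto simp: H_def surface_params_def indicator_def)
  also have "\<dots> = (\<integral>\<^sup>+s. \<integral>\<^sup>+\<alpha>. \<integral>\<^sup>+\<theta>. ennreal (indicator {0<..} \<alpha> * \<alpha> powr (\<gamma> - 1)) * H (s, \<alpha>, \<theta>) \<partial>lborel \<partial>lborel \<partial>lborel)"
  proof -
    have B: "sigma_finite_measure (lborel \<Otimes>\<^sub>M lborel :: (real \<times> real) measure)"
      unfolding lborel_prod by (rule sigma_finite_lborel)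
    show ?thesis
      by (subst sigma_finite_measure.nn_integral_fst[OF B, symmetric], simp, subst lborel.nn_integral_fst[symmetric], simp, simp)
  qed
  also have "\<dots> = (\<integral>\<^sup>+s. \<integral>\<^sup>+\<alpha>. ennreal (indicator {0<..} \<alpha> * \<alpha> powr (\<gamma> - 1)) * (\<integral>\<^sup>+\<theta>. H (s, \<alpha>, \<theta>) \<partial>lborel) \<partial>lborel \<partial>lborel)"
    by (simp add: nn_integral_cmult)
  also have "\<dots> = (\<integral>\<^sup>+s. \<integral>\<^sup>+\<alpha>. (\<integral>\<^sup>+\<theta>. H (s, \<alpha>, \<theta>) \<partial>lborel) \<partial>radial_measure \<gamma> \<partial>lborel)"
    unfolding radial_measure_def by (intro nn_integral_cong nn_integral_density[symmetric]) measurable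
  also have "\<dots> = (\<integral>\<^sup>+\<zeta>. (\<integral>\<^sup>+\<theta>. H (fst \<zeta>, snd \<zeta>, \<theta>) \<partial>lborel) \<partial>fibre_measure \<gamma>)"
    by (subst R.nn_integral_fst[symmetric]) auto
  finally show "(\<integral>\<^sup>+z. h z \<partial>surface_measure \<gamma>) = (\<integral>\<^sup>+\<zeta>. (\<integral>\<^sup>+\<theta>. H (fst \<zeta>, snd \<zeta>, \<theta>) \<partial>lborel) \<partial>fibre_measure \<gamma>)" .
qed

text \<open>
  The function on a circle of the hypersurface, extended by zero to all real angles and to
  fibre points that do not belong to the chart.
\<close>

definition angular_slice :: "real \<Rightarrow> (complex \<times> complex \<Rightarrow> complex) \<Rightarrow> real \<times> real \<Rightarrow> real \<Rightarrow> complex" where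
  "angular_slice \<gamma> f \<zeta> \<theta> = indicator surface_params (fst \<zeta>, snd \<zeta>, \<theta>) * f (surface_point \<gamma> (fst \<zeta>, snd \<zeta>, \<theta>))"

lemma angular_slice_support: "\<theta> \<notin> {0..<2 * pi} \<Longrightarrow> angular_slice \<gamma> f \<zeta> \<theta> = 0"
  by (auto simp: angular_slice_def surface_params_def)

lemma angular_slice_measurable:
  assumes "f \<in> borel_measurable (surface_measure \<gamma>)"
  shows "(\<lambda>(\<zeta>, \<theta>). angular_slice \<gamma> f \<zeta> \<theta>) \<in> borel_measurable ((borel \<Otimes>\<^sub>M borel) \<Otimes>\<^sub>M borel)"
proof -
  have par: "surface_params \<in> sets lborel" using surface_params_sets by (simp add: borel_triple)
  have "f \<in> borel_measurable (restrict_space borel (hypersurface \<gamma>))"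
    using assms by (simp add: measurable_cong_sets[OF sets_surface_measure refl])
  from measurable_compose[OF surface_point_measurable this]
  have [measurable]: "(\<lambda>p. indicator surface_params p *\<^sub>R f (surface_point \<gamma> p)) \<in> borel_measurable (borel \<Otimes>\<^sub>M (borel \<Otimes>\<^sub>M borel))"
    using par by (simp add: borel_measurable_restrict_space_iff borel_triple)
  have "(\<lambda>x. indicator surface_params (fst (fst x), snd (fst x), snd x) *\<^sub>R f (surface_point \<gamma> (fst (fst x), snd (fst x), snd x)))
      \<in> borel_measurable (((borel :: real measure) \<Otimes>\<^sub>M (borel :: real measure)) \<Otimes>\<^sub>M (borel :: real measure))"
    by (rule measurable_compose[of "\<lambda>x. (fst (fst x), snd (fst x), snd x)"]) measurable
  then show ?thesis
    by (rule back_subst[where P="\<lambda>g. g \<in> _"]) (auto simp: fun_eq_iff angular_slice_def indicator_def)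
qed

lemma surface_energy:
  assumes f: "f \<in> borel_measurable (surface_measure \<gamma>)"
  shows "L2_energy (surface_measure \<gamma>) f = (\<integral>\<^sup>+\<zeta>. L2_energy lborel (angular_slice \<gamma> f \<zeta>) \<partial>fibre_measure \<gamma>)"
proof -
  have "(\<lambda>z. ennreal ((cmod (f z))\<^sup>2)) \<in> borel_measurable (surface_measure \<gamma>)" using f by measurable
  from nn_integral_surface(2)[OF this] show ?thesis
    unfolding L2_energy_def
    by (auto intro!: nn_integral_cong simp: angular_slice_def indicator_def)
qed


section \<open>L2 series\<close>

lemma L2_energy_0_AE:
  assumes [measurable]: "f \<in> borel_measurable M" and "L2_energy M f = 0"
  shows "AE x in M. f x = 0"
  using assms(2) unfolding L2_energy_def by (subst (asm) nn_integral_0_iff_AE) auto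

lemma L2_sums_partial: "L2_sums M F g \<Longrightarrow> (\<lambda>x. \<Sum>k<n. F k x) \<in> L2 M"
  unfolding L2_sums_def by (intro L2_sum) auto

lemma L2_sums_unique:
  assumes F: "L2_sums M F g" and h: "L2_sums M F h"
  shows "AE x in M. g x = h x"
  by (rule L2_limit_unique[of "\<lambda>n x. \<Sum>k<n. F k x"])
     (use F h L2_sums_partial[OF F] in \<open>auto simp: L2_sums_def\<close>)

lemma L2_sums_cong_AE:
  assumes F: "L2_sums M F g" and G: "\<And>k. G k \<in> L2 M" and eq: "\<And>k. AE x in M. F k x = G k x"
  shows "L2_sums M G g"
proof -
  have "L2_norm M (\<lambda>x. (\<Sum>k<n. F k x) - g x) = L2_norm M (\<lambda>x. (\<Sum>k<n. G k x) - g x)" for n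
  proof (rule L2_norm_cong_AE)
    have "AE x in M. \<forall>k. F k x = G k x" using eq by (simp add: AE_all_countable)
    then show "AE x in M. (\<Sum>k<n. F k x) - g x = (\<Sum>k<n. G k x) - g x" by eventually_elim simp
  qed (use F G in \<open>auto simp: L2_sums_def intro!: L2_diff L2_sum\<close>)
  then show ?thesis using F G by (simp add: L2_sums_def)
qed

lemma L2_sums_add:
  assumes F: "L2_sums M F g" and G: "L2_sums M G h"
  shows "L2_sums M (\<lambda>k x. F k x + G k x) (\<lambda>x. g x + h x)"
  unfolding L2_sums_def
proof (intro conjI allI)
  have F': "\<And>k. F k \<in> L2 M" "g \<in> L2 M" and G': "\<And>k. G k \<in> L2 M" "h \<in> L2 M"
    using F G by (auto simp: L2_sums_def)
  show "(\<lambda>x. F k x + G k x) \<in> L2 M" for k using F' G' by (intro L2_add)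
  show "(\<lambda>x. g x + h x) \<in> L2 M" using F' G' by (intro L2_add)
  show "(\<lambda>n. L2_norm M (\<lambda>x. (\<Sum>k<n. F k x + G k x) - (g x + h x))) \<longlonglongrightarrow> 0"
  proof (rule Lim_null_comparison)
    show "(\<lambda>n. L2_norm M (\<lambda>x. (\<Sum>k<n. F k x) - g x) + L2_norm M (\<lambda>x. (\<Sum>k<n. G k x) - h x)) \<longlonglongrightarrow> 0"
      using F G by (intro tendsto_add_zero) (auto simp: L2_sums_def)
    show "\<forall>\<^sub>F n in sequentially. norm (L2_norm M (\<lambda>x. (\<Sum>k<n. F k x + G k x) - (g x + h x))) \<le>
       L2_norm M (\<lambda>x. (\<Sum>k<n. F k x) - g x) + L2_norm M (\<lambda>x. (\<Sum>k<n. G k x) - h x)"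
    proof (intro always_eventually allI)
      fix n
      have "(\<lambda>x. (\<Sum>k<n. F k x + G k x) - (g x + h x)) = (\<lambda>x. ((\<Sum>k<n. F k x) - g x) + ((\<Sum>k<n. G k x) - h x))"
        by (simp add: fun_eq_iff sum.distrib)
      then show "norm (L2_norm M (\<lambda>x. (\<Sum>k<n. F k x + G k x) - (g x + h x))) \<le>
         L2_norm M (\<lambda>x. (\<Sum>k<n. F k x) - g x) + L2_norm M (\<lambda>x. (\<Sum>k<n. G k x) - h x)"
        using L2_norm_triangle[OF L2_diff[OF L2_sums_partial[OF F] F'(2)] L2_diff[OF L2_sums_partial[OF G] G'(2)]] by simp
    qed
  qed
qed

lemma L2_sums_cmult:
  assumes F: "L2_sums M F g"
  shows "L2_sums M (\<lambda>k x. c * F k x) (\<lambda>x. c * g x)"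
  unfolding L2_sums_def
proof (intro conjI allI)
  show "(\<lambda>x. c * F k x) \<in> L2 M" for k using F by (auto simp: L2_sums_def)
  show "(\<lambda>x. c * g x) \<in> L2 M" using F by (auto simp: L2_sums_def)
  have "(\<lambda>x. (\<Sum>k<n. c * F k x) - c * g x) = (\<lambda>x. c * ((\<Sum>k<n. F k x) - g x))" for n
    by (simp add: fun_eq_iff sum_distrib_left right_diff_distrib)
  then show "(\<lambda>n. L2_norm M (\<lambda>x. (\<Sum>k<n. c * F k x) - c * g x)) \<longlonglongrightarrow> 0"
    using F by (auto simp: L2_norm_cmult L2_sums_def intro!: tendsto_mult_right_zero)
qed

lemma L2_sums_norm_le:
  assumes F: "L2_sums M F g" and C: "\<And>n. L2_norm M (\<lambda>x. \<Sum>k<n. F k x) \<le> C"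
  shows "L2_norm M g \<le> C"
proof -
  have g: "g \<in> L2 M" using F by (simp add: L2_sums_def)
  have "L2_norm M g \<le> L2_norm M (\<lambda>x. (\<Sum>k<n. F k x) - g x) + C" for n
  proof -
    have "L2_norm M (\<lambda>x. g x - 0) \<le> L2_norm M (\<lambda>x. g x - (\<Sum>k<n. F k x)) + L2_norm M (\<lambda>x. (\<Sum>k<n. F k x) - 0)"
      by (rule L2_norm_triangle_diff[OF g L2_sums_partial[OF F] L2_zero])
    then show ?thesis using C[of n] L2_norm_diff_commute[of M g "\<lambda>x. \<Sum>k<n. F k x"] by simp
  qed
  then have "L2_norm M g \<le> 0 + C"
    by (intro LIMSEQ_le_const[OF tendsto_add[OF _ tendsto_const]]) (use F in \<open>auto simp: L2_sums_def\<close>)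
  then show ?thesis by simp
qed

lemma L2_sums_suminf: "L2_sums M F g \<Longrightarrow> L2_sums M F (L2_suminf M F)"
  unfolding L2_suminf_def by (rule someI[of "L2_sums M F"])


section \<open>Partial Fourier coefficients\<close>

definition fibre_coeff :: "real \<Rightarrow> (complex \<times> complex \<Rightarrow> complex) \<Rightarrow> nat \<Rightarrow> real \<times> real \<Rightarrow> complex" where
  "fibre_coeff \<gamma> f k \<zeta> = circle_coeff (angular_slice \<gamma> f \<zeta>) k"

lemma fibre_coeff_measurable:
  assumes "f \<in> borel_measurable (surface_measure \<gamma>)"
  shows "fibre_coeff \<gamma> f k \<in> borel_measurable (borel \<Otimes>\<^sub>M borel)"
proof -
  note [measurable] = angular_slice_measurable[OF assms]
  show ?thesis unfolding fibre_coeff_def circle_coeff_def by measurable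
qed

lemma angular_slice_measurable1:
  assumes "f \<in> borel_measurable (surface_measure \<gamma>)"
  shows "angular_slice \<gamma> f \<zeta> \<in> borel_measurable borel"
proof -
  have "\<zeta> \<in> space (borel \<Otimes>\<^sub>M borel)" by (simp add: space_pair_measure)
  from measurable_compose[OF measurable_Pair1'[OF this] angular_slice_measurable[OF assms]] show ?thesis by simp
qed

lemma fourier_coeff_eq_fibre_coeff:
  assumes "snd \<zeta> > 0"
  shows "fourier_coeff \<gamma> f (int k) (fst \<zeta>) (snd \<zeta>) = fibre_coeff \<gamma> f k \<zeta>"
proof -
  have "indicat_real {0..<2 * pi} \<theta> *\<^sub>R (f (surface_point \<gamma> (fst \<zeta>, snd \<zeta>, \<theta>)) * cis (- (of_int (int k) * \<theta>))) =
      angular_slice \<gamma> f \<zeta> \<theta> * cis (- (real k * \<theta>))" for \<theta>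
    using assms by (simp add: angular_slice_def indicator_def surface_params_iff)
  then show ?thesis by (simp add: fourier_coeff_def fibre_coeff_def circle_coeff_def set_lebesgue_integral_def)
qed

text \<open>
  The Bessel inequality on every circle, integrated over the fibre.
\<close>

lemma fibre_coeff_Bessel:
  assumes f: "f \<in> borel_measurable (surface_measure \<gamma>)" and I: "finite I"
  shows "(\<Sum>k\<in>I. ennreal (2 * pi) * L2_energy (fibre_measure \<gamma>) (fibre_coeff \<gamma> f k)) \<le> L2_energy (surface_measure \<gamma>) f"
proof -
  note [measurable] = fibre_coeff_measurable[OF f]
  have "(\<Sum>k\<in>I. ennreal (2 * pi) * L2_energy (fibre_measure \<gamma>) (fibre_coeff \<gamma> f k)) =
     (\<integral>\<^sup>+\<zeta>. (\<Sum>k\<in>I. ennreal (2 * pi) * ennreal ((cmod (fibre_coeff \<gamma> f k \<zeta>))\<^sup>2)) \<partial>fibre_measure \<gamma>)"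
    unfolding L2_energy_def by (simp add: nn_integral_sum nn_integral_cmult)
  also have "\<dots> = (\<integral>\<^sup>+\<zeta>. ennreal (2 * pi * (\<Sum>k\<in>I. (cmod (fibre_coeff \<gamma> f k \<zeta>))\<^sup>2)) \<partial>fibre_measure \<gamma>)"
    by (intro nn_integral_cong) (simp add: ennreal_mult'[symmetric] sum_distrib_left)
  also have "\<dots> \<le> (\<integral>\<^sup>+\<zeta>. L2_energy lborel (angular_slice \<gamma> f \<zeta>) \<partial>fibre_measure \<gamma>)"
    unfolding fibre_coeff_def
    by (intro nn_integral_mono circle_Bessel angular_slice_measurable1 f angular_slice_support I)
  also have "\<dots> = L2_energy (surface_measure \<gamma>) f" by (rule surface_energy[OF f, symmetric])
  finally show ?thesis .
qed

lemma fibre_coeff_energy_le: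
  assumes f: "f \<in> borel_measurable (surface_measure \<gamma>)"
  shows "L2_energy (fibre_measure \<gamma>) (fibre_coeff \<gamma> f k) \<le> L2_energy (surface_measure \<gamma>) f"
proof -
  have "1 * L2_energy (fibre_measure \<gamma>) (fibre_coeff \<gamma> f k) \<le> ennreal (2 * pi) * L2_energy (fibre_measure \<gamma>) (fibre_coeff \<gamma> f k)"
    using pi_gt3 by (intro mult_right_mono) auto
  also have "\<dots> \<le> L2_energy (surface_measure \<gamma>) f"
    using fibre_coeff_Bessel[OF f, of "{k}"] by simp
  finally show ?thesis by simp
qed

lemma fibre_coeff_L2:
  assumes f: "f \<in> L2 (surface_measure \<gamma>)"
  shows "fibre_coeff \<gamma> f k \<in> L2 (fibre_measure \<gamma>)"
    and "L2_norm (fibre_measure \<gamma>) (fibre_coeff \<gamma> f k) \<le> L2_norm (surface_measure \<gamma>) f"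
proof -
  have fm: "f \<in> borel_measurable (surface_measure \<gamma>)" using f by (simp add: L2_def)
  note [measurable] = fibre_coeff_measurable[OF fm]
  have m: "fibre_coeff \<gamma> f k \<in> borel_measurable (fibre_measure \<gamma>)" by measurable
  have le: "L2_energy (fibre_measure \<gamma>) (fibre_coeff \<gamma> f k) \<le> ennreal (1\<^sup>2) * L2_energy (surface_measure \<gamma>) f"
    using fibre_coeff_energy_le[OF fm] by simp
  show "fibre_coeff \<gamma> f k \<in> L2 (fibre_measure \<gamma>)" by (rule L2_from_energy_le_energy(1)[OF m le _ f]) simp
  show "L2_norm (fibre_measure \<gamma>) (fibre_coeff \<gamma> f k) \<le> L2_norm (surface_measure \<gamma>) f"
    using L2_from_energy_le_energy(2)[OF m le _ f] by simp
qed

lemma fibre_coeff_cmult: "fibre_coeff \<gamma> (\<lambda>z. c * f z) k \<zeta> = c * fibre_coeff \<gamma> f k \<zeta>"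
proof -
  have "(\<lambda>\<theta>. angular_slice \<gamma> (\<lambda>z. c * f z) \<zeta> \<theta> * cis (- (real k * \<theta>))) = (\<lambda>\<theta>. c * (angular_slice \<gamma> f \<zeta> \<theta> * cis (- (real k * \<theta>))))"
    by (simp add: fun_eq_iff angular_slice_def)
  then show ?thesis by (simp add: fibre_coeff_def circle_coeff_def)
qed

lemma AE_angular_slice_L2:
  assumes f: "f \<in> L2 (surface_measure \<gamma>)"
  shows "AE \<zeta> in fibre_measure \<gamma>. angular_slice \<gamma> f \<zeta> \<in> L2 lborel"
proof -
  have fm: "f \<in> borel_measurable (surface_measure \<gamma>)" using f by (simp add: L2_def)
  note [measurable] = angular_slice_measurable[OF fm]
  have "(\<integral>\<^sup>+\<zeta>. L2_energy lborel (angular_slice \<gamma> f \<zeta>) \<partial>fibre_measure \<gamma>) \<noteq> \<infinity>"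
    using f by (auto simp: surface_energy[OF fm, symmetric] L2_iff_energy)
  moreover have "(\<lambda>\<zeta>. L2_energy lborel (angular_slice \<gamma> f \<zeta>)) \<in> borel_measurable (fibre_measure \<gamma>)"
    unfolding L2_energy_def by measurable
  ultimately have "AE \<zeta> in fibre_measure \<gamma>. L2_energy lborel (angular_slice \<gamma> f \<zeta>) \<noteq> \<infinity>"
    by (intro nn_integral_PInf_AE)
  then show ?thesis
  proof eventually_elim
    case (elim \<zeta>)
    then show ?case using angular_slice_measurable1[OF fm, of \<zeta>]
      by (simp add: L2_iff_energy less_top[symmetric])
  qed
qed

lemma fibre_coeff_add:
  assumes f: "f \<in> L2 (surface_measure \<gamma>)" and g: "g \<in> L2 (surface_measure \<gamma>)"
  shows "AE \<zeta> in fibre_measure \<gamma>. fibre_coeff \<gamma> (\<lambda>z. f z + g z) k \<zeta> = fibre_coeff \<gamma> f k \<zeta> + fibre_coeff \<gamma> g k \<zeta>"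
  using AE_angular_slice_L2[OF f] AE_angular_slice_L2[OF g]
proof eventually_elim
  case (elim \<zeta>)
  have i: "integrable lborel (\<lambda>\<theta>. angular_slice \<gamma> h \<zeta> \<theta> * cnj (circle_mode k \<theta>))" if "angular_slice \<gamma> h \<zeta> \<in> L2 lborel" for h
    by (intro L2_mult_integrable that L2_cnj circle_mode_L2)
  have c: "complex_of_real (2 * pi) * fibre_coeff \<gamma> h k \<zeta> = (\<integral>\<theta>. angular_slice \<gamma> h \<zeta> \<theta> * cnj (circle_mode k \<theta>) \<partial>lborel)" for h
    unfolding fibre_coeff_def by (rule circle_coeff_inner[symmetric, OF angular_slice_support])
  have "angular_slice \<gamma> (\<lambda>z. f z + g z) \<zeta> \<theta> * cnj (circle_mode k \<theta>) =
     angular_slice \<gamma> f \<zeta> \<theta> * cnj (circle_mode k \<theta>) + angular_slice \<gamma> g \<zeta> \<theta> * cnj (circle_mode k \<theta>)" for \<theta>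
    by (simp add: angular_slice_def algebra_simps)
  then have "complex_of_real (2 * pi) * fibre_coeff \<gamma> (\<lambda>z. f z + g z) k \<zeta> = complex_of_real (2 * pi) * (fibre_coeff \<gamma> f k \<zeta> + fibre_coeff \<gamma> g k \<zeta>)"
    unfolding distrib_left c using i[OF elim(1)] i[OF elim(2)] by simp
  then show ?case by simp
qed

lemma fibre_coeff_diff:
  assumes f: "f \<in> L2 (surface_measure \<gamma>)" and g: "g \<in> L2 (surface_measure \<gamma>)"
  shows "AE \<zeta> in fibre_measure \<gamma>. fibre_coeff \<gamma> (\<lambda>z. f z - g z) k \<zeta> = fibre_coeff \<gamma> f k \<zeta> - fibre_coeff \<gamma> g k \<zeta>"
  using fibre_coeff_add[OF f L2_cmult[OF g, of "-1"], of k] fibre_coeff_cmult[of \<gamma> "-1" g k] by simp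

lemma fibre_coeff_cong_AE:
  assumes f: "f \<in> L2 (surface_measure \<gamma>)" and g: "g \<in> L2 (surface_measure \<gamma>)"
    and eq: "AE z in surface_measure \<gamma>. f z = g z"
  shows "AE \<zeta> in fibre_measure \<gamma>. fibre_coeff \<gamma> f k \<zeta> = fibre_coeff \<gamma> g k \<zeta>"
proof -
  have d: "(\<lambda>z. f z - g z) \<in> L2 (surface_measure \<gamma>)" using f g by (rule L2_diff)
  have "L2_norm (surface_measure \<gamma>) (\<lambda>z. f z - g z) = L2_norm (surface_measure \<gamma>) (\<lambda>z. 0)"
    using eq by (intro L2_norm_cong_AE d) auto
  then have "L2_norm (fibre_measure \<gamma>) (fibre_coeff \<gamma> (\<lambda>z. f z - g z) k) = 0"
    using fibre_coeff_L2(2)[OF d, of k] L2_norm_nonneg[of "fibre_measure \<gamma>" "fibre_coeff \<gamma> (\<lambda>z. f z - g z) k"] by simp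
  from L2_norm_eq_0_AE[OF fibre_coeff_L2(1)[OF d] this] fibre_coeff_diff[OF f g, of k] show ?thesis
    by eventually_elim simp
qed


section \<open>Angular modes\<close>

text \<open>
  The functions \<open>v(s, \<alpha>) e\<^sup>i\<^sup>k\<^sup>\<theta>\<close>, written on the
  hypersurface itself because the terms of the Leray transform are defined there.
\<close>

definition angular_mode :: "nat \<Rightarrow> (real \<times> real \<Rightarrow> complex) \<Rightarrow> complex \<times> complex \<Rightarrow> complex" where
  "angular_mode k v z = cis (real k * Arg2pi (fst z)) * v (Re (snd z), cmod (fst z))"

lemma angular_mode_measurable:
  assumes [measurable]: "v \<in> borel_measurable (borel \<Otimes>\<^sub>M borel)"
  shows "angular_mode k v \<in> borel_measurable (surface_measure \<gamma>)"
proof -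
  have cis_eq: "cis (real k * Arg2pi w) = (if w = 0 then 1 else (w / of_real (cmod w)) ^ k)" for w
  proof (cases "w = 0")
    case False
    have "w = of_real (cmod w) * cis (Arg2pi w)" using Arg2pi_eq[of w] by (simp add: cis_conv_exp)
    then have "w / of_real (cmod w) = cis (Arg2pi w)" using False by (metis nonzero_mult_div_cancel_left norm_eq_zero of_real_eq_0_iff)
    then show ?thesis using False Complex.DeMoivre[of "Arg2pi w" k] by simp
  qed simp
  have "angular_mode k v \<in> borel_measurable (borel \<Otimes>\<^sub>M borel)"
    unfolding angular_mode_def cis_eq by measurable
  then have "angular_mode k v \<in> borel_measurable borel" by (simp add: borel_prod)
  then have "angular_mode k v \<in> borel_measurable (restrict_space borel (hypersurface \<gamma>))" by (rule measurable_restrict_space1)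
  then show ?thesis by (simp add: measurable_cong_sets[OF sets_surface_measure refl])
qed

lemma angular_slice_angular_mode:
  assumes "snd \<zeta> > 0"
  shows "angular_slice \<gamma> (angular_mode k v) \<zeta> \<theta> = v \<zeta> * circle_mode k \<theta>"
proof (cases "\<theta> \<in> {0..<2 * pi}")
  case True
  have "Arg2pi (of_real (snd \<zeta>) * cis \<theta>) = \<theta>"
    by (rule Arg2pi_unique[of "snd \<zeta>"]) (use True assms in \<open>auto simp: cis_conv_exp\<close>)
  then show ?thesis using True assms
    by (simp add: angular_slice_def angular_mode_def surface_point_def surface_params_iff circle_mode_def norm_mult)
next
  case False
  then show ?thesis by (auto simp: angular_slice_support circle_mode_def)
qed

lemma angular_slice_sum: "angular_slice \<gamma> (\<lambda>z. \<Sum>k\<in>I. F k z) \<zeta> \<theta> = (\<Sum>k\<in>I. angular_slice \<gamma> (F k) \<zeta> \<theta>)"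
  by (simp add: angular_slice_def sum_distrib_left)

text \<open>
  Orthogonality of different angular frequencies.
\<close>

lemma energy_angular_mode_sum:
  assumes v: "\<And>k. k \<in> I \<Longrightarrow> v k \<in> borel_measurable (borel \<Otimes>\<^sub>M borel)" and I: "finite I"
  shows "L2_energy (surface_measure \<gamma>) (\<lambda>z. \<Sum>k\<in>I. angular_mode k (v k) z) = (\<Sum>k\<in>I. ennreal (2 * pi) * L2_energy (fibre_measure \<gamma>) (v k))"
proof -
  have "L2_energy (surface_measure \<gamma>) (\<lambda>z. \<Sum>k\<in>I. angular_mode k (v k) z) =
     (\<integral>\<^sup>+\<zeta>. L2_energy lborel (angular_slice \<gamma> (\<lambda>z. \<Sum>k\<in>I. angular_mode k (v k) z) \<zeta>) \<partial>fibre_measure \<gamma>)"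
    by (rule surface_energy) (intro borel_measurable_sum angular_mode_measurable v)
  also have "\<dots> = (\<integral>\<^sup>+\<zeta>. (\<Sum>k\<in>I. ennreal (2 * pi) * ennreal ((cmod (v k \<zeta>))\<^sup>2)) \<partial>fibre_measure \<gamma>)"
  proof (rule nn_integral_cong_AE, use AE_fibre_pos in eventually_elim)
    case (elim \<zeta>)
    have "angular_slice \<gamma> (\<lambda>z. \<Sum>k\<in>I. angular_mode k (v k) z) \<zeta> = (\<lambda>\<theta>. \<Sum>k\<in>I. v k \<zeta> * circle_mode k \<theta>)"
      by (simp add: fun_eq_iff angular_slice_sum angular_slice_angular_mode[OF elim])
    then have "L2_energy lborel (angular_slice \<gamma> (\<lambda>z. \<Sum>k\<in>I. angular_mode k (v k) z) \<zeta>) = ennreal (2 * pi * (\<Sum>k\<in>I. (cmod (v k \<zeta>))\<^sup>2))"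
      using circle_sum_energy[OF I, of "\<lambda>k. v k \<zeta>"] by simp
    then show ?case by (simp add: ennreal_mult'[symmetric] sum_distrib_left)
  qed
  also have "\<dots> = (\<Sum>k\<in>I. ennreal (2 * pi) * L2_energy (fibre_measure \<gamma>) (v k))"
  proof -
    have m: "v k \<in> borel_measurable (fibre_measure \<gamma>)" if "k \<in> I" for k
      using v[OF that] by measurable
    show ?thesis unfolding L2_energy_def using m
      by (subst nn_integral_sum) (auto intro!: sum.cong nn_integral_cmult)
  qed
  finally show ?thesis .
qed

lemma energy_angular_mode:
  assumes "v \<in> borel_measurable (borel \<Otimes>\<^sub>M borel)"
  shows "L2_energy (surface_measure \<gamma>) (angular_mode k v) = ennreal (2 * pi) * L2_energy (fibre_measure \<gamma>) v"
  using energy_angular_mode_sum[of "{k}" "\<lambda>_. v" \<gamma>] assms by simp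

lemma angular_mode_L2:
  assumes v: "v \<in> L2 (fibre_measure \<gamma>)"
  shows "angular_mode k v \<in> L2 (surface_measure \<gamma>)"
    and "L2_norm (surface_measure \<gamma>) (angular_mode k v) = sqrt (2 * pi) * L2_norm (fibre_measure \<gamma>) v"
proof -
  have vm: "v \<in> borel_measurable (borel \<Otimes>\<^sub>M borel)" using v by (rule L2_fibre_measurable)
  have e: "L2_energy (surface_measure \<gamma>) (angular_mode k v) = ennreal ((sqrt (2 * pi) * L2_norm (fibre_measure \<gamma>) v)\<^sup>2)"
    unfolding energy_angular_mode[OF vm] L2_norm_square_energy[OF v, symmetric]
    by (simp add: power_mult_distrib ennreal_mult'[symmetric])
  show L2: "angular_mode k v \<in> L2 (surface_measure \<gamma>)"
    using angular_mode_measurable[OF vm] e by (simp add: L2_iff_energy)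
  have "(L2_norm (surface_measure \<gamma>) (angular_mode k v))\<^sup>2 = (sqrt (2 * pi) * L2_norm (fibre_measure \<gamma>) v)\<^sup>2"
    using L2_norm_square_energy[OF L2] unfolding e by simp
  then show "L2_norm (surface_measure \<gamma>) (angular_mode k v) = sqrt (2 * pi) * L2_norm (fibre_measure \<gamma>) v"
    by (subst (asm) power2_eq_iff_nonneg) auto
qed

text \<open>
  Null sets of the fibre are transported to null sets of the hypersurface by the isometry
  \<open>v \<mapsto> v e\<^sup>i\<^sup>k\<^sup>\<theta>\<close>.
\<close>

lemma angular_mode_cong_AE:
  assumes v: "v \<in> borel_measurable (borel \<Otimes>\<^sub>M borel)" and w: "w \<in> borel_measurable (borel \<Otimes>\<^sub>M borel)"
    and eq: "AE \<zeta> in fibre_measure \<gamma>. v \<zeta> = w \<zeta>"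
  shows "AE z in surface_measure \<gamma>. angular_mode k v z = angular_mode k w z"
proof -
  have [measurable]: "v \<in> borel_measurable (borel \<Otimes>\<^sub>M borel)" "w \<in> borel_measurable (borel \<Otimes>\<^sub>M borel)" by fact+
  have vw: "(\<lambda>\<zeta>. v \<zeta> - w \<zeta>) \<in> borel_measurable (borel \<Otimes>\<^sub>M borel)" by measurable
  have "L2_energy (fibre_measure \<gamma>) (\<lambda>\<zeta>. v \<zeta> - w \<zeta>) = L2_energy (fibre_measure \<gamma>) (\<lambda>\<zeta>. 0)"
    using eq by (intro L2_energy_cong_AE) auto
  then have "L2_energy (surface_measure \<gamma>) (angular_mode k (\<lambda>\<zeta>. v \<zeta> - w \<zeta>)) = 0"
    unfolding energy_angular_mode[OF vw] by (simp add: L2_energy_def)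
  from L2_energy_0_AE[OF angular_mode_measurable[OF vw] this] show ?thesis
    by eventually_elim (simp add: angular_mode_def right_diff_distrib)
qed

lemma fibre_coeff_angular_mode_sum:
  assumes \<zeta>: "snd \<zeta> > 0" and I: "finite I"
  shows "fibre_coeff \<gamma> (\<lambda>z. \<Sum>j\<in>I. angular_mode j (v j) z) k \<zeta> = (if k \<in> I then v k \<zeta> else 0)"
proof -
  have slice: "angular_slice \<gamma> (\<lambda>z. \<Sum>j\<in>I. angular_mode j (v j) z) \<zeta> = (\<lambda>\<theta>. \<Sum>j\<in>I. v j \<zeta> * circle_mode j \<theta>)"
    by (simp add: fun_eq_iff angular_slice_sum angular_slice_angular_mode[OF \<zeta>])
  have "complex_of_real (2 * pi) * fibre_coeff \<gamma> (\<lambda>z. \<Sum>j\<in>I. angular_mode j (v j) z) k \<zeta> =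
      (\<integral>\<theta>. angular_slice \<gamma> (\<lambda>z. \<Sum>j\<in>I. angular_mode j (v j) z) \<zeta> \<theta> * cnj (circle_mode k \<theta>) \<partial>lborel)"
    unfolding fibre_coeff_def by (rule circle_coeff_inner[symmetric, OF angular_slice_support])
  also have "\<dots> = (if k \<in> I then complex_of_real (2 * pi) * v k \<zeta> else 0)"
    unfolding slice by (rule circle_sum_inner[OF I])
  finally have "complex_of_real (2 * pi) * fibre_coeff \<gamma> (\<lambda>z. \<Sum>j\<in>I. angular_mode j (v j) z) k \<zeta> = (if k \<in> I then complex_of_real (2 * pi) * v k \<zeta> else 0)" .
  then show ?thesis by (auto split: if_splits)
qed

lemma fibre_coeff_angular_mode:
  assumes "snd \<zeta> > 0"
  shows "fibre_coeff \<gamma> (angular_mode j v) k \<zeta> = (if k = j then v \<zeta> else 0)"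
  using fibre_coeff_angular_mode_sum[OF assms, of "{j}" \<gamma> "\<lambda>_. v" k] by simp


section \<open>The Leray transform\<close>

text \<open>
  The iterated integral of the definition of the Leray transform. It agrees with
  \<open>T\<^sub>k\<close> applied to the Fourier coefficient where \<open>\<alpha> >
  0\<close>; the terms of the transform are given by the iterated integral at every point.
\<close>

definition leray_fibre :: "real \<Rightarrow> (complex \<times> complex \<Rightarrow> complex) \<Rightarrow> nat \<Rightarrow> real \<times> real \<Rightarrow> complex" where
  "leray_fibre \<gamma> f k z = (LINT \<alpha>:{0<..}|lborel. LINT s|lborel.
      leray_kernel \<gamma> k z (s, \<alpha>) * fibre_coeff \<gamma> f k (s, \<alpha>) * of_real (\<alpha> powr (\<gamma> - 1)))"

lemma leray_term_eq: "leray_term \<gamma> f k = angular_mode k (leray_fibre \<gamma> f k)"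
proof
  fix z
  define c where "c = complex_of_real (\<gamma>\<^sup>2 * (real k + 1) / (2 * pi))"
  define w where "w = (Re (snd z), cmod (fst z))"
  let ?K = "\<lambda>s \<alpha>. of_real (leray_B \<gamma> (snd w) \<alpha>) ^ k / leray_A \<gamma> (fst w) (snd w) s \<alpha> ^ (k + 2)"
  have "leray_fibre \<gamma> f k w = (LINT \<alpha>:{0<..}|lborel. c * (LINT s|lborel. ?K s \<alpha> * fourier_coeff \<gamma> f (int k) s \<alpha> * of_real (\<alpha> powr (\<gamma> - 1))))"
    unfolding leray_fibre_def set_lebesgue_integral_def
  proof (intro Bochner_Integration.integral_cong refl)
    fix \<alpha> :: real
    show "indicat_real {0<..} \<alpha> *\<^sub>R (LINT s|lborel. leray_kernel \<gamma> k w (s, \<alpha>) * fibre_coeff \<gamma> f k (s, \<alpha>) * of_real (\<alpha> powr (\<gamma> - 1))) =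
       indicat_real {0<..} \<alpha> *\<^sub>R (c * (LINT s|lborel. ?K s \<alpha> * fourier_coeff \<gamma> f (int k) s \<alpha> * of_real (\<alpha> powr (\<gamma> - 1))))"
    proof (cases "\<alpha> > 0")
      case True
      have "leray_kernel \<gamma> k w (s, \<alpha>) * fibre_coeff \<gamma> f k (s, \<alpha>) * of_real (\<alpha> powr (\<gamma> - 1)) =
          c * (?K s \<alpha> * fourier_coeff \<gamma> f (int k) s \<alpha> * of_real (\<alpha> powr (\<gamma> - 1)))" for s
        using fourier_coeff_eq_fibre_coeff[of "(s, \<alpha>)" \<gamma> f k] True
        by (simp only: leray_kernel_def c_def fst_conv snd_conv mult.assoc)
      then show ?thesis by (simp only: integral_mult_right_zero)
    qed simp
  qed
  also have "\<dots> = c * (LINT \<alpha>:{0<..}|lborel. (LINT s|lborel. ?K s \<alpha> * fourier_coeff \<gamma> f (int k) s \<alpha> * of_real (\<alpha> powr (\<gamma> - 1))))"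
    by (rule set_integral_mult_right)
  finally show "leray_term \<gamma> f k z = angular_mode k (leray_fibre \<gamma> f k) z"
    unfolding leray_term_def angular_mode_def Let_def w_def[symmetric]
    by (simp only: c_def w_def fst_conv snd_conv mult.assoc)
qed

lemma leray_fibre_measurable:
  assumes f: "f \<in> borel_measurable (surface_measure \<gamma>)"
  shows "leray_fibre \<gamma> f k \<in> borel_measurable (borel \<Otimes>\<^sub>M borel)"
proof -
  note [measurable] = fibre_coeff_measurable[OF f]
  let ?h = "\<lambda>z \<alpha> s. leray_kernel \<gamma> k z (s, \<alpha>) * fibre_coeff \<gamma> f k (s, \<alpha>) * complex_of_real (\<alpha> powr (\<gamma> - 1))"
  have "(\<lambda>p. ?h (fst (fst p)) (snd (fst p)) (snd p)) \<in> borel_measurable (((borel \<Otimes>\<^sub>M borel) \<Otimes>\<^sub>M borel) \<Otimes>\<^sub>M lborel)"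
    by measurable
  then have [measurable]: "(\<lambda>q. \<integral>s. ?h (fst q) (snd q) s \<partial>lborel) \<in> borel_measurable ((borel \<Otimes>\<^sub>M borel) \<Otimes>\<^sub>M borel)"
    by (intro lborel.borel_measurable_lebesgue_integral) (simp add: split_beta')
  have "(\<lambda>q. indicator {0<..} (snd q) *\<^sub>R (\<integral>s. ?h (fst q) (snd q) s \<partial>lborel)) \<in> borel_measurable ((borel \<Otimes>\<^sub>M borel) \<Otimes>\<^sub>M lborel)"
    by measurable
  then have "(\<lambda>z. \<integral>\<alpha>. indicator {0<..} \<alpha> *\<^sub>R (\<integral>s. ?h z \<alpha> s \<partial>lborel) \<partial>lborel) \<in> borel_measurable (borel \<Otimes>\<^sub>M borel)"
    by (intro lborel.borel_measurable_lebesgue_integral) (simp add: split_beta')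
  then show ?thesis unfolding leray_fibre_def[abs_def] set_lebesgue_integral_def .
qed

lemma leray_fibre_eq_mode:
  assumes g: "\<gamma> > 1" and f: "f \<in> L2 (surface_measure \<gamma>)" and z: "snd z > 0"
  shows "leray_fibre \<gamma> f k z = leray_mode \<gamma> k (fibre_coeff \<gamma> f k) z"
proof -
  interpret pair_sigma_finite lborel "radial_measure \<gamma>" by (rule pair_sigma_finite_fibre)
  have fm: "f \<in> borel_measurable (surface_measure \<gamma>)" using f by (simp add: L2_def)
  note [measurable] = fibre_coeff_measurable[OF fm]
  let ?h = "\<lambda>s \<alpha>. leray_kernel \<gamma> k z (s, \<alpha>) * fibre_coeff \<gamma> f k (s, \<alpha>)"
  have i: "integrable (fibre_measure \<gamma>) (case_prod ?h)"
    using leray_mode_integrable[OF g z fibre_coeff_L2(1)[OF f], of k k] by (simp add: split_beta')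
  have "leray_mode \<gamma> k (fibre_coeff \<gamma> f k) z = (\<integral>\<alpha>. (\<integral>s. ?h s \<alpha> \<partial>lborel) \<partial>radial_measure \<gamma>)"
    unfolding leray_mode_def using integral_snd[OF i] by (simp add: split_beta')
  also have "\<dots> = (\<integral>\<alpha>. (indicator {0<..} \<alpha> * \<alpha> powr (\<gamma> - 1)) *\<^sub>R (\<integral>s. ?h s \<alpha> \<partial>lborel) \<partial>lborel)"
    unfolding radial_measure_def by (rule integral_density) (measurable, auto simp: space_pair_measure)
  also have "\<dots> = leray_fibre \<gamma> f k z"
    unfolding leray_fibre_def set_lebesgue_integral_def
    by (intro Bochner_Integration.integral_cong refl) (simp add: scaleR_conv_of_real mult_ac)
  finally show ?thesis ..
qed

lemma leray_fibre_L2: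
  assumes g: "\<gamma> > 1" and f: "f \<in> L2 (surface_measure \<gamma>)"
  shows "AE z in fibre_measure \<gamma>. leray_fibre \<gamma> f k z = leray_mode \<gamma> k (fibre_coeff \<gamma> f k) z"
    and "leray_fibre \<gamma> f k \<in> L2 (fibre_measure \<gamma>)"
    and "L2_energy (fibre_measure \<gamma>) (leray_fibre \<gamma> f k) \<le> ennreal (\<gamma>\<^sup>2 / (4 * (\<gamma> - 1))) * L2_energy (fibre_measure \<gamma>) (fibre_coeff \<gamma> f k)"
proof -
  have fm: "f \<in> borel_measurable (surface_measure \<gamma>)" using f by (simp add: L2_def)
  note [measurable] = leray_fibre_measurable[OF fm]
  show ae: "AE z in fibre_measure \<gamma>. leray_fibre \<gamma> f k z = leray_mode \<gamma> k (fibre_coeff \<gamma> f k) z"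
    using AE_fibre_pos by eventually_elim (rule leray_fibre_eq_mode[OF g f])
  have e: "L2_energy (fibre_measure \<gamma>) (leray_fibre \<gamma> f k) = L2_energy (fibre_measure \<gamma>) (leray_mode \<gamma> k (fibre_coeff \<gamma> f k))"
    by (rule L2_energy_cong_AE[OF ae])
  show "L2_energy (fibre_measure \<gamma>) (leray_fibre \<gamma> f k) \<le> ennreal (\<gamma>\<^sup>2 / (4 * (\<gamma> - 1))) * L2_energy (fibre_measure \<gamma>) (fibre_coeff \<gamma> f k)"
    unfolding e by (rule leray_mode_bounded(1)[OF g fibre_coeff_L2(1)[OF f]])
  have "leray_fibre \<gamma> f k \<in> borel_measurable (fibre_measure \<gamma>)" by measurable
  then show "leray_fibre \<gamma> f k \<in> L2 (fibre_measure \<gamma>)"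
    using leray_mode_bounded(2)[OF g fibre_coeff_L2(1)[OF f, of k], of k] e by (simp add: L2_iff_energy)
qed

lemma leray_term_L2:
  assumes "\<gamma> > 1" "f \<in> L2 (surface_measure \<gamma>)"
  shows "leray_term \<gamma> f k \<in> L2 (surface_measure \<gamma>)"
  unfolding leray_term_eq by (intro angular_mode_L2 leray_fibre_L2 assms)

lemma leray_term_sum_norm_le:
  assumes g: "\<gamma> > 1" and f: "f \<in> L2 (surface_measure \<gamma>)" and I: "finite I"
  shows "(L2_norm (surface_measure \<gamma>) (\<lambda>z. \<Sum>k\<in>I. leray_term \<gamma> f k z))\<^sup>2 \<le>
     \<gamma>\<^sup>2 / (4 * (\<gamma> - 1)) * (\<Sum>k\<in>I. 2 * pi * (L2_norm (fibre_measure \<gamma>) (fibre_coeff \<gamma> f k))\<^sup>2)"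
proof -
  have fm: "f \<in> borel_measurable (surface_measure \<gamma>)" using f by (simp add: L2_def)
  define Q where "Q = \<gamma>\<^sup>2 / (4 * (\<gamma> - 1))"
  have Q: "Q \<ge> 0" using g by (simp add: Q_def)
  have "ennreal ((L2_norm (surface_measure \<gamma>) (\<lambda>z. \<Sum>k\<in>I. leray_term \<gamma> f k z))\<^sup>2) = (\<Sum>k\<in>I. ennreal (2 * pi) * L2_energy (fibre_measure \<gamma>) (leray_fibre \<gamma> f k))"
    using L2_sum[of I "leray_term \<gamma> f", OF leray_term_L2[OF g f]]
    by (subst L2_norm_square_energy) (auto simp: leray_term_eq intro!: energy_angular_mode_sum leray_fibre_measurable fm I)
  also have "\<dots> \<le> (\<Sum>k\<in>I. ennreal (2 * pi) * (ennreal Q * L2_energy (fibre_measure \<gamma>) (fibre_coeff \<gamma> f k)))"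
    unfolding Q_def by (intro sum_mono mult_left_mono leray_fibre_L2(3)[OF g f]) simp
  also have "\<dots> = (\<Sum>k\<in>I. ennreal (2 * pi * (Q * (L2_norm (fibre_measure \<gamma>) (fibre_coeff \<gamma> f k))\<^sup>2)))"
    using Q by (simp add: L2_norm_square_energy[OF fibre_coeff_L2(1)[OF f], symmetric] ennreal_mult)
  also have "\<dots> = ennreal (Q * (\<Sum>k\<in>I. 2 * pi * (L2_norm (fibre_measure \<gamma>) (fibre_coeff \<gamma> f k))\<^sup>2))"
    using Q by (subst sum_ennreal) (auto simp: sum_distrib_left mult_ac)
  finally show ?thesis unfolding Q_def[symmetric]
    using Q by (subst (asm) ennreal_le_iff) (auto intro!: mult_nonneg_nonneg sum_nonneg)
qed

lemma fibre_coeff_Bessel_real: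
  assumes f: "f \<in> L2 (surface_measure \<gamma>)" and I: "finite I"
  shows "(\<Sum>k\<in>I. 2 * pi * (L2_norm (fibre_measure \<gamma>) (fibre_coeff \<gamma> f k))\<^sup>2) \<le> (L2_norm (surface_measure \<gamma>) f)\<^sup>2"
proof -
  have fm: "f \<in> borel_measurable (surface_measure \<gamma>)" using f by (simp add: L2_def)
  have "ennreal (\<Sum>k\<in>I. 2 * pi * (L2_norm (fibre_measure \<gamma>) (fibre_coeff \<gamma> f k))\<^sup>2) \<le> ennreal ((L2_norm (surface_measure \<gamma>) f)\<^sup>2)"
    using fibre_coeff_Bessel[OF fm I]
    by (simp add: L2_norm_square_energy[OF fibre_coeff_L2(1)[OF f], symmetric] L2_norm_square_energy[OF f, symmetric]
        ennreal_mult[symmetric] sum_ennreal)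
  then show ?thesis by (subst (asm) ennreal_le_iff) auto
qed

lemma leray_term_partial_norm_le:
  assumes g: "\<gamma> > 1" and f: "f \<in> L2 (surface_measure \<gamma>)"
  shows "L2_norm (surface_measure \<gamma>) (\<lambda>z. \<Sum>k<n. leray_term \<gamma> f k z) \<le> \<gamma> / (2 * sqrt (\<gamma> - 1)) * L2_norm (surface_measure \<gamma>) f"
proof (rule power2_le_imp_le)
  have "(L2_norm (surface_measure \<gamma>) (\<lambda>z. \<Sum>k<n. leray_term \<gamma> f k z))\<^sup>2 \<le> \<gamma>\<^sup>2 / (4 * (\<gamma> - 1)) * (\<Sum>k<n. 2 * pi * (L2_norm (fibre_measure \<gamma>) (fibre_coeff \<gamma> f k))\<^sup>2)"
    by (rule leray_term_sum_norm_le[OF g f]) simp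
  also have "\<dots> \<le> \<gamma>\<^sup>2 / (4 * (\<gamma> - 1)) * (L2_norm (surface_measure \<gamma>) f)\<^sup>2"
    using g by (intro mult_left_mono fibre_coeff_Bessel_real f) auto
  also have "\<dots> = (\<gamma> / (2 * sqrt (\<gamma> - 1)) * L2_norm (surface_measure \<gamma>) f)\<^sup>2"
    using g by (simp add: power_mult_distrib power_divide)
  finally show "(L2_norm (surface_measure \<gamma>) (\<lambda>z. \<Sum>k<n. leray_term \<gamma> f k z))\<^sup>2 \<le> (\<gamma> / (2 * sqrt (\<gamma> - 1)) * L2_norm (surface_measure \<gamma>) f)\<^sup>2" .
qed (use g in simp)

text \<open>
  The terms are orthogonal and their squared norms are dominated by those of the Fourier
  coefficients, which are summable by Bessel; hence the partial sums form a Cauchy sequence.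
\<close>

lemma leray_series_converges:
  assumes g: "\<gamma> > 1" and f: "f \<in> L2 (surface_measure \<gamma>)"
  shows "\<exists>h. L2_sums (surface_measure \<gamma>) (leray_term \<gamma> f) h"
proof -
  let ?M = "surface_measure \<gamma>"
  define Q where "Q = \<gamma>\<^sup>2 / (4 * (\<gamma> - 1))"
  have Q: "Q > 0" using g by (simp add: Q_def)
  define b where "b k = 2 * pi * (L2_norm (fibre_measure \<gamma>) (fibre_coeff \<gamma> f k))\<^sup>2" for k
  have b: "summable b"
    by (rule summableI_nonneg_bounded[where x="(L2_norm ?M f)\<^sup>2"])
       (auto simp: b_def intro: fibre_coeff_Bessel_real f)
  let ?S = "\<lambda>n z. \<Sum>k<n. leray_term \<gamma> f k z"
  have S: "?S n \<in> L2 ?M" for n by (intro L2_sum leray_term_L2 g f)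
  have diff: "(L2_norm ?M (\<lambda>z. ?S n z - ?S m z))\<^sup>2 \<le> Q * sum b {m..<n}" if "m \<le> n" for m n
  proof -
    have "?S n z - ?S m z = (\<Sum>k\<in>{m..<n}. leray_term \<gamma> f k z)" for z
      using that by (simp add: lessThan_atLeast0 sum_diff_nat_ivl)
    then show ?thesis using leray_term_sum_norm_le[OF g f, of "{m..<n}"] by (simp add: Q_def b_def)
  qed
  have "\<exists>N. \<forall>m\<ge>N. \<forall>n\<ge>N. L2_norm ?M (\<lambda>z. ?S m z - ?S n z) \<le> e" if e: "e > 0" for e :: real
  proof -
    have "e\<^sup>2 / Q > 0" using e Q by simp
    then obtain N where N: "\<And>m n. m \<ge> N \<Longrightarrow> norm (sum b {m..<n}) < e\<^sup>2 / Q"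
      using b unfolding summable_Cauchy by meson
    have le: "L2_norm ?M (\<lambda>z. ?S n z - ?S m z) \<le> e" if "m \<ge> N" "m \<le> n" for m n
    proof (rule power2_le_imp_le)
      have "(L2_norm ?M (\<lambda>z. ?S n z - ?S m z))\<^sup>2 \<le> Q * sum b {m..<n}" by (rule diff[OF that(2)])
      also have "\<dots> \<le> Q * (e\<^sup>2 / Q)" using N[OF that(1), of n] Q by (intro mult_left_mono) auto
      also have "\<dots> = e\<^sup>2" using Q by simp
      finally show "(L2_norm ?M (\<lambda>z. ?S n z - ?S m z))\<^sup>2 \<le> e\<^sup>2" .
    qed (use e in simp)
    show ?thesis
    proof (intro exI[of _ N] allI impI)
      fix m n assume "m \<ge> N" "n \<ge> N"
      then show "L2_norm ?M (\<lambda>z. ?S m z - ?S n z) \<le> e"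
        using le[of m n] le[of n m] L2_norm_diff_commute[of ?M "?S m" "?S n"] by (cases "m \<le> n") auto
    qed
  qed
  from L2_complete[of ?S, OF S this] obtain h where "h \<in> L2 ?M" "(\<lambda>n. L2_norm ?M (\<lambda>z. ?S n z - h z)) \<longlonglongrightarrow> 0"
    by blast
  then show ?thesis using leray_term_L2[OF g f] by (auto simp: L2_sums_def)
qed

lemma leray_transform_sums:
  assumes "\<gamma> > 1" "f \<in> L2 (surface_measure \<gamma>)"
  shows "L2_sums (surface_measure \<gamma>) (leray_term \<gamma> f) (leray_transform \<gamma> f)"
  using leray_series_converges[OF assms] unfolding leray_transform_def by (blast intro: L2_sums_suminf)

lemma leray_transform_L2:
  assumes "\<gamma> > 1" "f \<in> L2 (surface_measure \<gamma>)"
  shows "leray_transform \<gamma> f \<in> L2 (surface_measure \<gamma>)"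
  using leray_transform_sums[OF assms] by (simp add: L2_sums_def)

lemma leray_transform_norm_le:
  assumes "\<gamma> > 1" "f \<in> L2 (surface_measure \<gamma>)"
  shows "L2_norm (surface_measure \<gamma>) (leray_transform \<gamma> f) \<le> \<gamma> / (2 * sqrt (\<gamma> - 1)) * L2_norm (surface_measure \<gamma>) f"
  by (rule L2_sums_norm_le[OF leray_transform_sums[OF assms] leray_term_partial_norm_le[OF assms]])

lemma leray_term_AE_eqI:
  assumes g: "\<gamma> > 1" and f: "f \<in> L2 (surface_measure \<gamma>)" and v: "v \<in> borel_measurable (borel \<Otimes>\<^sub>M borel)"
    and eq: "\<And>z. snd z > 0 \<Longrightarrow> leray_mode \<gamma> k (fibre_coeff \<gamma> f k) z = v z"
  shows "AE z in surface_measure \<gamma>. leray_term \<gamma> f k z = angular_mode k v z"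
  unfolding leray_term_eq
proof (rule angular_mode_cong_AE[OF leray_fibre_measurable v])
  show "f \<in> borel_measurable (surface_measure \<gamma>)" using f by (simp add: L2_def)
  show "AE z in fibre_measure \<gamma>. leray_fibre \<gamma> f k z = v z"
    using AE_fibre_pos by eventually_elim (simp add: leray_fibre_eq_mode[OF g f] eq)
qed

lemma leray_transform_AE_eqI:
  assumes g: "\<gamma> > 1" and f: "f \<in> L2 (surface_measure \<gamma>)"
    and h: "L2_sums (surface_measure \<gamma>) F h" and eq: "\<And>k. AE z in surface_measure \<gamma>. F k z = leray_term \<gamma> f k z"
  shows "AE z in surface_measure \<gamma>. leray_transform \<gamma> f z = h z"
  by (rule L2_sums_unique[OF leray_transform_sums[OF g f] L2_sums_cong_AE[OF h leray_term_L2[OF g f] eq]])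

text \<open>
  The transform depends on \<open>f\<close> only through the functions \<open>T\<^sub>k
  f\<^sub>k\<close>.
\<close>

lemma leray_transform_cong_AE:
  assumes g: "\<gamma> > 1" and f: "f \<in> L2 (surface_measure \<gamma>)" and f': "f' \<in> L2 (surface_measure \<gamma>)"
    and eq: "\<And>k z. snd z > 0 \<Longrightarrow> leray_mode \<gamma> k (fibre_coeff \<gamma> f k) z = leray_mode \<gamma> k (fibre_coeff \<gamma> f' k) z"
  shows "AE z in surface_measure \<gamma>. leray_transform \<gamma> f z = leray_transform \<gamma> f' z"
proof (rule leray_transform_AE_eqI[OF g f leray_transform_sums[OF g f']])
  fix k
  have f'm: "f' \<in> borel_measurable (surface_measure \<gamma>)" using f' by (simp add: L2_def)
  have "AE z in surface_measure \<gamma>. leray_term \<gamma> f k z = angular_mode k (leray_fibre \<gamma> f' k) z"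
    by (rule leray_term_AE_eqI[OF g f leray_fibre_measurable[OF f'm]]) (simp add: eq leray_fibre_eq_mode[OF g f'])
  then show "AE z in surface_measure \<gamma>. leray_term \<gamma> f' k z = leray_term \<gamma> f k z"
    by eventually_elim (simp add: leray_term_eq[of \<gamma> f'])
qed

lemma leray_transform_add:
  assumes g: "\<gamma> > 1" and f: "f \<in> L2 (surface_measure \<gamma>)" and h: "h \<in> L2 (surface_measure \<gamma>)"
  shows "AE z in surface_measure \<gamma>. leray_transform \<gamma> (\<lambda>y. f y + h y) z = leray_transform \<gamma> f z + leray_transform \<gamma> h z"
proof (rule leray_transform_AE_eqI[OF g L2_add[OF f h] L2_sums_add[OF leray_transform_sums[OF g f] leray_transform_sums[OF g h]]])
  fix k
  let ?N = "fibre_measure \<gamma>"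
  have fh: "(\<lambda>y. f y + h y) \<in> L2 (surface_measure \<gamma>)" using f h by (rule L2_add)
  have m: "f \<in> borel_measurable (surface_measure \<gamma>)" "h \<in> borel_measurable (surface_measure \<gamma>)" "(\<lambda>y. f y + h y) \<in> borel_measurable (surface_measure \<gamma>)"
    using f h fh by (auto simp: L2_def)
  note [measurable] = fibre_coeff_measurable[OF m(1)] fibre_coeff_measurable[OF m(2)] fibre_coeff_measurable[OF m(3)]
     leray_fibre_measurable[OF m(1)] leray_fibre_measurable[OF m(2)]
  have "AE z in surface_measure \<gamma>. leray_term \<gamma> (\<lambda>y. f y + h y) k z = angular_mode k (\<lambda>z. leray_fibre \<gamma> f k z + leray_fibre \<gamma> h k z) z"
  proof (rule leray_term_AE_eqI[OF g fh])
    fix z :: "real \<times> real" assume z: "snd z > 0"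
    have "leray_mode \<gamma> k (fibre_coeff \<gamma> (\<lambda>y. f y + h y) k) z = leray_mode \<gamma> k (\<lambda>\<zeta>. fibre_coeff \<gamma> f k \<zeta> + fibre_coeff \<gamma> h k \<zeta>) z"
      by (rule leray_mode_cong_AE[OF _ _ fibre_coeff_add[OF f h]]) measurable
    also have "\<dots> = leray_mode \<gamma> k (fibre_coeff \<gamma> f k) z + leray_mode \<gamma> k (fibre_coeff \<gamma> h k) z"
      by (rule leray_mode_add[OF g z fibre_coeff_L2(1)[OF f] fibre_coeff_L2(1)[OF h]])
    finally show "leray_mode \<gamma> k (fibre_coeff \<gamma> (\<lambda>y. f y + h y) k) z = leray_fibre \<gamma> f k z + leray_fibre \<gamma> h k z"
      using z by (simp add: leray_fibre_eq_mode[OF g f] leray_fibre_eq_mode[OF g h])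
  qed measurable
  then show "AE z in surface_measure \<gamma>. leray_term \<gamma> f k z + leray_term \<gamma> h k z = leray_term \<gamma> (\<lambda>y. f y + h y) k z"
    by eventually_elim (simp add: leray_term_eq[of \<gamma> f] leray_term_eq[of \<gamma> h] angular_mode_def distrib_left)
qed

lemma leray_transform_cmult:
  assumes g: "\<gamma> > 1" and f: "f \<in> L2 (surface_measure \<gamma>)"
  shows "AE z in surface_measure \<gamma>. leray_transform \<gamma> (\<lambda>y. c * f y) z = c * leray_transform \<gamma> f z"
proof (rule leray_transform_AE_eqI[OF g L2_cmult[OF f] L2_sums_cmult[OF leray_transform_sums[OF g f]]])
  fix k
  have m: "f \<in> borel_measurable (surface_measure \<gamma>)" using f by (simp add: L2_def)
  note [measurable] = leray_fibre_measurable[OF m]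
  have "AE z in surface_measure \<gamma>. leray_term \<gamma> (\<lambda>y. c * f y) k z = angular_mode k (\<lambda>z. c * leray_fibre \<gamma> f k z) z"
  proof (rule leray_term_AE_eqI[OF g L2_cmult[OF f]])
    fix z :: "real \<times> real" assume z: "snd z > 0"
    show "leray_mode \<gamma> k (fibre_coeff \<gamma> (\<lambda>y. c * f y) k) z = c * leray_fibre \<gamma> f k z"
      unfolding fibre_coeff_cmult[abs_def] leray_mode_cmult leray_fibre_eq_mode[OF g f z] ..
  qed measurable
  then show "AE z in surface_measure \<gamma>. c * leray_term \<gamma> f k z = leray_term \<gamma> (\<lambda>y. c * f y) k z"
    by eventually_elim (simp add: leray_term_eq[of \<gamma> f] angular_mode_def)
qed

text \<open>
  Taking a Fourier coefficient is continuous in L2, and the partial sums of the transform have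
  the right coefficient as soon as they contain the \<open>k\<close>-th term.
\<close>

lemma fibre_coeff_leray_transform:
  assumes g: "\<gamma> > 1" and f: "f \<in> L2 (surface_measure \<gamma>)"
  shows "AE \<zeta> in fibre_measure \<gamma>. fibre_coeff \<gamma> (leray_transform \<gamma> f) k \<zeta> = leray_mode \<gamma> k (fibre_coeff \<gamma> f k) \<zeta>"
proof -
  let ?N = "fibre_measure \<gamma>" and ?M = "surface_measure \<gamma>" and ?L = "leray_transform \<gamma> f"
  let ?S = "\<lambda>n z. \<Sum>j<n. leray_term \<gamma> f j z"
  have L: "?L \<in> L2 ?M" by (rule leray_transform_L2[OF g f])
  have S: "?S n \<in> L2 ?M" for n by (intro L2_sum leray_term_L2 g f)
  have lim: "(\<lambda>n. L2_norm ?M (\<lambda>z. ?S n z - ?L z)) \<longlonglongrightarrow> 0"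
    using leray_transform_sums[OF g f] by (simp add: L2_sums_def)
  have d: "(\<lambda>\<zeta>. leray_fibre \<gamma> f k \<zeta> - fibre_coeff \<gamma> ?L k \<zeta>) \<in> L2 ?N"
    by (intro L2_diff leray_fibre_L2(2)[OF g f] fibre_coeff_L2(1)[OF L])
  have "L2_norm ?N (\<lambda>\<zeta>. leray_fibre \<gamma> f k \<zeta> - fibre_coeff \<gamma> ?L k \<zeta>) \<le> L2_norm ?M (\<lambda>z. ?S n z - ?L z)" if "n > k" for n
  proof -
    have SL: "(\<lambda>z. ?S n z - ?L z) \<in> L2 ?M" by (rule L2_diff[OF S L])
    have "L2_norm ?N (\<lambda>\<zeta>. leray_fibre \<gamma> f k \<zeta> - fibre_coeff \<gamma> ?L k \<zeta>) = L2_norm ?N (fibre_coeff \<gamma> (\<lambda>z. ?S n z - ?L z) k)"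
    proof (rule L2_norm_cong_AE[OF d fibre_coeff_L2(1)[OF SL]])
      show "AE \<zeta> in ?N. leray_fibre \<gamma> f k \<zeta> - fibre_coeff \<gamma> ?L k \<zeta> = fibre_coeff \<gamma> (\<lambda>z. ?S n z - ?L z) k \<zeta>"
        using fibre_coeff_diff[OF S[of n] L, of k] AE_fibre_pos
      proof eventually_elim
        case (elim \<zeta>)
        have "fibre_coeff \<gamma> (?S n) k \<zeta> = leray_fibre \<gamma> f k \<zeta>"
          unfolding leray_term_eq using fibre_coeff_angular_mode_sum[OF elim(2), of "{..<n}" \<gamma> "leray_fibre \<gamma> f" k] that by simp
        then show ?case using elim(1) by simp
      qed
    qed
    also have "\<dots> \<le> L2_norm ?M (\<lambda>z. ?S n z - ?L z)" by (rule fibre_coeff_L2(2)[OF SL])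
    finally show ?thesis .
  qed
  then have "L2_norm ?N (\<lambda>\<zeta>. leray_fibre \<gamma> f k \<zeta> - fibre_coeff \<gamma> ?L k \<zeta>) \<le> 0"
    by (intro LIMSEQ_le_const[OF lim] exI[of _ "Suc k"]) auto
  then have "L2_norm ?N (\<lambda>\<zeta>. leray_fibre \<gamma> f k \<zeta> - fibre_coeff \<gamma> ?L k \<zeta>) = 0"
    using L2_norm_nonneg[of ?N "\<lambda>\<zeta>. leray_fibre \<gamma> f k \<zeta> - fibre_coeff \<gamma> ?L k \<zeta>"] by linarith
  from L2_norm_eq_0_AE[OF d this] leray_fibre_L2(1)[OF g f, of k] show ?thesis
    by eventually_elim simp
qed

text \<open>
  By the preceding lemma the transform of the transform is built from \<open>T\<^sub>k
  T\<^sub>k f\<^sub>k = T\<^sub>k f\<^sub>k\<close>.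
\<close>

lemma leray_transform_idempotent:
  assumes g: "\<gamma> > 1" and f: "f \<in> L2 (surface_measure \<gamma>)"
  shows "AE z in surface_measure \<gamma>. leray_transform \<gamma> (leray_transform \<gamma> f) z = leray_transform \<gamma> f z"
proof (rule leray_transform_cong_AE[OF g leray_transform_L2[OF g f] f])
  fix k and z :: "real \<times> real" assume z: "snd z > 0"
  have m: "f \<in> borel_measurable (surface_measure \<gamma>)" "leray_transform \<gamma> f \<in> borel_measurable (surface_measure \<gamma>)"
    using f leray_transform_L2[OF g f] by (auto simp: L2_def)
  note [measurable] = fibre_coeff_measurable[OF m(1)] fibre_coeff_measurable[OF m(2)]
  have "leray_mode \<gamma> k (fibre_coeff \<gamma> (leray_transform \<gamma> f) k) z = leray_mode \<gamma> k (leray_mode \<gamma> k (fibre_coeff \<gamma> f k)) z"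
    by (rule leray_mode_cong_AE[OF _ _ fibre_coeff_leray_transform[OF g f]]) measurable
  also have "\<dots> = leray_mode \<gamma> k (fibre_coeff \<gamma> f k) z"
    by (rule leray_mode_idempotent[OF g fibre_coeff_L2(1)[OF f] z])
  finally show "leray_mode \<gamma> k (fibre_coeff \<gamma> (leray_transform \<gamma> f) k) z = leray_mode \<gamma> k (fibre_coeff \<gamma> f k) z" .
qed

text \<open>
  On functions that do not depend on the angle the transform is \<open>T\<^sub>0\<close>.
\<close>

lemma leray_transform_angular_mode_0:
  assumes g: "\<gamma> > 1" and u: "u \<in> L2 (fibre_measure \<gamma>)"
  shows "AE z in surface_measure \<gamma>. leray_transform \<gamma> (angular_mode 0 u) z = angular_mode 0 (leray_mode \<gamma> 0 u) z"
proof (rule leray_transform_AE_eqI[OF g angular_mode_L2(1)[OF u]])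
  let ?M = "surface_measure \<gamma>" and ?f = "angular_mode 0 u"
  define F where "F k = (if k = 0 then angular_mode 0 (leray_mode \<gamma> 0 u) else (\<lambda>z. 0))" for k :: nat
  have um: "u \<in> borel_measurable (borel \<Otimes>\<^sub>M borel)" using u by (rule L2_fibre_measurable)
  have f: "?f \<in> L2 ?M" by (rule angular_mode_L2(1)[OF u])
  have F0: "angular_mode 0 (leray_mode \<gamma> 0 u) \<in> L2 ?M" by (rule angular_mode_L2(1)[OF leray_mode_bounded(2)[OF g u]])
  have sum: "(\<Sum>k<n. F k z) = angular_mode 0 (leray_mode \<gamma> 0 u) z" if "n > 0" for n z
  proof -
    have "(\<Sum>k<n. F k z) = (\<Sum>k\<in>{..<n}. if 0 = k then angular_mode 0 (leray_mode \<gamma> 0 u) z else 0)"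
      by (intro sum.cong) (auto simp: F_def)
    then show ?thesis using that by (simp only: sum.delta finite_lessThan) simp
  qed
  show "L2_sums ?M F (angular_mode 0 (leray_mode \<gamma> 0 u))"
    unfolding L2_sums_def
  proof (intro conjI allI)
    show "F k \<in> L2 ?M" for k using F0 by (simp add: F_def)
    show "(\<lambda>n. L2_norm ?M (\<lambda>z. (\<Sum>k<n. F k z) - angular_mode 0 (leray_mode \<gamma> 0 u) z)) \<longlonglongrightarrow> 0"
      by (rule tendsto_eventually, rule eventually_mono[OF eventually_gt_at_top[of 0]]) (simp add: sum)
  qed (rule F0)
  note [measurable] = um
  have fm: "?f \<in> borel_measurable ?M" using f by (simp add: L2_def)
  note [measurable] = fibre_coeff_measurable[OF fm]
  fix k
  show "AE z in ?M. F k z = leray_term \<gamma> ?f k z"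
  proof (cases "k = 0")
    case True
    have "AE z in ?M. leray_term \<gamma> ?f 0 z = angular_mode 0 (leray_mode \<gamma> 0 u) z"
    proof (rule leray_term_AE_eqI[OF g f])
      have "AE \<zeta> in fibre_measure \<gamma>. fibre_coeff \<gamma> ?f 0 \<zeta> = u \<zeta>"
        using AE_fibre_pos by eventually_elim (simp add: fibre_coeff_angular_mode)
      then show "leray_mode \<gamma> 0 (fibre_coeff \<gamma> ?f 0) z = leray_mode \<gamma> 0 u z" for z
        by (rule leray_mode_cong_AE[rotated 2]) measurable
    qed measurable
    then show ?thesis unfolding True by eventually_elim (simp add: F_def)
  next
    case False
    have "AE z in ?M. leray_term \<gamma> ?f k z = angular_mode k (\<lambda>\<zeta>. 0) z"
    proof (rule leray_term_AE_eqI[OF g f])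
      have "AE \<zeta> in fibre_measure \<gamma>. fibre_coeff \<gamma> ?f k \<zeta> = 0"
        using AE_fibre_pos by eventually_elim (simp add: fibre_coeff_angular_mode False)
      then have "leray_mode \<gamma> k (fibre_coeff \<gamma> ?f k) z = leray_mode \<gamma> k (\<lambda>\<zeta>. 0) z" for z
        by (rule leray_mode_cong_AE[rotated 2]) measurable
      then show "leray_mode \<gamma> k (fibre_coeff \<gamma> ?f k) z = 0" for z by (simp add: leray_mode_def)
    qed measurable
    then show ?thesis by eventually_elim (simp add: F_def False angular_mode_def)
  qed
qed

section \<open>The norm of the Leray transform\<close>

lemma leray_transform_onorm:
  assumes g: "\<gamma> > 1"
  shows "L2_onorm (surface_measure \<gamma>) (leray_transform \<gamma>) = \<gamma> / (2 * sqrt (\<gamma> - 1))"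
proof -
  let ?M = "surface_measure \<gamma>" and ?c = "\<gamma> / (2 * sqrt (\<gamma> - 1))"
  let ?q = "\<lambda>f. L2_norm ?M (leray_transform \<gamma> f) / L2_norm ?M f"
  have le: "?q f \<le> ?c" if "f \<in> L2 ?M" for f
  proof (cases "L2_norm ?M f = 0")
    case False
    then have "L2_norm ?M f > 0" using L2_norm_nonneg[of ?M f] by linarith
    then show ?thesis using leray_transform_norm_le[OF g that] by (simp add: pos_divide_le_eq)
  qed (use g in simp)
  obtain u where u: "u \<in> L2 (fibre_measure \<gamma>)" "L2_norm (fibre_measure \<gamma>) u > 0"
    "L2_norm (fibre_measure \<gamma>) (leray_mode \<gamma> 0 u) = ?c * L2_norm (fibre_measure \<gamma>) u"
    using leray_mode_0_extremal[OF g] by blast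
  let ?f = "angular_mode 0 u"
  have f: "?f \<in> L2 ?M" by (rule angular_mode_L2(1)[OF u(1)])
  have m: "leray_mode \<gamma> 0 u \<in> L2 (fibre_measure \<gamma>)" by (rule leray_mode_bounded(2)[OF g u(1)])
  have "L2_norm ?M (leray_transform \<gamma> ?f) = L2_norm ?M (angular_mode 0 (leray_mode \<gamma> 0 u))"
    by (rule L2_norm_cong_AE[OF leray_transform_L2[OF g f] angular_mode_L2(1)[OF m] leray_transform_angular_mode_0[OF g u(1)]])
  then have q: "?q ?f = ?c"
    using u(2) by (simp add: angular_mode_L2(2)[OF m] angular_mode_L2(2)[OF u(1)] u(3))
  have bdd: "bdd_above (?q ` L2 ?M)" by (rule bdd_aboveI2[of _ _ ?c]) (rule le)
  from q have "?c \<le> (SUP f\<in>L2 ?M. ?q f)"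
    using cSUP_upper[OF f bdd] by simp
  moreover have "(SUP f\<in>L2 ?M. ?q f) \<le> ?c"
    using f le by (intro cSUP_least) auto
  ultimately show ?thesis by (simp add: L2_onorm_def)
qed

theorem theorem1p3:
  fixes \<gamma> :: real
  assumes "\<gamma> > 1"
  shows "(\<forall>f \<in> L2 (surface_measure \<gamma>).
            L2_sums (surface_measure \<gamma>) (leray_term \<gamma> f) (leray_transform \<gamma> f))
       \<and> L2_bounded_operator (surface_measure \<gamma>) (leray_transform \<gamma>)
       \<and> (\<forall>f \<in> L2 (surface_measure \<gamma>). AE z in surface_measure \<gamma>.
            leray_transform \<gamma> (leray_transform \<gamma> f) z = leray_transform \<gamma> f z)
       \<and> L2_onorm (surface_measure \<gamma>) (leray_transform \<gamma>) = \<gamma> / (2 * sqrt (\<gamma> - 1))"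
proof (intro conjI ballI)
  note g = assms
  show "L2_sums (surface_measure \<gamma>) (leray_term \<gamma> f) (leray_transform \<gamma> f)" if "f \<in> L2 (surface_measure \<gamma>)" for f
    by (rule leray_transform_sums[OF g that])
  show "AE z in surface_measure \<gamma>. leray_transform \<gamma> (leray_transform \<gamma> f) z = leray_transform \<gamma> f z"
    if "f \<in> L2 (surface_measure \<gamma>)" for f
    by (rule leray_transform_idempotent[OF g that])
  show "L2_onorm (surface_measure \<gamma>) (leray_transform \<gamma>) = \<gamma> / (2 * sqrt (\<gamma> - 1))"
    by (rule leray_transform_onorm[OF g])
  show "L2_bounded_operator (surface_measure \<gamma>) (leray_transform \<gamma>)"
    unfolding L2_bounded_operator_def
  proof (intro conjI ballI allI impI)
    fix f h assume f: "f \<in> L2 (surface_measure \<gamma>)" and h: "h \<in> L2 (surface_measure \<gamma>)"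
      and eq: "AE z in surface_measure \<gamma>. f z = h z"
    have m: "f \<in> borel_measurable (surface_measure \<gamma>)" "h \<in> borel_measurable (surface_measure \<gamma>)"
      using f h by (auto simp: L2_def)
    show "AE z in surface_measure \<gamma>. leray_transform \<gamma> f z = leray_transform \<gamma> h z"
      by (rule leray_transform_cong_AE[OF g f h])
         (rule leray_mode_cong_AE[OF fibre_coeff_measurable[OF m(1)] fibre_coeff_measurable[OF m(2)] fibre_coeff_cong_AE[OF f h eq]])
  next
    show "\<exists>C. \<forall>f\<in>L2 (surface_measure \<gamma>). L2_norm (surface_measure \<gamma>) (leray_transform \<gamma> f) \<le> C * L2_norm (surface_measure \<gamma>) f"
      using leray_transform_norm_le[OF g] by blast
  qed (use leray_transform_L2[OF g] leray_transform_add[OF g] leray_transform_cmult[OF g] in auto)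
qed


end
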